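(* Let $\mathfrak g$ be a semisimple Lie algebra over $\Bbbk$. For any $\vartheta\in\mathrm{Aut}(\mathfrak g)$ of finite order $m\ge 2$, one has $$\mathrm{ind}\,\mathfrak g_{(\infty)}=\dim\mathfrak g_0+\mathrm{rk}\,\mathfrak g-\mathrm{rk}\,\mathfrak g_0 .$$
   Context: The ground field $\Bbbk$ is algebraically closed of characteristic $0$; Lie algebras are finite-dimensional. Fix a primitive $m$-th root of unity $\zeta$; for $j\in\{0,\dots,m-1\}$ let $\mathfrak g_j=\{x\in\mathfrak g\mid\vartheta(x)=\zeta^jx\}$. Then $\mathfrak g_0=\mathfrak g^\vartheta$ is a reductive subalgebra. $\mathfrak g_{(\infty)}$ is the Lie algebra with the same underlying vector space as $\mathfrak g$ and the bracket $[\,,\,]_\infty$ given, for $x\in\mathfrak g_i$, $y\in\mathfrak g_j$ with $i,j\in\{0,\dots,m-1\}$, by $[x,y]_\infty=0$ if $i+j<m$ and $[x,y]_\infty=[x,y]$ if $i+j\ge m$. The index of a Lie algebra $\mathfrak q$ is $\mathrm{ind}\,\mathfrak q=\min_{\xi\in\mathfrak q^*}\dim\mathfrak q^\xi$, where $\mathfrak q^\xi=\{x\in\mathfrak q\mid \mathrm{ad}^*(x)\cdot\xi=0\}$ is the stabiliser of $\xi$ for the coadjoint representation. The rank $\mathrm{rk}$ of a reductive Lie algebra is the dimension of a Cartan subalgebra. *)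

theory Defs
  imports "HOL-Computational_Algebra.Computational_Algebra"
begin

definition primitive_root_of_unity :: "nat \<Rightarrow> 'k::field \<Rightarrow> bool" where
  "primitive_root_of_unity m \<zeta> \<longleftrightarrow> m > 0 \<and> \<zeta> ^ m = 1 \<and> (\<forall>k. 0 < k \<and> k < m \<longrightarrow> \<zeta> ^ k \<noteq> 1)"

definition has_order :: "('a \<Rightarrow> 'a) \<Rightarrow> nat \<Rightarrow> bool" where
  "has_order f m \<longleftrightarrow> m > 0 \<and> f ^^ m = id \<and> (\<forall>k. 0 < k \<and> k < m \<longrightarrow> f ^^ k \<noteq> id)"

text \<open>The underlying space of a Lie algebra is the whole type \<open>'g\<close>; subalgebras are subsets.
  \<open>Basis\<close> only witnesses finite dimension.\<close>

locale lie_algebra = finite_dimensional_vector_space scale Basis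
  for scale :: "'k::{alg_closed_field,field_char_0} \<Rightarrow> 'g::ab_group_add \<Rightarrow> 'g" (infixr "*s" 75)
    and Basis :: "'g set" +
  fixes br :: "'g \<Rightarrow> 'g \<Rightarrow> 'g"
  assumes linear_br_left: "Vector_Spaces.linear scale scale (\<lambda>x. br x y)"
    and linear_br_right: "Vector_Spaces.linear scale scale (\<lambda>y. br x y)"
    and br_self: "br x x = 0"
    and jacobi: "br x (br y z) + br y (br z x) + br z (br x y) = 0"
begin

definition subalgebra :: "'g set \<Rightarrow> bool" where
  "subalgebra L \<longleftrightarrow> subspace L \<and> (\<forall>x\<in>L. \<forall>y\<in>L. br x y \<in> L)"

definition lie_ideal :: "'g set \<Rightarrow> bool" where
  "lie_ideal I \<longleftrightarrow> subspace I \<and> (\<forall>x. \<forall>y\<in>I. br x y \<in> I)"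

definition commutator :: "'g set \<Rightarrow> 'g set \<Rightarrow> 'g set" where
  "commutator A B = span {br x y | x y. x \<in> A \<and> y \<in> B}"

definition solvable :: "'g set \<Rightarrow> bool" where
  "solvable L \<longleftrightarrow> (\<exists>n. ((\<lambda>D. commutator D D) ^^ n) L = {0})"

definition nilpotent :: "'g set \<Rightarrow> bool" where
  "nilpotent L \<longleftrightarrow> (\<exists>n. (commutator L ^^ n) L = {0})"

definition semisimple :: bool where
  "semisimple \<longleftrightarrow> (\<forall>I. lie_ideal I \<and> solvable I \<longrightarrow> I = {0})"

definition cartan_subalgebra :: "'g set \<Rightarrow> 'g set \<Rightarrow> bool" where
  "cartan_subalgebra L H \<longleftrightarrow> subalgebra H \<and> H \<subseteq> L \<and> nilpotent H \<and>
     {x \<in> L. \<forall>h\<in>H. br x h \<in> H} = H"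

text \<open>All Cartan subalgebras of a Lie algebra over an algebraically closed field of
  characteristic \<open>0\<close> have the same dimension, so the choice does not matter.\<close>

definition rank :: "'g set \<Rightarrow> nat" where
  "rank L = dim (SOME H. cartan_subalgebra L H)"

definition dual :: "('g \<Rightarrow> 'k) set" where
  "dual = {\<xi>. Vector_Spaces.linear scale (*) \<xi>}"

definition coad :: "'g \<Rightarrow> ('g \<Rightarrow> 'k) \<Rightarrow> ('g \<Rightarrow> 'k)" where
  "coad x \<xi> = (\<lambda>y. - \<xi> (br x y))"

definition stabiliser :: "('g \<Rightarrow> 'k) \<Rightarrow> 'g set" where
  "stabiliser \<xi> = {x. coad x \<xi> = (\<lambda>_. 0)}"

definition index :: nat where
  "index = (LEAST d. \<exists>\<xi>\<in>dual. dim (stabiliser \<xi>) = d)"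

definition automorphism :: "('g \<Rightarrow> 'g) \<Rightarrow> bool" where
  "automorphism \<theta> \<longleftrightarrow> Vector_Spaces.linear scale scale \<theta> \<and> bij \<theta> \<and>
     (\<forall>x y. \<theta> (br x y) = br (\<theta> x) (\<theta> y))"

definition grade :: "('g \<Rightarrow> 'g) \<Rightarrow> 'k \<Rightarrow> nat \<Rightarrow> 'g set" where
  "grade \<theta> \<zeta> j = {x. \<theta> x = \<zeta> ^ j *s x}"

text \<open>The family of components of \<open>x\<close> in the decomposition of \<open>'g\<close> as the direct sum of the
  subspaces \<open>grade \<theta> \<zeta> j\<close> with \<open>j < m\<close>.\<close>

definition component :: "('g \<Rightarrow> 'g) \<Rightarrow> 'k \<Rightarrow> nat \<Rightarrow> 'g \<Rightarrow> nat \<Rightarrow> 'g" where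
  "component \<theta> \<zeta> m x =
     (THE u. (\<forall>j<m. u j \<in> grade \<theta> \<zeta> j) \<and> (\<forall>j\<ge>m. u j = 0) \<and> x = (\<Sum>j<m. u j))"

text \<open>The bracket of \<open>\<gg>\<^bsub>(\<infinity>)\<^esub>\<close>, extended bilinearly from homogeneous elements;
  see \<open>br_inf_homogeneous\<close> and \<open>lie_algebra_br_inf\<close> below.\<close>

definition br_inf :: "('g \<Rightarrow> 'g) \<Rightarrow> 'k \<Rightarrow> nat \<Rightarrow> 'g \<Rightarrow> 'g \<Rightarrow> 'g" where
  "br_inf \<theta> \<zeta> m x y = (\<Sum>i<m. \<Sum>j<m.
     if i + j < m then 0 else br (component \<theta> \<zeta> m x i) (component \<theta> \<zeta> m y j))"

end

locale lie_algebra_automorphism = lie_algebra scale Basis br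
  for scale :: "'k::{alg_closed_field,field_char_0} \<Rightarrow> 'g::ab_group_add \<Rightarrow> 'g" (infixr "*s" 75)
    and Basis br +
  fixes \<theta> :: "'g \<Rightarrow> 'g" and \<zeta> :: 'k and m :: nat
  assumes aut: "automorphism \<theta>"
    and ord: "has_order \<theta> m"
    and root: "primitive_root_of_unity m \<zeta>"
begin

lemma m_pos: "m > 0" and root_pow: "\<zeta> ^ m = 1" and \<zeta>_nz: "\<zeta> \<noteq> 0"
  using root unfolding primitive_root_of_unity_def by (auto simp: power_0_left)

sublocale theta: Vector_Spaces.linear scale scale \<theta>
  using aut unfolding automorphism_def by blast

sublocale bl: Vector_Spaces.linear scale scale "\<lambda>x. br x y" for y
  by (rule linear_br_left)

sublocale brr: Vector_Spaces.linear scale scale "\<lambda>y. br x y" for x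
  by (rule linear_br_right)

lemma theta_pow_add: "(\<theta> ^^ k) (x + y) = (\<theta> ^^ k) x + (\<theta> ^^ k) y"
  by (induction k) (auto simp: theta.add)

lemma theta_pow_scale: "(\<theta> ^^ k) (c *s x) = c *s (\<theta> ^^ k) x"
  by (induction k) (auto simp: theta.scale)

definition proj :: "nat \<Rightarrow> 'g \<Rightarrow> 'g" where
  "proj j x = inverse (of_nat m) *s (\<Sum>k<m. inverse \<zeta> ^ (j * k) *s (\<theta> ^^ k) x)"

lemma linear_proj: "Vector_Spaces.linear scale scale (proj j)"
  by unfold_locales
    (simp_all add: proj_def theta_pow_add theta_pow_scale scale_right_distrib sum.distrib
      scale_sum_right mult_ac)

sublocale proj: Vector_Spaces.linear scale scale "proj j" for j
  by (rule linear_proj)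

lemma proj_in_grade: "proj j x \<in> grade \<theta> \<zeta> j"
proof -
  define f where "f k = inverse \<zeta> ^ (j * k) *s (\<theta> ^^ k) x" for k
  have step: "\<theta> (f k) = \<zeta> ^ j *s f (Suc k)" for k
    using \<zeta>_nz by (simp add: f_def theta.scale power_add[symmetric] power_add power_inverse)
  have "\<theta> ^^ m = id" using ord by (simp add: has_order_def)
  then have "f m = f 0"
    using root_pow by (simp add: f_def mult.commute[of j] power_mult power_inverse)
  then have shift: "(\<Sum>k<m. f (Suc k)) = (\<Sum>k<m. f k)"
    using sum.lessThan_Suc_shift[of f m] by (simp add: add.commute)
  have "\<theta> (proj j x) = inverse (of_nat m) *s (\<Sum>k<m. \<theta> (f k))"
    by (simp add: proj_def f_def theta.scale theta.sum)
  also have "\<dots> = \<zeta> ^ j *s (inverse (of_nat m) *s (\<Sum>k<m. f (Suc k)))"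
    by (simp add: step scale_sum_right mult.commute)
  finally have "\<theta> (proj j x) = \<zeta> ^ j *s (inverse (of_nat m) *s (\<Sum>k<m. f k))"
    by (simp only: shift)
  then show ?thesis by (simp only: grade_def proj_def f_def mem_Collect_eq)
qed

lemma root_sum:
  assumes "i < m" "j < m"
  shows "(\<Sum>k<m. (\<zeta> ^ i * inverse \<zeta> ^ j) ^ k) = (if i = j then of_nat m else 0)"
proof (cases "i = j")
  case True
  then show ?thesis using \<zeta>_nz by (simp add: power_mult_distrib[symmetric])
next
  case False
  let ?z = "\<zeta> ^ i * inverse \<zeta> ^ j"
  have neq: "\<zeta> ^ a \<noteq> \<zeta> ^ b" if "a < b" "b < m" for a b
  proof
    assume eq: "\<zeta> ^ a = \<zeta> ^ b"
    have "\<zeta> ^ b = \<zeta> ^ a * \<zeta> ^ (b - a)" using that by (simp add: power_add[symmetric])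
    then have "\<zeta> ^ (b - a) = 1" using eq \<zeta>_nz by simp
    moreover have "0 < b - a" "b - a < m" using that by auto
    ultimately show False using root unfolding primitive_root_of_unity_def by blast
  qed
  have "\<zeta> ^ i \<noteq> \<zeta> ^ j" using neq[of i j] neq[of j i] assms False by (metis linorder_neqE_nat)
  then have "?z \<noteq> 1" using \<zeta>_nz by (simp add: power_inverse field_simps)
  moreover have "?z ^ m = 1"
  proof -
    have "(\<zeta> ^ l) ^ m = 1" for l
      using root_pow by (metis mult.commute power_mult power_one)
    then show ?thesis by (simp add: power_mult_distrib power_inverse)
  qed
  ultimately show ?thesis using False by (simp add: geometric_sum)
qed

lemma proj_grade:
  assumes "u \<in> grade \<theta> \<zeta> i" "i < m" "j < m"
  shows "proj j u = (if i = j then u else 0)"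
proof -
  have pw: "(\<theta> ^^ k) u = (\<zeta> ^ i) ^ k *s u" for k
    using assms(1) by (induction k) (auto simp: grade_def theta.scale mult.commute)
  have "proj j u = inverse (of_nat m) *s ((\<Sum>k<m. (\<zeta> ^ i * inverse \<zeta> ^ j) ^ k) *s u)"
    by (simp add: proj_def pw scale_sum_left power_mult_distrib power_mult mult.commute[of _ "(\<zeta> ^ i) ^ _"])
  then show ?thesis using root_sum[OF assms(2,3)] m_pos by simp
qed

lemma sum_proj: "(\<Sum>j<m. proj j x) = x"
proof -
  have "(\<Sum>j<m. proj j x) =
      inverse (of_nat m) *s (\<Sum>k<m. (\<Sum>j<m. inverse \<zeta> ^ (j * k)) *s (\<theta> ^^ k) x)"
    by (simp add: proj_def scale_sum_right[symmetric] scale_sum_left) (subst sum.swap, simp)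
  also have "(\<Sum>k<m. (\<Sum>j<m. inverse \<zeta> ^ (j * k)) *s (\<theta> ^^ k) x) =
      (\<Sum>k<m. if k = 0 then of_nat m *s x else 0)"
  proof (rule sum.cong)
    fix k assume "k \<in> {..<m}"
    then have "(\<Sum>j<m. (\<zeta> ^ 0 * inverse \<zeta> ^ k) ^ j) = (if 0 = k then of_nat m else 0)"
      using m_pos by (intro root_sum) auto
    then show "(\<Sum>j<m. inverse \<zeta> ^ (j * k)) *s (\<theta> ^^ k) x = (if k = 0 then of_nat m *s x else 0)"
      by (auto simp: power_mult[symmetric] mult.commute)
  qed simp
  finally show ?thesis using m_pos by simp
qed

lemma component_eqI:
  assumes "\<And>j. j < m \<Longrightarrow> u j \<in> grade \<theta> \<zeta> j" "\<And>j. j \<ge> m \<Longrightarrow> u j = 0" "x = (\<Sum>j<m. u j)"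
  shows "component \<theta> \<zeta> m x = u"
  unfolding component_def
proof (rule the_equality)
  have *: "v j = proj j x"
    if "\<forall>j<m. v j \<in> grade \<theta> \<zeta> j" "x = (\<Sum>j<m. v j)" "j < m" for v j
  proof -
    have "proj j x = (\<Sum>i<m. proj j (v i))" using that by (simp add: proj.sum)
    also have "\<dots> = (\<Sum>i<m. if i = j then v i else 0)"
      using that by (intro sum.cong) (auto simp: proj_grade)
    finally show ?thesis using that by simp
  qed
  fix v assume v: "(\<forall>j<m. v j \<in> grade \<theta> \<zeta> j) \<and> (\<forall>j\<ge>m. v j = 0) \<and> x = (\<Sum>j<m. v j)"
  show "v = u"
  proof
    fix j show "v j = u j"
      using *[of v j] *[of u j] v assms by (cases "j < m") auto
  qed
qed (use assms in auto)

lemma component_eq_proj: "component \<theta> \<zeta> m x = (\<lambda>j. if j < m then proj j x else 0)"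
  by (rule component_eqI) (auto simp: proj_in_grade sum_proj)

lemma br_inf_proj:
  "br_inf \<theta> \<zeta> m x y = (\<Sum>i<m. \<Sum>j<m. if i + j < m then 0 else br (proj i x) (proj j y))"
  by (simp add: br_inf_def component_eq_proj cong: if_cong)

lemma br_inf_homogeneous:
  assumes "x \<in> grade \<theta> \<zeta> i" "y \<in> grade \<theta> \<zeta> j" "i < m" "j < m"
  shows "br_inf \<theta> \<zeta> m x y = (if i + j < m then 0 else br x y)"
proof -
  have "br_inf \<theta> \<zeta> m x y =
      (\<Sum>k<m. \<Sum>l<m. if l = j then if k = i then if i + j < m then 0 else br x y else 0 else 0)"
    unfolding br_inf_proj using assms by (intro sum.cong) (auto simp: proj_grade)
  then show ?thesis using assms by simp
qed

lemma linear_br_inf_left: "Vector_Spaces.linear scale scale (\<lambda>x. br_inf \<theta> \<zeta> m x y)"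
  by unfold_locales
    (auto simp: br_inf_proj proj.add proj.scale bl.add bl.scale scale_sum_right
      sum.distrib[symmetric] intro!: sum.cong)

lemma linear_br_inf_right: "Vector_Spaces.linear scale scale (\<lambda>y. br_inf \<theta> \<zeta> m x y)"
  by unfold_locales
    (auto simp: br_inf_proj proj.add proj.scale brr.add brr.scale scale_sum_right
      sum.distrib[symmetric] intro!: sum.cong)

lemma br_antisym: "br x y = - br y x"
proof -
  have "br (x + y) (x + y) = br x y + br y x"
    by (simp only: bl.add brr.add) (simp add: br_self)
  then have "br x y + br y x = 0" by (metis br_self)
  then show ?thesis by (simp only: eq_neg_iff_add_eq_0)
qed

lemma br_grade:
  assumes "x \<in> grade \<theta> \<zeta> i" "y \<in> grade \<theta> \<zeta> j"
  shows "br x y \<in> grade \<theta> \<zeta> (i + j)"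
  using assms aut
  by (simp add: grade_def automorphism_def bl.scale brr.scale power_add mult.commute)

lemma br_inf_self: "br_inf \<theta> \<zeta> m x x = 0"
proof -
  let ?f = "\<lambda>i j. if i + j < m then 0 else br (proj i x) (proj j x)"
  have *: "?f i j = - ?f j i" for i j
    using br_antisym[of "proj i x" "proj j x"] by (simp add: add.commute)
  have "(\<Sum>i<m. \<Sum>j<m. ?f i j) = (\<Sum>j<m. \<Sum>i<m. ?f i j)" by (rule sum.swap)
  also have "\<dots> = (\<Sum>j<m. \<Sum>i<m. - ?f j i)" by (intro sum.cong refl *)
  finally have eq: "br_inf \<theta> \<zeta> m x x = - br_inf \<theta> \<zeta> m x x"
    by (simp add: br_inf_proj sum_negf)
  then have "br_inf \<theta> \<zeta> m x x + br_inf \<theta> \<zeta> m x x = 0"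
    by (metis add.right_inverse)
  then have "(2::'k) *s br_inf \<theta> \<zeta> m x x = 0"
    by (metis one_add_one scale_left_distrib scale_one)
  then show ?thesis by simp
qed

lemma br_inf_br_inf_homogeneous:
  assumes "x \<in> grade \<theta> \<zeta> i" "y \<in> grade \<theta> \<zeta> j" "z \<in> grade \<theta> \<zeta> k" "i < m" "j < m" "k < m"
  shows "br_inf \<theta> \<zeta> m x (br_inf \<theta> \<zeta> m y z) = (if i + j + k < 2 * m then 0 else br x (br y z))"
proof (cases "j + k < m")
  case True
  then show ?thesis using assms
    by (simp add: br_inf_homogeneous[OF assms(2,3)] module_hom.zero[OF
      linear_br_inf_right[unfolded module_hom_iff_linear[symmetric]]])
next
  case False
  have "\<zeta> ^ (j + k) = \<zeta> ^ (j + k - m) * \<zeta> ^ m" using False by (simp flip: power_add)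
  then have "br y z \<in> grade \<theta> \<zeta> (j + k - m)"
    using br_grade[OF assms(2,3)] root_pow by (simp add: grade_def)
  then show ?thesis using False assms
    by (auto simp: br_inf_homogeneous[OF assms(2,3)] br_inf_homogeneous[OF assms(1), of _ "j + k - m"])
qed

lemma jacobi_br_inf:
  "br_inf \<theta> \<zeta> m x (br_inf \<theta> \<zeta> m y z) + br_inf \<theta> \<zeta> m y (br_inf \<theta> \<zeta> m z x)
     + br_inf \<theta> \<zeta> m z (br_inf \<theta> \<zeta> m x y) = 0"
proof -
  let ?b = "br_inf \<theta> \<zeta> m"
  interpret l: Vector_Spaces.linear scale scale "\<lambda>u. ?b u v" for v by (rule linear_br_inf_left)
  interpret r: Vector_Spaces.linear scale scale "\<lambda>v. ?b u v" for u by (rule linear_br_inf_right)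
  define J where "J x y z = ?b x (?b y z) + ?b y (?b z x) + ?b z (?b x y)" for x y z
  have hom: "J (proj i x) (proj j y) (proj k z) = 0" if "i < m" "j < m" "k < m" for i j k
  proof -
    have "j + k + i = i + j + k" "k + i + j = i + j + k" by auto
    then show ?thesis
      using br_inf_br_inf_homogeneous[OF proj_in_grade proj_in_grade proj_in_grade, of i j k x y z]
        br_inf_br_inf_homogeneous[OF proj_in_grade proj_in_grade proj_in_grade, of j k i y z x]
        br_inf_br_inf_homogeneous[OF proj_in_grade proj_in_grade proj_in_grade, of k i j z x y]
        jacobi that by (simp add: J_def)
  qed
  have sJ1: "J (\<Sum>i<m. f i) y z = (\<Sum>i<m. J (f i) y z)" for f y z
    by (simp add: J_def l.sum r.sum sum.distrib)
  have sJ2: "J x (\<Sum>i<m. f i) z = (\<Sum>i<m. J x (f i) z)" for f x z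
    by (simp add: J_def l.sum r.sum sum.distrib)
  have sJ3: "J x y (\<Sum>i<m. f i) = (\<Sum>i<m. J x y (f i))" for f x y
    by (simp add: J_def l.sum r.sum sum.distrib)
  have "J x y z = J (\<Sum>i<m. proj i x) (\<Sum>j<m. proj j y) (\<Sum>k<m. proj k z)"
    by (simp only: sum_proj)
  also have "\<dots> = (\<Sum>i<m. \<Sum>j<m. \<Sum>k<m. J (proj i x) (proj j y) (proj k z))"
    by (subst sJ1, subst sJ2, subst sJ3) (rule refl)
  also have "\<dots> = (\<Sum>i<m. \<Sum>j<m. \<Sum>k<m. 0)"
    by (intro sum.cong refl hom) auto
  finally have "J x y z = 0" by simp
  then show ?thesis unfolding J_def .
qed

lemma lie_algebra_br_inf: "lie_algebra scale Basis (br_inf \<theta> \<zeta> m)"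
  by (intro lie_algebra.intro lie_algebra_axioms.intro finite_dimensional_vector_space_axioms
      linear_br_inf_left linear_br_inf_right br_inf_self jacobi_br_inf)

end

end

theory Submission
  imports Defs
begin

text \<open>
  In the contraction, degree \<open>0\<close> is central.  So the index is \<open>dim \<gg>\<^sub>0\<close> plus the least
  dimension of the kernel, among vectors without component of degree \<open>0\<close>, of the form
  \<open>(x, y) \<mapsto> \<xi> [x, y]\<^sub>\<infinity>\<close>.  Writing \<open>\<xi>\<close> as the Killing form with an element \<open>z\<close> and giving
  degree \<open>m - i\<close> to the component of degree \<open>i > 0\<close>, this kernel consists of the vectors killed by
  the part of \<open>ad z\<close> in which the new degrees add up without wrapping around modulo \<open>m\<close>
  (\<open>killing_br_inf\<close>).  Two estimates show that the least dimension is \<open>rk \<gg> - rk \<gg>\<^sub>0\<close>.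

  The lower bound is semicontinuity.  If the part of the bracket that wraps around is multiplied by
  \<open>t \<noteq> 0\<close>, the result is a rescaling of the original bracket, where all centralizers have
  dimension at least \<open>rk \<gg>\<close>; this persists at \<open>t = 0\<close>.  The kernel obtained there projects to the
  centralizer in \<open>\<gg>\<^sub>0\<close> of the component of \<open>z\<close> of degree \<open>0\<close>, whose dimension is \<open>rk \<gg>\<^sub>0\<close> for
  generic \<open>z\<close>; semicontinuity extends the bound to all \<open>z\<close> (\<open>rank_le_dim_reduced_kernel\<close>).

  Equality holds when \<open>z\<close> is fixed by the automorphism, regular in \<open>\<gg>\<^sub>0\<close> and regular in \<open>\<gg>\<close>.  Such
  an element exists (\<open>regular_element_fixed\<close>): let \<open>C\<close> be the centralizer in \<open>\<gg>\<close> of a Cartan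
  subalgebra \<open>H\<close> of \<open>\<gg>\<^sub>0\<close>.  Then \<open>C = H \<oplus> D\<close> where the automorphism has no fixed points on the
  subalgebra \<open>D\<close>.  By Kreknin's theorem \<open>D\<close> is solvable, and since the Killing form is
  nondegenerate on it, \<open>D\<close> is abelian.  So \<open>C\<close> is a Cartan subalgebra of \<open>\<gg>\<close>.

  All this rests on the structure theory of the Killing form: Engel's theorem, Cartan's criterion
  (\<open>killing_nondegenerate\<close>) and the existence of Cartan subalgebras.  The rank refers to an
  arbitrary Cartan subalgebra.  That its dimension is the least dimension of a centralizer replaces
  the conjugacy of Cartan subalgebras; it is proved by transporting the Cartan subalgebra along a
  line, with formal power series (\<open>abelian_fitting_minimal\<close>).  The same argument applies to
  \<open>\<gg>\<^sub>0\<close>, where only the nondegeneracy of the Killing form of \<open>\<gg>\<close> is used.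
\<close>

section \<open>Operators on a finite-dimensional space over an algebraically closed field\<close>

lemma homogeneous_system_nontrivial_solution:
  fixes M :: "'i \<Rightarrow> 'j \<Rightarrow> 'k::field"
  assumes "finite I" "finite J" "card J < card I"
  shows "\<exists>a. (\<exists>i\<in>I. a i \<noteq> 0) \<and> (\<forall>j\<in>J. (\<Sum>i\<in>I. a i * M i j) = 0)"
  using assms(2,1,3)
proof (induction J arbitrary: I M rule: finite_induct)
  case empty
  then have "I \<noteq> {}" by auto
  then show ?case by (intro exI[of _ "\<lambda>_. 1"]) auto
next
  case (insert j J)
  show ?case
  proof (cases "\<forall>i\<in>I. M i j = 0")
    case True
    have "card J < card I" using insert.prems insert.hyps by simp
    from insert.IH[OF insert.prems(1) this, of M] obtain a
      where "\<exists>i\<in>I. a i \<noteq> 0" "\<forall>j\<in>J. (\<Sum>i\<in>I. a i * M i j) = 0" by blast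
    then show ?thesis using True by (intro exI[of _ a]) (auto intro!: sum.neutral)
  next
    case False
    then obtain i0 where i0: "i0 \<in> I" "M i0 j \<noteq> 0" by blast
    let ?I = "I - {i0}"
    define M' where "M' i l = M i l - M i j / M i0 j * M i0 l" for i l
    have "card J < card ?I" using insert.prems insert.hyps i0 by (simp add: card_Diff_singleton)
    from insert.IH[OF _ this, of M'] insert.prems(1) obtain a
      where a: "\<exists>i\<in>?I. a i \<noteq> 0" "\<forall>l\<in>J. (\<Sum>i\<in>?I. a i * M' i l) = 0" by blast
    define c where "c = - (\<Sum>i\<in>?I. a i * (M i j / M i0 j))"
    define b where "b = a(i0 := c)"
    have split: "(\<Sum>i\<in>I. b i * M i l) = c * M i0 l + (\<Sum>i\<in>?I. a i * M i l)" for l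
    proof -
      have "(\<Sum>i\<in>I. b i * M i l) = b i0 * M i0 l + (\<Sum>i\<in>?I. b i * M i l)"
        using insert.prems(1) i0 by (simp add: sum.remove)
      also have "(\<Sum>i\<in>?I. b i * M i l) = (\<Sum>i\<in>?I. a i * M i l)"
        by (intro sum.cong) (auto simp: b_def)
      finally show ?thesis by (simp add: b_def)
    qed
    have M': "(\<Sum>i\<in>?I. a i * M' i l) = (\<Sum>i\<in>I. b i * M i l)" for l
      unfolding split c_def M'_def
      by (simp add: right_diff_distrib sum_subtractf sum_distrib_right mult.assoc)
    have "M' i j = 0" for i using i0 by (simp add: M'_def)
    then have "(\<Sum>i\<in>I. b i * M i j) = 0" using M'[of j] by simp
    then have "\<forall>l\<in>insert j J. (\<Sum>i\<in>I. b i * M i l) = 0" using a(2) M' by auto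
    moreover have "\<exists>i\<in>I. b i \<noteq> 0" using a(1) by (auto simp: b_def)
    ultimately show ?thesis by blast
  qed
qed

locale alg_closed_space = finite_dimensional_vector_space scale Basis
  for scale :: "'k::{alg_closed_field,field_char_0} \<Rightarrow> 'g::ab_group_add \<Rightarrow> 'g" (infixr "*s" 75)
    and Basis :: "'g set"
begin

abbreviation lin :: "('g \<Rightarrow> 'g) \<Rightarrow> bool" where
  "lin \<equiv> Vector_Spaces.linear scale scale"

lemma linI: "(\<And>x y. f (x + y) = f x + f y) \<Longrightarrow> (\<And>c x. f (c *s x) = c *s f x) \<Longrightarrow> lin f"
  by unfold_locales auto

sublocale self: vector_space_pair scale scale by unfold_locales

context
begin

interpretation to_field: vector_space_pair scale "(*)"
  by unfold_locales (auto simp: algebra_simps)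

lemmas form_zero = to_field.linear_0
  and form_add = to_field.linear_add
  and form_scale = to_field.linear_scale
  and form_diff = to_field.linear_diff
  and form_neg = to_field.linear_neg
  and form_sum = to_field.linear_sum
  and form_eq_on = to_field.linear_eq_on

end

lemmas lin_add = self.linear_add
  and lin_scale = self.linear_scale
  and lin_zero = self.linear_0
  and lin_diff = self.linear_diff
  and lin_neg = self.linear_neg
  and lin_sum = self.linear_sum

lemma formI:
  "(\<And>x y. f (x + y) = f x + f y) \<Longrightarrow> (\<And>c x. f (c *s x) = c * f x)
    \<Longrightarrow> Vector_Spaces.linear scale (*) f"
  by unfold_locales (simp_all add: algebra_simps)

lemma lin_compose: "lin f \<Longrightarrow> lin g \<Longrightarrow> lin (\<lambda>x. f (g x))"
  by (rule linI) (simp_all add: lin_add lin_scale)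

lemma lin_plus: "lin f \<Longrightarrow> lin g \<Longrightarrow> lin (\<lambda>x. f x + g x)"
  by (rule linI) (simp_all add: lin_add lin_scale scale_right_distrib algebra_simps)

lemma lin_minus: "lin f \<Longrightarrow> lin g \<Longrightarrow> lin (\<lambda>x. f x - g x)"
  by (rule linI) (simp_all add: lin_add lin_scale scale_right_diff_distrib algebra_simps)

lemma lin_scaled: "lin f \<Longrightarrow> lin (\<lambda>x. c *s f x)"
  by (rule linI) (simp_all add: lin_add lin_scale scale_right_distrib mult.commute)

lemma lin_sums: "(\<And>i. i \<in> I \<Longrightarrow> lin (f i)) \<Longrightarrow> lin (\<lambda>x. \<Sum>i\<in>I. f i x)"
  by (rule linI) (simp_all add: lin_add lin_scale sum.distrib scale_sum_right)

lemma lin_id: "lin (\<lambda>x. x)" and lin_0: "lin (\<lambda>x. 0)"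
  by (rule linI; simp)+

lemma lin_funpow: "lin f \<Longrightarrow> lin (f ^^ n)"
  by (induction n) (auto simp: lin_id[folded id_def] intro: Vector_Spaces.linear_compose)

lemma subspace_kernel: "lin f \<Longrightarrow> subspace {x. f x = 0}"
  by (rule self.linear_subspace_kernel)

lemma subspace_kernel_on: "lin f \<Longrightarrow> subspace U \<Longrightarrow> subspace {x \<in> U. f x = 0}"
  using subspace_inter[OF _ subspace_kernel[of f], of U] by (simp add: Int_def)

lemma sum_rep: "(\<Sum>b\<in>Basis. representation Basis v b *s b) = v"
  by (rule sum_representation_eq) (auto simp: independent_Basis finite_Basis span_Basis)

lemma rep_lin: "Vector_Spaces.linear scale (*) (\<lambda>v. representation Basis v b)"
  by (rule linear_representation) (auto simp: independent_Basis span_Basis)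

lemma eq_iff_rep: "x = y \<longleftrightarrow> (\<forall>b\<in>Basis. representation Basis x b = representation Basis y b)"
proof
  assume "\<forall>b\<in>Basis. representation Basis x b = representation Basis y b"
  then have "(\<Sum>b\<in>Basis. representation Basis x b *s b) = (\<Sum>b\<in>Basis. representation Basis y b *s b)"
    by (intro sum.cong) auto
  then show "x = y" by (simp only: sum_rep)
qed simp

lemma rep_sum_scale:
  "representation Basis (\<Sum>i\<in>I. c i *s v i) b = (\<Sum>i\<in>I. c i * representation Basis (v i) b)"
  by (simp add: form_sum[OF rep_lin] form_scale[OF rep_lin])

lemma dim_kernel_image:
  assumes f: "lin f" and U: "subspace U"
  shows "dim {x \<in> U. f x = 0} + dim (f ` U) = dim U"
proof -
  interpret pair: finite_dimensional_vector_space_pair_1 scale Basis scale by unfold_locales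
  obtain g where g: "g ` UNIV \<subseteq> U" "lin g" "\<forall>v\<in>f ` U. f (g v) = v"
    using self.linear_exists_right_inverse_on[OF f U] by blast
  let ?K = "{x \<in> U. f x = 0}" and ?G = "g ` (f ` U)"
  have sub: "subspace ?K" "subspace ?G"
    using subspace_kernel_on[OF f U] f g(2) U by (auto intro!: self.linear_subspace_image)
  have "{x + y |x y. x \<in> ?K \<and> y \<in> ?G} = U"
  proof
    show "{x + y |x y. x \<in> ?K \<and> y \<in> ?G} \<subseteq> U" using g(1) U by (auto intro!: subspace_add)
    show "U \<subseteq> {x + y |x y. x \<in> ?K \<and> y \<in> ?G}"
    proof
      fix u assume u: "u \<in> U"
      have "u - g (f u) \<in> ?K"
        using u g(1,3) U by (auto intro!: subspace_diff simp: lin_diff[OF f])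
      moreover have "g (f u) \<in> ?G" using u by blast
      moreover have "u = (u - g (f u)) + g (f u)" by simp
      ultimately show "u \<in> {x + y |x y. x \<in> ?K \<and> y \<in> ?G}" by blast
    qed
  qed
  moreover have "?K \<inter> ?G = {0}"
    using g(3) f g(2) U subspace_0[OF sub(1)] subspace_0[OF sub(2)]
    by (auto simp: lin_zero[OF g(2)])
  moreover have "dim ?G = dim (f ` U)"
  proof (rule pair.dim_image_eq[OF g(2)])
    have "span (f ` U) = f ` U" using f U by (simp add: span_eq_iff self.linear_subspace_image)
    then show "inj_on g (span (f ` U))" using g(3) by (metis inj_on_inverseI)
  qed
  ultimately show ?thesis using dim_sums_Int[OF sub] by simp
qed

lemma dim_direct_sum:
  assumes "subspace S" "subspace T" "S \<inter> T = {0}"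
  shows "dim {x + y |x y. x \<in> S \<and> y \<in> T} = dim S + dim T"
  using dim_sums_Int[OF assms(1,2)] assms(3) by simp

lemma projection_exists:
  assumes "subspace U"
  shows "\<exists>P. lin P \<and> (\<forall>x. P x \<in> U) \<and> (\<forall>x\<in>U. P x = x)"
  using self.linear_exists_left_inverse_on[OF lin_id assms] by (auto simp: inj_on_def)

lemma complement_exists:
  assumes "subspace U" "subspace V" "U \<subseteq> V"
  shows "\<exists>Q. subspace Q \<and> Q \<subseteq> V \<and> Q \<inter> U = {0} \<and> dim Q + dim U = dim V"
proof -
  obtain P where P: "lin P" "\<forall>x. P x \<in> U" "\<forall>x\<in>U. P x = x" using projection_exists assms by blast
  let ?Q = "{x \<in> V. P x = 0}"
  have "P ` V = U" using P(2,3) assms(3) by force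
  then have "dim ?Q + dim U = dim V" using dim_kernel_image[OF P(1) assms(2)] by simp
  moreover have "?Q \<inter> U = {0}" using P assms by (auto simp: subspace_0 lin_zero)
  ultimately show ?thesis using subspace_kernel_on[OF P(1) assms(2)] by blast
qed

section \<open>Generalized eigenspaces\<close>

definition shift :: "('g \<Rightarrow> 'g) \<Rightarrow> 'k \<Rightarrow> 'g \<Rightarrow> 'g" where
  "shift T l = (\<lambda>x. T x - l *s x)"

definition gen_eig :: "('g \<Rightarrow> 'g) \<Rightarrow> 'k \<Rightarrow> 'g set" where
  "gen_eig T l = {v. \<exists>k. (shift T l ^^ k) v = 0}"

definition spectrum :: "('g \<Rightarrow> 'g) \<Rightarrow> 'k set" where
  "spectrum T = {l. \<exists>v. v \<noteq> 0 \<and> T v = l *s v}"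

lemma shift_lin: "lin T \<Longrightarrow> lin (shift T l)"
  unfolding shift_def by (intro lin_minus lin_scaled lin_id)

lemma shift_0: "shift T 0 = T"
  by (simp add: shift_def)

lemma gen_eig_0: "v \<in> gen_eig T 0 \<longleftrightarrow> (\<exists>k. (T ^^ k) v = 0)"
  by (simp add: gen_eig_def shift_0)

lemma gen_eig_witness_mono:
  assumes "lin T" "(T ^^ k) v = 0" "k \<le> n" shows "(T ^^ n) v = 0"
proof -
  have "(T ^^ n) v = (T ^^ (n - k)) ((T ^^ k) v)"
    using assms(3) by (simp flip: funpow_add[THEN fun_cong, unfolded o_def])
  then show ?thesis using assms by (simp add: lin_zero[OF lin_funpow])
qed

lemma subspace_gen_eig:
  assumes T: "lin T" shows "subspace (gen_eig T l)"
proof (rule subspaceI)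
  note S = shift_lin[OF T, of l]
  show "0 \<in> gen_eig T l" unfolding gen_eig_def by (auto intro: exI[of _ 0])
  fix x y c assume "x \<in> gen_eig T l" "y \<in> gen_eig T l"
  then obtain j k where "(shift T l ^^ j) x = 0" "(shift T l ^^ k) y = 0" by (auto simp: gen_eig_def)
  then have "(shift T l ^^ max j k) x = 0" "(shift T l ^^ max j k) y = 0"
    using gen_eig_witness_mono[OF S] by (metis max.cobounded1, metis max.cobounded2)
  then have "(shift T l ^^ max j k) (x + y) = 0" by (simp add: lin_add[OF lin_funpow[OF S]])
  then show "x + y \<in> gen_eig T l" unfolding gen_eig_def by blast
  assume "x \<in> gen_eig T l"
  then show "c *s x \<in> gen_eig T l" unfolding gen_eig_def by (auto simp: lin_scale[OF lin_funpow[OF S]])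
qed

lemma gen_eig_intertwine:
  assumes "lin T" "lin T'" "lin S" "\<And>x. S (T x) = T' (S x)" "v \<in> gen_eig T l" shows "S v \<in> gen_eig T' l"
proof -
  have "(shift T' l ^^ k) (S v) = S ((shift T l ^^ k) v)" for k
    by (induction k) (auto simp: shift_def assms lin_diff[OF assms(3)] lin_scale[OF assms(3)])
  moreover obtain k where "(shift T l ^^ k) v = 0" using assms(5) by (auto simp: gen_eig_def)
  ultimately have "(shift T' l ^^ k) (S v) = 0" by (simp add: lin_zero[OF assms(3)])
  then show ?thesis by (auto simp: gen_eig_def)
qed

lemma gen_eig_commute:
  assumes "lin T" "lin S" "\<And>x. S (T x) = T (S x)" "v \<in> gen_eig T l" shows "S v \<in> gen_eig T l"
  using gen_eig_intertwine[OF assms(1,1,2)] assms by blast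

lemma gen_eig_shift_stable: "lin T \<Longrightarrow> v \<in> gen_eig T l \<Longrightarrow> shift T u v \<in> gen_eig T l"
  by (rule gen_eig_commute[OF _ shift_lin]) (auto simp: shift_def lin_diff lin_scale)

lemma eigenvector_funpow_shift:
  assumes "lin T" "T v = l *s v" shows "(shift T u ^^ k) v = (l - u) ^ k *s v"
  by (induction k) (auto simp: shift_def assms lin_scale[OF assms(1)] algebra_simps)

lemma gen_eig_disjoint:
  assumes T: "lin T" and "v \<in> gen_eig T l" "v \<in> gen_eig T u" "l \<noteq> u" shows "v = 0"
proof -
  obtain j where "(shift T l ^^ j) v = 0" using assms by (auto simp: gen_eig_def)
  then show ?thesis using assms(3)
  proof (induction j arbitrary: v)
    case (Suc j)
    have "shift T l v = 0"
      using Suc gen_eig_shift_stable[OF T Suc.prems(2)] by (simp add: funpow_swap1)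
    then have "T v = l *s v" by (simp add: shift_def)
    moreover obtain k where "(shift T u ^^ k) v = 0" using Suc.prems by (auto simp: gen_eig_def)
    ultimately have "(l - u) ^ k *s v = 0" using eigenvector_funpow_shift[OF T, of v l k u] by simp
    then show ?case using assms(4) by simp
  qed simp
qed

lemma gen_eig_independent:
  assumes T: "lin T" and "finite L" "\<And>l. l \<in> L \<Longrightarrow> v l \<in> gen_eig T l" "(\<Sum>l\<in>L. v l) = 0"
  shows "\<forall>l\<in>L. v l = 0"
  using assms(2-4)
proof (induction L arbitrary: v rule: finite_induct)
  case (insert u L)
  obtain k where k: "(shift T u ^^ k) (v u) = 0" using insert.prems by (auto simp: gen_eig_def)
  let ?S = "shift T u ^^ k"
  have S: "lin ?S" by (intro lin_funpow shift_lin T)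
  have mem: "?S x \<in> gen_eig T l" if "x \<in> gen_eig T l" for l x
    using that by (induction k) (auto intro: gen_eig_shift_stable[OF T])
  have "(\<Sum>l\<in>L. ?S (v l)) = ?S (\<Sum>l\<in>insert u L. v l)"
    using insert.hyps k by (simp add: lin_sum[OF S] lin_add[OF S])
  then have "\<forall>l\<in>L. ?S (v l) = 0"
    using insert.prems by (intro insert.IH) (auto intro: mem simp: lin_zero[OF S])
  then have "\<forall>l\<in>L. v l \<in> gen_eig T u" by (auto simp: gen_eig_def)
  then have L: "\<forall>l\<in>L. v l = 0" using insert.prems insert.hyps gen_eig_disjoint[OF T] by blast
  then show ?case using insert by simp
qed simp

lemma eigenvector_gen_eig: "T v = l *s v \<Longrightarrow> v \<in> gen_eig T l"
  unfolding gen_eig_def by (auto intro!: exI[of _ 1] simp: shift_def)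

lemma finite_spectrum:
  assumes T: "lin T" shows "finite (spectrum T)"
proof (rule ccontr)
  assume "infinite (spectrum T)"
  then obtain L where L: "finite L" "card L = Suc (card Basis)" "L \<subseteq> spectrum T"
    by (meson infinite_arbitrarily_large)
  have "\<forall>l\<in>L. \<exists>v. v \<noteq> 0 \<and> T v = l *s v" using L(3) by (auto simp: spectrum_def)
  then obtain v where v: "\<And>l. l \<in> L \<Longrightarrow> v l \<noteq> 0" "\<And>l. l \<in> L \<Longrightarrow> T (v l) = l *s v l" by metis
  have "card Basis < card L" using L by simp
  from homogeneous_system_nontrivial_solution[OF L(1) finite_Basis this,
      of "\<lambda>l b. representation Basis (v l) b"]
  obtain a where a: "\<exists>i\<in>L. a i \<noteq> 0"
    "\<forall>b\<in>Basis. (\<Sum>l\<in>L. a l * representation Basis (v l) b) = 0" by blast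
  have "(\<Sum>l\<in>L. a l *s v l) = 0"
    unfolding eq_iff_rep using a(2) form_zero[OF rep_lin] by (simp add: rep_sum_scale)
  then have "\<forall>l\<in>L. a l *s v l = 0"
    using subspace_scale[OF subspace_gen_eig[OF T] eigenvector_gen_eig[of T, OF v(2)]]
    by (intro gen_eig_independent[OF T L(1)])
  then show False using a v by auto
qed

lemma gen_eig_trivial:
  assumes T: "lin T" and "l \<notin> spectrum T" "v \<in> gen_eig T l" shows "v = 0"
proof -
  obtain k where "(shift T l ^^ k) v = 0" using assms by (auto simp: gen_eig_def)
  then show ?thesis
  proof (induction k)
    case (Suc k)
    let ?w = "(shift T l ^^ k) v"
    have "T ?w = l *s ?w" using Suc.prems by (simp add: shift_def)
    then show ?case using Suc.IH assms(2) by (auto simp: spectrum_def)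
  qed simp
qed

definition poly_op :: "'k poly \<Rightarrow> ('g \<Rightarrow> 'g) \<Rightarrow> 'g \<Rightarrow> 'g" where
  "poly_op p T v = (\<Sum>i\<le>degree p. coeff p i *s (T ^^ i) v)"

lemma poly_op_bound: "degree p \<le> n \<Longrightarrow> poly_op p T v = (\<Sum>i\<le>n. coeff p i *s (T ^^ i) v)"
  unfolding poly_op_def
  by (rule sum.mono_neutral_left) (auto simp: coeff_eq_0)

lemma poly_op_linear_factor:
  assumes "lin T" shows "poly_op ([:-l, 1:] * q) T v = shift T l (poly_op q T v)"
proof -
  let ?n = "degree q"
  have "poly_op ([:-l, 1:] * q) T v = (\<Sum>i\<le>Suc ?n. coeff ([:-l, 1:] * q) i *s (T ^^ i) v)"
    using degree_mult_le[of "[:-l, 1:]" q] by (intro poly_op_bound) simp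
  also have "\<dots> = (\<Sum>i\<le>Suc ?n. coeff (pCons 0 q) i *s (T ^^ i) v) - l *s (\<Sum>i\<le>Suc ?n. coeff q i *s (T ^^ i) v)"
    by (simp add: scale_sum_right sum_subtractf[symmetric] algebra_simps del: sum.atMost_Suc)
  also have "(\<Sum>i\<le>Suc ?n. coeff q i *s (T ^^ i) v) = poly_op q T v"
    by (rule poly_op_bound[symmetric]) simp
  also have "(\<Sum>i\<le>Suc ?n. coeff (pCons 0 q) i *s (T ^^ i) v) = T (poly_op q T v)"
    by (subst sum.atMost_Suc_shift) (simp add: poly_op_def lin_sum[OF assms] lin_scale[OF assms])
  finally show ?thesis by (simp add: shift_def)
qed

lemma poly_op_in: "subspace U \<Longrightarrow> (\<And>x. x \<in> U \<Longrightarrow> T x \<in> U) \<Longrightarrow> v \<in> U \<Longrightarrow> poly_op p T v \<in> U"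
  unfolding poly_op_def
proof (intro subspace_sum subspace_scale)
  fix i assume "subspace U" "\<And>x. x \<in> U \<Longrightarrow> T x \<in> U" "v \<in> U"
  then show "(T ^^ i) v \<in> U" by (induction i) auto
qed auto

lemma annihilating_polynomial: "\<exists>p. p \<noteq> 0 \<and> poly_op p T v = 0"
proof -
  let ?n = "card Basis"
  have "card Basis < card {..?n}" by simp
  from homogeneous_system_nontrivial_solution[OF _ finite_Basis this,
      of "\<lambda>i b. representation Basis ((T ^^ i) v) b"]
  obtain a where a: "\<exists>i\<in>{..?n}. a i \<noteq> 0"
    "\<forall>b\<in>Basis. (\<Sum>i\<le>?n. a i * representation Basis ((T ^^ i) v) b) = 0" by blast
  define p where "p = (\<Sum>i\<le>?n. monom (a i) i)"
  have c: "coeff p i = (if i \<le> ?n then a i else 0)" for i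
    by (auto simp: p_def coeff_sum)
  have deg: "degree p \<le> ?n" by (rule degree_le) (simp add: c)
  have "poly_op p T v = (\<Sum>i\<le>?n. a i *s (T ^^ i) v)"
    unfolding poly_op_bound[OF deg] by (rule sum.cong) (auto simp: c)
  also have "\<dots> = 0"
    unfolding eq_iff_rep using a(2) form_zero[OF rep_lin] by (simp add: rep_sum_scale)
  finally have "poly_op p T v = 0" .
  moreover have "p \<noteq> 0" using a(1) c by (metis atMost_iff coeff_0)
  ultimately show ?thesis by blast
qed

text \<open>Among the polynomials in \<open>T\<close> that send \<open>v\<close> into \<open>W\<close>, take one of least degree and split off a
  root: the other factor sends \<open>v\<close> to an eigenvector modulo \<open>W\<close>.\<close>

lemma eigenvector_modulo:
  assumes T: "lin T" and U: "subspace U" "\<And>x. x \<in> U \<Longrightarrow> T x \<in> U"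
    and W: "subspace W" and v: "v \<in> U" "v \<notin> W"
  shows "\<exists>u l. u \<in> U \<and> u \<notin> W \<and> shift T l u \<in> W"
proof -
  let ?P = "\<lambda>p. p \<noteq> 0 \<and> poly_op p T v \<in> W"
  have "\<exists>p. ?P p" using annihilating_polynomial[of T v] subspace_0[OF W] by metis
  then obtain p where p: "?P p" and min: "\<And>q. ?P q \<Longrightarrow> degree p \<le> degree q"
    by (meson ex_has_least_nat[of ?P _ degree])
  have "degree p \<noteq> 0"
  proof
    assume "degree p = 0"
    then obtain a where "p = [:a:]" by (meson degree_eq_zeroE)
    then have "a \<noteq> 0" "a *s v \<in> W" using p by (auto simp: poly_op_def)
    then have "inverse a *s (a *s v) \<in> W" using subspace_scale[OF W] by blast
    then show False using \<open>a \<noteq> 0\<close> v by simp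
  qed
  then obtain l where "poly p l = 0" using alg_closed_imp_poly_has_root[of p] by auto
  then obtain q where q: "p = [:-l, 1:] * q" using poly_eq_0_iff_dvd[of p l] by auto
  then have "q \<noteq> 0" using p by auto
  then have "degree q < degree p" unfolding q by (subst degree_mult_eq) auto
  then have "poly_op q T v \<notin> W" using min[of q] \<open>q \<noteq> 0\<close> by auto
  moreover have "poly_op q T v \<in> U" using poly_op_in U v by blast
  moreover have "shift T l (poly_op q T v) \<in> W" using p q poly_op_linear_factor[OF T] by simp
  ultimately show ?thesis by blast
qed

text \<open>On the generalized eigenspace for \<open>u\<close>, \<open>T - l\<close> is the nonzero scalar \<open>u - l\<close> plus a nilpotent
  operator.\<close>

lemma shift_surj_gen_eig:
  assumes T: "lin T" and U: "subspace U" "\<And>x. x \<in> U \<Longrightarrow> T x \<in> U"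
    and "l \<noteq> u" "x \<in> U" "x \<in> gen_eig T u"
  shows "\<exists>y. y \<in> U \<and> y \<in> gen_eig T u \<and> shift T l y = x"
proof -
  obtain j where "(shift T u ^^ j) x = 0" using assms by (auto simp: gen_eig_def)
  then show ?thesis using assms(5,6)
  proof (induction j arbitrary: x)
    case 0
    then show ?case using shift_lin[OF T] lin_zero by auto
  next
    case (Suc j)
    have "shift T u x \<in> U" using Suc.prems U by (auto simp: shift_def intro!: subspace_diff subspace_scale)
    moreover have "(shift T u ^^ j) (shift T u x) = 0" using Suc.prems by (simp add: funpow_swap1)
    ultimately obtain y where y: "y \<in> U" "y \<in> gen_eig T u" "shift T l y = shift T u x"
      using Suc.IH gen_eig_shift_stable[OF T] Suc.prems by blast
    let ?z = "inverse (u - l) *s (x - y)"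
    have "shift T l (x - y) = (u - l) *s x"
      unfolding lin_diff[OF shift_lin[OF T]] y(3) by (simp add: shift_def scale_left_diff_distrib)
    then have "shift T l ?z = x"
      using assms(4) by (simp add: lin_scale[OF shift_lin[OF T]])
    moreover have "?z \<in> U" "?z \<in> gen_eig T u"
      using Suc.prems y U(1) subspace_gen_eig[OF T] by (auto intro!: subspace_scale subspace_diff)
    ultimately show ?case by blast
  qed
qed

text \<open>Let \<open>W\<close> be the span on the right.  By the previous lemma, every element of \<open>W\<close> is congruent to one
  of the generalized eigenspace for \<open>l\<close> modulo \<open>(T - l) W\<close>.  So an eigenvector modulo \<open>W\<close> can be
  corrected by an element of \<open>W\<close> to lie in a generalized eigenspace, hence in \<open>W\<close>.\<close>

lemma gen_eig_span:
  assumes T: "lin T" and U: "subspace U" "\<And>x. x \<in> U \<Longrightarrow> T x \<in> U"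
  shows "U \<subseteq> span (\<Union>l. U \<inter> gen_eig T l)" (is "_ \<subseteq> ?W")
proof (rule ccontr)
  assume "\<not> U \<subseteq> ?W"
  then obtain v where "v \<in> U" "v \<notin> ?W" by blast
  from eigenvector_modulo[OF T U subspace_span this]
  obtain u l where u: "u \<in> U" "u \<notin> ?W" "shift T l u \<in> ?W" by blast
  let ?Q = "{x. \<exists>y\<in>?W. x - shift T l y \<in> U \<inter> gen_eig T l}"
  note S = shift_lin[OF T, of l]
  have UG: "subspace (U \<inter> gen_eig T l)" by (intro subspace_inter U subspace_gen_eig[OF T])
  have WQ: "?W \<subseteq> ?Q"
  proof (rule span_minimal)
    show "subspace ?Q"
    proof (rule subspaceI)
      show "0 \<in> ?Q" using subspace_0[OF UG] by (auto intro!: bexI[of _ 0] simp: lin_zero[OF S] span_zero)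
    next
      fix x y assume "x \<in> ?Q" "y \<in> ?Q"
      then obtain a b where a: "a \<in> ?W" "x - shift T l a \<in> U \<inter> gen_eig T l"
        and b: "b \<in> ?W" "y - shift T l b \<in> U \<inter> gen_eig T l" by auto
      have "x + y - shift T l (a + b) = (x - shift T l a) + (y - shift T l b)"
        by (simp add: lin_add[OF S])
      then have "x + y - shift T l (a + b) \<in> U \<inter> gen_eig T l"
        using subspace_add[OF UG a(2) b(2)] by (simp only:)
      then show "x + y \<in> ?Q" using span_add[OF a(1) b(1)] by blast
    next
      fix c x assume "x \<in> ?Q"
      then obtain a where a: "a \<in> ?W" "x - shift T l a \<in> U \<inter> gen_eig T l" by auto
      have "c *s x - shift T l (c *s a) = c *s (x - shift T l a)"
        by (simp add: lin_scale[OF S] scale_right_diff_distrib)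
      then have "c *s x - shift T l (c *s a) \<in> U \<inter> gen_eig T l"
        using subspace_scale[OF UG a(2)] by (simp only:)
      then show "c *s x \<in> ?Q" using span_scale[OF a(1)] by blast
    qed
  next
    show "(\<Union>l. U \<inter> gen_eig T l) \<subseteq> ?Q"
    proof
    fix x assume "x \<in> (\<Union>l. U \<inter> gen_eig T l)"
    then obtain m where m: "x \<in> U" "x \<in> gen_eig T m" by blast
    show "x \<in> ?Q"
    proof (cases "l = m")
      case True
      have "x - shift T l 0 \<in> U \<inter> gen_eig T l" using m True by (simp add: lin_zero[OF shift_lin[OF T]])
      then show ?thesis using span_zero by blast
    next
      case False
      from shift_surj_gen_eig[OF T U False m] obtain y
        where y: "y \<in> U" "y \<in> gen_eig T m" "shift T l y = x" by blast
      then have "y \<in> ?W" by (intro span_base) auto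
      moreover have "x - shift T l y \<in> U \<inter> gen_eig T l" using subspace_0[OF UG] y by simp
      ultimately show ?thesis by blast
    qed
    qed
  qed
  have "shift T l u \<in> ?Q" using WQ u(3) by blast
  then obtain y where y: "y \<in> ?W" "shift T l u - shift T l y \<in> U \<inter> gen_eig T l" by auto
  have "?W \<subseteq> U" by (rule span_minimal) (use U in auto)
  obtain k where "(shift T l ^^ k) (shift T l (u - y)) = 0"
    using y(2) by (auto simp: gen_eig_def lin_diff[OF S])
  then have "(shift T l ^^ Suc k) (u - y) = 0" by (simp add: funpow_swap1)
  then have "u - y \<in> U \<inter> gen_eig T l"
    using u(1) y(1) \<open>?W \<subseteq> U\<close> subspace_diff[OF U(1)] unfolding gen_eig_def by blast
  then have "u - y \<in> ?W" by (intro span_base) auto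
  then have "u - y + y \<in> ?W" using y(1) span_add by blast
  then show False using u(2) by simp
qed

lemma gen_eig_decomposition:
  assumes T: "lin T" and U: "subspace U" "\<And>x. x \<in> U \<Longrightarrow> T x \<in> U" and v: "v \<in> U"
  shows "\<exists>w. (\<forall>l. w l \<in> U \<inter> gen_eig T l) \<and> v = (\<Sum>l\<in>spectrum T. w l)"
proof -
  have UG: "subspace (U \<inter> gen_eig T l)" for l by (intro subspace_inter U subspace_gen_eig[OF T])
  define D where "D = {v. \<exists>w. (\<forall>l. w l \<in> U \<inter> gen_eig T l) \<and> v = (\<Sum>l\<in>spectrum T. w l)}"
  have DI: "v \<in> D" if "\<And>l. w l \<in> U \<inter> gen_eig T l" "v = (\<Sum>l\<in>spectrum T. w l)" for v w
    using that unfolding D_def by blast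
  have DE: "\<exists>w. (\<forall>l. w l \<in> U \<inter> gen_eig T l) \<and> v = (\<Sum>l\<in>spectrum T. w l)" if "v \<in> D" for v
    using that unfolding D_def by blast
  have "span (\<Union>l. U \<inter> gen_eig T l) \<subseteq> D"
  proof (rule span_minimal)
    show "subspace D"
    proof (rule subspaceI)
      show "0 \<in> D" by (rule DI[of "\<lambda>_. 0"]) (simp_all only: subspace_0[OF UG] sum.neutral_const)
    next
      fix x y assume "x \<in> D" "y \<in> D"
      then obtain w w' where w: "\<forall>l. w l \<in> U \<inter> gen_eig T l" "x = (\<Sum>l\<in>spectrum T. w l)"
        and w': "\<forall>l. w' l \<in> U \<inter> gen_eig T l" "y = (\<Sum>l\<in>spectrum T. w' l)" using DE by metis
      show "x + y \<in> D"
      proof (rule DI)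
        show "w l + w' l \<in> U \<inter> gen_eig T l" for l using subspace_add[OF UG] w(1) w'(1) by blast
        show "x + y = (\<Sum>l\<in>spectrum T. w l + w' l)" using w(2) w'(2) by (simp only: sum.distrib)
      qed
    next
      fix c x assume "x \<in> D"
      then obtain w where w: "\<forall>l. w l \<in> U \<inter> gen_eig T l" "x = (\<Sum>l\<in>spectrum T. w l)" using DE by metis
      show "c *s x \<in> D"
      proof (rule DI)
        show "c *s w l \<in> U \<inter> gen_eig T l" for l using subspace_scale[OF UG] w(1) by blast
        show "c *s x = (\<Sum>l\<in>spectrum T. c *s w l)" using w(2) by (simp only: scale_sum_right)
      qed
    qed
  next
    show "(\<Union>l. U \<inter> gen_eig T l) \<subseteq> D"
    proof
    fix x assume "x \<in> (\<Union>l. U \<inter> gen_eig T l)"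
    then obtain m where m: "x \<in> U \<inter> gen_eig T m" by blast
    show "x \<in> D"
    proof (rule DI[of "\<lambda>l. if l = m then x else 0"])
      show "(if l = m then x else 0) \<in> U \<inter> gen_eig T l" for l using m subspace_0[OF UG] by simp
      show "x = (\<Sum>l\<in>spectrum T. if l = m then x else 0)"
        using gen_eig_trivial[OF T, of m x] m finite_spectrum[OF T] by (cases "m \<in> spectrum T") auto
    qed
    qed
  qed
  then have "v \<in> D" using gen_eig_span[OF T U] v by blast
  then show ?thesis by (rule DE)
qed

text \<open>The projection along the decomposition into generalized eigenspaces.\<close>

definition eig_proj :: "('g \<Rightarrow> 'g) \<Rightarrow> 'k \<Rightarrow> 'g \<Rightarrow> 'g" where
  "eig_proj T l v = (THE w. (\<forall>l. w l \<in> gen_eig T l) \<and> v = (\<Sum>l\<in>spectrum T. w l)) l"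

lemma eig_proj_eqI:
  assumes T: "lin T" and w: "\<And>l. w l \<in> gen_eig T l" "v = (\<Sum>l\<in>spectrum T. w l)"
  shows "eig_proj T l v = w l"
proof -
  have "(THE w. (\<forall>l. w l \<in> gen_eig T l) \<and> v = (\<Sum>l\<in>spectrum T. w l)) = w"
  proof (rule the_equality)
    fix w' assume w': "(\<forall>l. w' l \<in> gen_eig T l) \<and> v = (\<Sum>l\<in>spectrum T. w' l)"
    show "w' = w"
    proof
      fix l
      have "\<forall>l\<in>spectrum T. w' l - w l = 0"
      proof (rule gen_eig_independent[OF T finite_spectrum[OF T]])
        show "w' l - w l \<in> gen_eig T l" for l
          using w w' by (intro subspace_diff subspace_gen_eig[OF T]) auto
        show "(\<Sum>l\<in>spectrum T. w' l - w l) = 0" using w(2) w' by (simp add: sum_subtractf)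
      qed
      then show "w' l = w l"
        using gen_eig_trivial[OF T, of l "w' l"] gen_eig_trivial[OF T, of l "w l"] w w' by (cases "l \<in> spectrum T") auto
    qed
  qed (use w in blast)
  then show ?thesis by (simp add: eig_proj_def)
qed

lemma eig_proj_facts:
  assumes T: "lin T" and U: "subspace U" "\<And>x. x \<in> U \<Longrightarrow> T x \<in> U" and "v \<in> U"
  shows "eig_proj T l v \<in> gen_eig T l" "eig_proj T l v \<in> U" "(\<Sum>l\<in>spectrum T. eig_proj T l v) = v"
proof -
  obtain w where w: "\<And>l. w l \<in> U" "\<And>l. w l \<in> gen_eig T l" "v = (\<Sum>l\<in>spectrum T. w l)"
    using gen_eig_decomposition[OF T U assms(4)] by (metis IntD1 IntD2)
  have "eig_proj T l v = w l" for l using eig_proj_eqI[OF T w(2,3)] by simp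
  then show "eig_proj T l v \<in> gen_eig T l" "eig_proj T l v \<in> U" "(\<Sum>l\<in>spectrum T. eig_proj T l v) = v" using w by auto
qed

lemma eig_proj_in_gen_eig: "lin T \<Longrightarrow> eig_proj T l v \<in> gen_eig T l"
  using eig_proj_facts(1)[of T UNIV v l] by auto

lemma eig_proj_sum: "lin T \<Longrightarrow> (\<Sum>l\<in>spectrum T. eig_proj T l v) = v"
  using eig_proj_facts(3)[of T UNIV v] by auto

lemma eig_proj_commute:
  assumes T: "lin T" and S: "lin S" "\<And>x. S (T x) = T (S x)"
  shows "eig_proj T l (S v) = S (eig_proj T l v)"
proof (rule eig_proj_eqI[OF T, where w = "\<lambda>l. S (eig_proj T l v)"])
  show "S (eig_proj T l v) \<in> gen_eig T l" for l by (rule gen_eig_commute[OF T S eig_proj_in_gen_eig[OF T]])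
  show "S v = (\<Sum>l\<in>spectrum T. S (eig_proj T l v))"
    by (simp add: lin_sum[OF S(1), symmetric] eig_proj_sum[OF T])
qed

lemma eig_proj_lin: assumes T: "lin T" shows "lin (eig_proj T l)"
proof (rule linI)
  note G = subspace_gen_eig[OF T] eig_proj_in_gen_eig[OF T]
  show "eig_proj T l (x + y) = eig_proj T l x + eig_proj T l y" for x y
    by (rule eig_proj_eqI[OF T, where w = "\<lambda>l. eig_proj T l x + eig_proj T l y"])
      (auto simp: sum.distrib eig_proj_sum[OF T] intro!: subspace_add G)
  show "eig_proj T l (c *s x) = c *s eig_proj T l x" for c x
    by (rule eig_proj_eqI[OF T, where w = "\<lambda>l. c *s eig_proj T l x"])
      (auto simp: scale_sum_right[symmetric] eig_proj_sum[OF T] intro!: subspace_scale G)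
qed

lemma eig_proj_gen_eig:
  assumes T: "lin T" and "v \<in> gen_eig T u" shows "eig_proj T l v = (if l = u then v else 0)"
proof (cases "u \<in> spectrum T")
  case True
  show ?thesis
    by (rule eig_proj_eqI[OF T, where w = "\<lambda>l. if l = u then v else 0"])
      (use assms True subspace_0[OF subspace_gen_eig[OF T]] finite_spectrum[OF T] in auto)
next
  case False
  then have "v = 0" using gen_eig_trivial[OF T] assms(2) by blast
  then show ?thesis using lin_zero[OF eig_proj_lin[OF T]] by simp
qed

lemma funpow_shift_eig_proj_nilpotent:
  assumes T: "lin T" shows "\<exists>k. ((\<lambda>x. eig_proj T l (shift T l x)) ^^ k) v = 0"
proof -
  have c: "eig_proj T l (shift T l x) = shift T l (eig_proj T l x)" for x
    by (rule eig_proj_commute[OF T shift_lin[OF T]]) (simp add: shift_def lin_diff[OF T] lin_scale[OF T])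
  have *: "((\<lambda>x. eig_proj T l (shift T l x)) ^^ Suc k) v = (shift T l ^^ Suc k) (eig_proj T l v)" for k
  proof (induction k)
    case (Suc k)
    have "(shift T l ^^ Suc k) (eig_proj T l v) \<in> gen_eig T l"
      using eig_proj_in_gen_eig[OF T] by (induction k) (auto intro!: gen_eig_shift_stable[OF T])
    then have "eig_proj T l ((shift T l ^^ Suc k) (eig_proj T l v)) = (shift T l ^^ Suc k) (eig_proj T l v)"
      using eig_proj_gen_eig[OF T] by simp
    then show ?case using Suc c by simp
  qed (simp add: c)
  obtain k where "(shift T l ^^ k) (eig_proj T l v) = 0" using eig_proj_in_gen_eig[OF T, of l v] by (auto simp: gen_eig_def)
  then have "(shift T l ^^ Suc k) (eig_proj T l v) = 0" using lin_zero[OF shift_lin[OF T]] by simp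
  then show ?thesis using * by metis
qed

text \<open>Functional calculus on the spectrum that ignores the nilpotent part; the identity function yields
  the semisimple part of the Jordan decomposition of \<open>T\<close>.\<close>

definition twist :: "('k \<Rightarrow> 'k) \<Rightarrow> ('g \<Rightarrow> 'g) \<Rightarrow> 'g \<Rightarrow> 'g" where
  "twist \<phi> T v = (\<Sum>l\<in>spectrum T. \<phi> l *s eig_proj T l v)"

lemma twist_lin: "lin T \<Longrightarrow> lin (twist \<phi> T)"
  unfolding twist_def by (intro lin_sums lin_scaled eig_proj_lin)

lemma twist_gen_eig:
  assumes T: "lin T" and v: "v \<in> gen_eig T l" shows "twist \<phi> T v = \<phi> l *s v"
proof (cases "l \<in> spectrum T")
  case True
  have "twist \<phi> T v = (\<Sum>u\<in>spectrum T. if u = l then \<phi> l *s v else 0)"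
    unfolding twist_def by (intro sum.cong) (auto simp: eig_proj_gen_eig[OF T v])
  then show ?thesis using True finite_spectrum[OF T] by simp
next
  case False
  then have "v = 0" using gen_eig_trivial[OF T] v by blast
  then show ?thesis using lin_zero[OF twist_lin[OF T]] by simp
qed

lemma twist_commute:
  assumes T: "lin T" and S: "lin S" "\<And>x. S (T x) = T (S x)"
  shows "twist \<phi> T (S v) = S (twist \<phi> T v)"
  unfolding twist_def by (simp add: eig_proj_commute[OF T S] lin_sum[OF S(1)] lin_scale[OF S(1)])

lemma gen_eig_induct:
  assumes T: "lin T" and "\<And>l v. v \<in> gen_eig T l \<Longrightarrow> P v" "\<And>x y. P x \<Longrightarrow> P y \<Longrightarrow> P (x + y)" "P 0"
  shows "P v"
proof -
  have "P (\<Sum>l\<in>L. eig_proj T l v)" if "finite L" for L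
    using that by (induction L rule: finite_induct) (auto intro: assms eig_proj_in_gen_eig[OF T])
  then show ?thesis using eig_proj_sum[OF T, of v] finite_spectrum[OF T] by metis
qed

section \<open>Nilpotent operators and the trace\<close>

text \<open>A linear relation between \<open>v, T v, T\<^sup>2 v, \<dots>\<close> is multiplied by the power of \<open>T\<close> that kills all
  its terms but the first.\<close>

lemma funpow_dim_eq_0:
  assumes T: "lin T" and "(T ^^ k) v = 0" shows "(T ^^ card Basis) v = 0"
proof (rule ccontr)
  let ?n = "card Basis"
  assume nz: "(T ^^ ?n) v \<noteq> 0"
  define j where "j = (LEAST k. (T ^^ k) v = 0)"
  have j0: "(T ^^ j) v = 0" unfolding j_def using assms(2) by (rule LeastI)
  have j1: "(T ^^ i) v \<noteq> 0" if "i < j" for i using that not_less_Least unfolding j_def by blast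
  have jn: "?n < j" using j0 gen_eig_witness_mono[OF T] nz by (metis not_le)
  have "card Basis < card {..?n}" by simp
  from homogeneous_system_nontrivial_solution[OF _ finite_Basis this,
      of "\<lambda>i b. representation Basis ((T ^^ i) v) b"]
  obtain a where a: "\<exists>i\<in>{..?n}. a i \<noteq> 0"
    "\<forall>b\<in>Basis. (\<Sum>i\<le>?n. a i * representation Basis ((T ^^ i) v) b) = 0" by blast
  have s: "(\<Sum>i\<le>?n. a i *s (T ^^ i) v) = 0"
    unfolding eq_iff_rep using a(2) form_zero[OF rep_lin] by (simp add: rep_sum_scale)
  define i where "i = (LEAST i. a i \<noteq> 0)"
  obtain i0 where i0: "i0 \<le> ?n" "a i0 \<noteq> 0" using a(1) by blast
  have i: "a i \<noteq> 0" unfolding i_def using i0(2) by (rule LeastI)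
  have "i \<le> i0" unfolding i_def using i0(2) by (rule Least_le)
  then have in_le: "i \<le> ?n" using i0(1) by simp
  have i': "a l = 0" if "l < i" for l using that not_less_Least unfolding i_def by blast
  let ?e = "j - 1 - i"
  have "0 = (T ^^ ?e) (\<Sum>l\<le>?n. a l *s (T ^^ l) v)" using s lin_zero[OF lin_funpow[OF T]] by simp
  also have "\<dots> = (\<Sum>l\<le>?n. a l *s (T ^^ (?e + l)) v)"
    by (simp add: lin_sum[OF lin_funpow[OF T]] lin_scale[OF lin_funpow[OF T]] funpow_add)
  also have "\<dots> = (\<Sum>l\<le>?n. if l = i then a i *s (T ^^ (j - 1)) v else 0)"
  proof (rule sum.cong)
    fix l assume "l \<in> {..?n}"
    show "a l *s (T ^^ (?e + l)) v = (if l = i then a i *s (T ^^ (j - 1)) v else 0)"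
    proof (cases "l > i")
      case True
      then have "(T ^^ (?e + l)) v = 0" using gen_eig_witness_mono[OF T j0, of "?e + l"] jn in_le by simp
      then show ?thesis using True by simp
    next
      case False
      then show ?thesis using i' jn in_le by (cases "l = i") auto
    qed
  qed simp
  also have "\<dots> = a i *s (T ^^ (j - 1)) v" using in_le by simp
  finally show False using i j1[of "j - 1"] jn by simp
qed

definition trace :: "('g \<Rightarrow> 'g) \<Rightarrow> 'k" where
  "trace f = (\<Sum>b\<in>Basis. representation Basis (f b) b)"

lemma trace_add: "trace (\<lambda>x. f x + g x) = trace f + trace g"
  by (simp add: trace_def form_add[OF rep_lin] sum.distrib)

lemma trace_diff: "trace (\<lambda>x. f x - g x) = trace f - trace g"
  by (simp add: trace_def form_diff[OF rep_lin] sum_subtractf)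

lemma trace_scale: "trace (\<lambda>x. c *s f x) = c * trace f"
  by (simp add: trace_def form_scale[OF rep_lin] sum_distrib_left)

lemma trace_zero: "trace (\<lambda>x. 0) = 0"
  by (simp add: trace_def form_zero[OF rep_lin])

lemma trace_sum: "trace (\<lambda>x. \<Sum>i\<in>I. f i x) = (\<Sum>i\<in>I. trace (f i))"
  by (simp add: trace_def form_sum[OF rep_lin] sum.swap[of _ I])

lemma rep_lin_expand:
  assumes "lin f"
  shows "representation Basis (f v) b = (\<Sum>c\<in>Basis. representation Basis v c * representation Basis (f c) b)"
proof -
  have "f v = (\<Sum>c\<in>Basis. representation Basis v c *s f c)"
    by (subst sum_rep[of v, symmetric]) (simp add: lin_sum[OF assms] lin_scale[OF assms])
  then show ?thesis by (simp only: rep_sum_scale)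
qed

lemma trace_commute:
  assumes "lin f" "lin g" shows "trace (\<lambda>x. f (g x)) = trace (\<lambda>x. g (f x))"
proof -
  let ?R = "representation Basis"
  have "trace (\<lambda>x. f (g x)) = (\<Sum>b\<in>Basis. \<Sum>c\<in>Basis. ?R (g b) c * ?R (f c) b)"
    unfolding trace_def by (intro sum.cong refl rep_lin_expand assms)
  also have "\<dots> = (\<Sum>c\<in>Basis. \<Sum>b\<in>Basis. ?R (f c) b * ?R (g b) c)"
    by (subst sum.swap) (simp only: mult.commute)
  also have "\<dots> = trace (\<lambda>x. g (f x))"
    unfolding trace_def by (intro sum.cong refl rep_lin_expand[symmetric] assms)
  finally show ?thesis .
qed

lemma trace_conj:
  assumes "lin f" "lin g" "lin h" "\<And>x. h (g x) = x" shows "trace (\<lambda>x. g (f (h x))) = trace f"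
proof -
  have "trace (\<lambda>x. g (f (h x))) = trace (\<lambda>x. f (h (g x)))"
    by (rule trace_commute[OF assms(2) lin_compose[OF assms(1,3)]])
  then show ?thesis by (simp add: assms)
qed

text \<open>A projection \<open>P\<close> onto the range of \<open>f\<close> satisfies \<open>P f = f\<close>, so \<open>f\<close> and \<open>f P\<close> have the same
  trace; but the range of \<open>f P\<close> is the image under \<open>f\<close> of the range of \<open>f\<close>, which is smaller.\<close>

lemma trace_nilpotent:
  assumes f: "lin f" and nil: "\<And>v. \<exists>k. (f ^^ k) v = 0" shows "trace f = 0"
  using f nil
proof (induction "dim (range f)" arbitrary: f rule: less_induct)
  case less
  note f = less.prems(1)
  let ?W = "range f"
  have W: "subspace ?W" using f by (simp add: self.linear_subspace_image)
  obtain P where P: "lin P" "\<And>x. P x \<in> ?W" "\<And>x. x \<in> ?W \<Longrightarrow> P x = x"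
    using projection_exists[OF W] by blast
  have Pf: "P (f x) = f x" for x using P(3) by blast
  have trace: "trace f = trace (\<lambda>x. f (P x))"
    using trace_commute[OF P(1) f] by (simp only: Pf)
  show ?case
  proof (cases "?W = {0}")
    case True
    then have "f = (\<lambda>_. 0)" by auto
    then show ?thesis by (simp add: trace_zero)
  next
    case False
    have rg: "range (\<lambda>x. f (P x)) = f ` ?W"
    proof -
      have "range P = ?W" using P(2) Pf by (metis (no_types, lifting) image_subsetI rangeE rangeI subsetI subset_antisym)
      then show ?thesis by (metis image_image)
    qed
    have "f ` ?W \<noteq> ?W"
    proof
      assume eq: "f ` ?W = ?W"
      have "(f ^^ n) ` ?W = ?W" for n
      proof (induction n)
        case (Suc n)
        have "(f ^^ Suc n) ` ?W = f ` ((f ^^ n) ` ?W)" unfolding funpow.simps by (rule image_comp[symmetric])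
        then show ?case using Suc eq by (simp only:)
      qed simp
      moreover have "(f ^^ card Basis) x = 0" for x
        using funpow_dim_eq_0[OF f] less.prems(2) by blast
      then have "(f ^^ card Basis) ` ?W \<subseteq> {0}" by blast
      ultimately have "?W \<subseteq> {0}" by metis
      then show False using False subspace_0[OF W] by auto
    qed
    then have "f ` ?W \<subset> ?W" by auto
    then have "dim (f ` ?W) < dim ?W"
      using f W by (intro dim_psubset) (simp add: self.linear_subspace_image span_eq_iff[THEN iffD2])
    then have lt: "dim (range (\<lambda>x. f (P x))) < dim ?W" using rg by simp
    have pow: "((\<lambda>x. f (P x)) ^^ Suc k) v = (f ^^ Suc k) (P v)" for k v
      by (induction k) (simp_all add: Pf)
    have "\<exists>k. ((\<lambda>x. f (P x)) ^^ k) v = 0" for v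
    proof -
      obtain k where "(f ^^ k) (P v) = 0" using less.prems(2) by blast
      then have "(f ^^ Suc k) (P v) = 0" using lin_zero[OF f] by simp
      then show ?thesis using pow by metis
    qed
    then show ?thesis using less.hyps[OF lt lin_compose[OF f P(1)]] trace by simp
  qed
qed

lemma trace_basis:
  assumes f: "lin f" and B: "independent B" "span B = UNIV"
  shows "trace f = (\<Sum>b\<in>B. representation B (f b) b)"
proof -
  have fB: "finite B" using B finiteI_independent by blast
  have lB: "Vector_Spaces.linear scale (*) (\<lambda>v. representation B v b)" for b
    by (rule linear_representation[OF B])
  have sB: "v = (\<Sum>b\<in>B. representation B v b *s b)" for v
    by (rule sum_representation_eq[symmetric]) (use B fB in auto)
  have expand: "representation B (f v) b = (\<Sum>c\<in>Basis. representation Basis v c * representation B (f c) b)" for v b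
  proof -
    have "f v = (\<Sum>c\<in>Basis. representation Basis v c *s f c)"
      by (subst sum_rep[of v, symmetric]) (simp add: lin_sum[OF f] lin_scale[OF f])
    then show ?thesis by (simp add: form_sum[OF lB] form_scale[OF lB])
  qed
  have "(\<Sum>b\<in>B. representation B (f b) b)
      = (\<Sum>b\<in>B. \<Sum>c\<in>Basis. representation Basis b c * representation B (f c) b)"
    by (intro sum.cong refl expand)
  also have "\<dots> = (\<Sum>c\<in>Basis. \<Sum>b\<in>B. representation Basis b c * representation B (f c) b)"
    by (rule sum.swap)
  also have "\<dots> = (\<Sum>c\<in>Basis. representation Basis (f c) c)"
  proof (rule sum.cong)
    fix c
    have "representation Basis (f c) c = (\<Sum>b\<in>B. representation B (f c) b * representation Basis b c)"
      by (subst sB[of "f c"]) (simp only: rep_sum_scale)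
    then show "(\<Sum>b\<in>B. representation Basis b c * representation B (f c) b) = representation Basis (f c) c"
      by (simp add: mult.commute)
  qed simp
  finally show ?thesis by (simp add: trace_def)
qed

lemma trace_idempotent:
  assumes P: "lin P" "\<And>x. P (P x) = P x" shows "trace P = of_nat (dim (range P))"
proof -
  have W: "subspace (range P)" using P(1) by (simp add: self.linear_subspace_image)
  obtain C where C: "C \<subseteq> range P" "independent C" "range P \<subseteq> span C" "card C = dim (range P)"
    using basis_exists[of "range P"] by auto
  obtain B where B: "C \<subseteq> B" "independent B" "span B = UNIV"
    using maximal_independent_subset_extend[OF subset_UNIV C(2)] by (metis top.extremum_uniqueI)
  have fB: "finite B" using B finiteI_independent by blast
  have "representation B (P b) b = (if b \<in> C then 1 else 0)" if b: "b \<in> B" for b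
  proof (cases "b \<in> C")
    case True
    then have "P b = b" using C(1) P(2) by (metis rangeE subsetD)
    then show ?thesis using True b by (simp add: representation_basis[OF B(2)])
  next
    case False
    have "P b \<in> span C" using C(3) by blast
    then have "representation B (P b) = representation C (P b)"
      by (rule representation_extend[OF B(2) _ B(1)])
    moreover have "representation C (P b) b = 0" using False representation_ne_zero by blast
    ultimately show ?thesis using False by simp
  qed
  then have "trace P = (\<Sum>b\<in>B. if b \<in> C then 1 else 0)"
    unfolding trace_basis[OF P(1) B(2,3)] by (intro sum.cong refl)
  also have "\<dots> = of_nat (card C)"
    using B(1) by (simp only: sum.If_cases[OF fB] Int_absorb1 Collect_mem_eq sum.neutral_const add_0_right) simp
  finally show ?thesis using C(4) by simp
qed

definition alg_multiplicity :: "('g \<Rightarrow> 'g) \<Rightarrow> 'k \<Rightarrow> nat" where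
  "alg_multiplicity T l = dim (gen_eig T l)"

lemma alg_multiplicity_pos: assumes "lin T" "l \<in> spectrum T" shows "alg_multiplicity T l \<noteq> 0"
proof -
  obtain v where "v \<noteq> 0" "v \<in> gen_eig T l" using assms(2) eigenvector_gen_eig by (auto simp: spectrum_def)
  then have "\<not> gen_eig T l \<subseteq> {0}" by blast
  then show ?thesis unfolding alg_multiplicity_def dim_eq_0 .
qed

lemma trace_eig_proj: assumes T: "lin T" shows "trace (eig_proj T l) = of_nat (alg_multiplicity T l)"
proof -
  have "range (eig_proj T l) = gen_eig T l"
  proof
    show "range (eig_proj T l) \<subseteq> gen_eig T l" using eig_proj_in_gen_eig[OF T] by blast
    show "gen_eig T l \<subseteq> range (eig_proj T l)"
    proof
      fix v assume "v \<in> gen_eig T l"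
      then have "v = eig_proj T l v" using eig_proj_gen_eig[OF T] by simp
      then show "v \<in> range (eig_proj T l)" by (rule range_eqI)
    qed
  qed
  moreover have "eig_proj T l (eig_proj T l x) = eig_proj T l x" for x using eig_proj_gen_eig[OF T eig_proj_in_gen_eig[OF T]] by simp
  ultimately show ?thesis using trace_idempotent[OF eig_proj_lin[OF T]] by (metis alg_multiplicity_def)
qed

lemma trace_eig_proj_T: assumes T: "lin T" shows "trace (\<lambda>x. eig_proj T l (T x)) = l * of_nat (alg_multiplicity T l)"
proof -
  note S = shift_lin[OF T, of l]
  have "trace (\<lambda>x. eig_proj T l (shift T l x)) = 0"
    by (rule trace_nilpotent[OF lin_compose[OF eig_proj_lin[OF T] S] funpow_shift_eig_proj_nilpotent[OF T]])
  moreover have "eig_proj T l (shift T l x) = eig_proj T l (T x) - l *s eig_proj T l x" for x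
    unfolding shift_def lin_diff[OF eig_proj_lin[OF T]] lin_scale[OF eig_proj_lin[OF T]] ..
  ultimately have "trace (\<lambda>x. eig_proj T l (T x) - l *s eig_proj T l x) = 0" by (simp only:)
  then have "trace (\<lambda>x. eig_proj T l (T x)) - trace (\<lambda>x. l *s eig_proj T l x) = 0" by (simp only: trace_diff)
  then show ?thesis by (simp only: trace_scale trace_eig_proj[OF T] right_minus_eq)
qed

lemma trace_twist:
  assumes T: "lin T" shows "trace (\<lambda>x. twist \<phi> T (T x)) = (\<Sum>l\<in>spectrum T. \<phi> l * l * of_nat (alg_multiplicity T l))"
  unfolding twist_def by (simp only: trace_sum trace_scale trace_eig_proj_T[OF T] mult.assoc)

lemma nilpotent_if_spectrum:
  assumes T: "lin T" and "spectrum T \<subseteq> {0}" shows "\<exists>k. (T ^^ k) v = 0"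
proof -
  note G = subspace_gen_eig[OF T, of 0]
  have "v \<in> gen_eig T 0"
  proof (rule gen_eig_induct[OF T, of "\<lambda>v. v \<in> gen_eig T 0"])
    fix l v assume v: "v \<in> gen_eig T l"
    show "v \<in> gen_eig T 0"
    proof (cases "l = 0")
      case False
      then have "v = 0" using gen_eig_trivial[OF T _ v] assms(2) by blast
      then show ?thesis using subspace_0[OF G] by simp
    qed (use v in simp)
  qed (rule subspace_add[OF G] subspace_0[OF G]; assumption)+
  then show ?thesis by (simp add: gen_eig_0)
qed

section \<open>Linear pencils of operators\<close>

text \<open>If \<open>G\<close> inverts \<open>A\<close> on \<open>Q\<close> and \<open>A + s E\<close> kills a nonzero vector of \<open>Q\<close>, then \<open>- 1 / s\<close> is an
  eigenvalue of \<open>G E\<close>.  This is the semicontinuity of the rank used throughout.\<close>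

lemma pencil_injective:
  assumes A: "lin A" and E: "lin E" and Q: "subspace Q" and inj: "\<And>v. v \<in> Q \<Longrightarrow> A v = 0 \<Longrightarrow> v = 0"
  shows "finite {s. \<exists>v\<in>Q. v \<noteq> 0 \<and> A v + s *s E v = 0}"
proof -
  have "inj_on A Q"
  proof (rule inj_onI)
    fix x y assume xy: "x \<in> Q" "y \<in> Q" "A x = A y"
    then have "A (x - y) = 0" by (simp add: lin_diff[OF A])
    then show "x = y" using inj[of "x - y"] subspace_diff[OF Q] xy by simp
  qed
  then obtain G where G: "lin G" "\<And>v. v \<in> Q \<Longrightarrow> G (A v) = v"
    using self.linear_exists_left_inverse_on[OF A Q] by blast
  let ?T = "\<lambda>v. G (E v)"
  have T: "lin ?T" by (rule lin_compose[OF G(1) E])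
  have "{s. \<exists>v\<in>Q. v \<noteq> 0 \<and> A v + s *s E v = 0} \<subseteq> (\<lambda>l. - inverse l) ` spectrum ?T"
  proof
    fix s assume "s \<in> {s. \<exists>v\<in>Q. v \<noteq> 0 \<and> A v + s *s E v = 0}"
    then obtain v where v: "v \<in> Q" "v \<noteq> 0" "A v + s *s E v = 0" by blast
    have "v + s *s ?T v = G (A v + s *s E v)"
      by (simp add: lin_add[OF G(1)] lin_scale[OF G(1)] G(2)[OF v(1)])
    then have eq: "v + s *s ?T v = 0" using v(3) lin_zero[OF G(1)] by simp
    then have s: "s \<noteq> 0" using v(2) by auto
    from eq have "s *s ?T v = - v" by (metis add.inverse_unique)
    then have "inverse s *s (s *s ?T v) = inverse s *s (- v)" by simp
    then have "?T v = - inverse s *s v" using s by (simp add: scale_minus_left scale_minus_right)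
    then have "- inverse s \<in> spectrum ?T" using v(2) by (auto simp: spectrum_def)
    moreover have "s = - inverse (- inverse s)" by simp
    ultimately show "s \<in> (\<lambda>l. - inverse l) ` spectrum ?T" by blast
  qed
  then show ?thesis by (rule finite_surj[OF finite_spectrum[OF T]])
qed

lemma vector_polynomial_zero:
  assumes "infinite S" "\<And>s. s \<in> S \<Longrightarrow> (\<Sum>i\<le>n. s ^ i *s c i) = 0" "i \<le> n" shows "c i = 0"
  unfolding eq_iff_rep
proof
  fix b
  define p where "p = (\<Sum>i\<le>n. monom (representation Basis (c i) b) i)"
  have "poly p s = 0" if "s \<in> S" for s
  proof -
    have "poly p s = representation Basis (\<Sum>i\<le>n. s ^ i *s c i) b"
      by (simp add: p_def poly_sum poly_monom rep_sum_scale mult.commute)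
    then show ?thesis using assms(2)[OF that] form_zero[OF rep_lin] by simp
  qed
  then have "S \<subseteq> {s. poly p s = 0}" by blast
  then have "p = 0" using assms(1) poly_roots_finite finite_subset by blast
  moreover have "coeff p i = representation Basis (c i) b" using assms(3) by (simp add: p_def coeff_sum)
  ultimately show "representation Basis (c i) b = representation Basis 0 b"
    using form_zero[OF rep_lin] by simp
qed

lemma pencil_power_expansion:
  assumes "lin A" "lin E"
  shows "\<exists>c. (\<forall>s. ((\<lambda>x. A x + s *s E x) ^^ n) v = (\<Sum>i\<le>n. s ^ i *s c i)) \<and> c n = (E ^^ n) v"
proof (induction n)
  case 0
  then show ?case by (intro exI[of _ "\<lambda>_. v"]) simp
next
  case (Suc n)
  then obtain c where c: "\<And>s. ((\<lambda>x. A x + s *s E x) ^^ n) v = (\<Sum>i\<le>n. s ^ i *s c i)" "c n = (E ^^ n) v"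
    by blast
  define d where "d i = (if i \<le> n then A (c i) else 0) + (if i = 0 then 0 else E (c (i - 1)))" for i
  have "((\<lambda>x. A x + s *s E x) ^^ Suc n) v = (\<Sum>i\<le>Suc n. s ^ i *s d i)" for s
  proof -
    have "((\<lambda>x. A x + s *s E x) ^^ Suc n) v = (\<Sum>i\<le>n. s ^ i *s A (c i)) + (\<Sum>i\<le>n. s ^ Suc i *s E (c i))"
      by (simp add: c lin_sum[OF assms(1)] lin_sum[OF assms(2)] lin_scale[OF assms(1)] lin_scale[OF assms(2)] scale_sum_right)
    also have "(\<Sum>i\<le>n. s ^ Suc i *s E (c i)) = (\<Sum>i\<le>Suc n. s ^ i *s (if i = 0 then 0 else E (c (i - 1))))"
      by (subst sum.atMost_Suc_shift) simp
    also have "(\<Sum>i\<le>n. s ^ i *s A (c i)) = (\<Sum>i\<le>Suc n. s ^ i *s (if i \<le> n then A (c i) else 0))"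
      by simp
    finally show ?thesis by (simp add: d_def scale_right_distrib sum.distrib[symmetric] del: sum.atMost_Suc)
  qed
  moreover have "d (Suc n) = (E ^^ Suc n) v" using c(2) by (simp add: d_def)
  ultimately show ?case by blast
qed

end

section \<open>Adjoint operators, derivations and the Killing form\<close>

sublocale lie_algebra \<subseteq> alg_closed_space scale Basis
  by unfold_locales

context lie_algebra
begin

lemma lin_br: "lin (br x)"
  using linear_br_right[of x] by simp

lemma lin_br_left: "lin (\<lambda>x. br x y)"
  by (rule linear_br_left)

lemmas br_add_right = lin_add[OF lin_br]
  and br_scale_right = lin_scale[OF lin_br]
  and br_zero_right = lin_zero[OF lin_br]
  and br_diff_right = lin_diff[OF lin_br]
  and br_neg_right = lin_neg[OF lin_br]
  and br_sum_right = lin_sum[OF lin_br]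

lemma br_add_left: "br (x + y) z = br x z + br y z"
  and br_scale_left: "br (c *s x) z = c *s br x z"
  and br_zero_left: "br 0 z = 0"
  and br_diff_left: "br (x - y) z = br x z - br y z"
  and br_sum_left: "br (\<Sum>i\<in>I. f i) z = (\<Sum>i\<in>I. br (f i) z)"
  using lin_add[OF lin_br_left] lin_scale[OF lin_br_left] lin_zero[OF lin_br_left]
    lin_diff[OF lin_br_left] lin_sum[OF lin_br_left] by simp_all

lemma br_skew: "br x y = - br y x"
proof -
  have "br (x + y) (x + y) = br x y + br y x"
    unfolding br_add_left br_add_right by (simp add: br_self)
  then have "br x y + br y x = 0" by (simp only: br_self)
  then show ?thesis by (simp only: eq_neg_iff_add_eq_0)
qed

lemma br_zero_sym: "br x y = 0 \<Longrightarrow> br y x = 0"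
  using br_skew[of y x] by simp

lemma br_br: "br x (br y z) = br (br x y) z + br y (br x z)"
proof -
  have "br x (br y z) + br y (- br x z) + - br (br x y) z = 0"
    using jacobi[of x y z] br_skew[of z x] br_skew[of z "br x y"] by simp
  then show ?thesis unfolding br_neg_right by (simp add: algebra_simps eq_neg_iff_add_eq_0)
qed

definition derivation :: "('g \<Rightarrow> 'g) \<Rightarrow> bool" where
  "derivation S \<longleftrightarrow> lin S \<and> (\<forall>u v. S (br u v) = br (S u) v + br u (S v))"

text \<open>The operator \<open>ad x - (l + m)\<close> acts on \<open>[u, v]\<close> as \<open>ad x - l\<close> on \<open>u\<close> plus \<open>ad x - m\<close> on \<open>v\<close>.\<close>

lemma gen_eig_br:
  assumes "u \<in> gen_eig (br x) l" "v \<in> gen_eig (br x) m"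
  shows "br u v \<in> gen_eig (br x) (l + m)"
proof -
  let ?D = "shift (br x) (l + m)"
  note D = shift_lin[OF lin_br, of x "l + m"]
  have step: "?D (br u v) = br (shift (br x) l u) v + br u (shift (br x) m v)" for u v
    unfolding shift_def br_br[of x u v] br_diff_left br_diff_right br_scale_left br_scale_right
      scale_left_distrib by (simp add: algebra_simps)
  have *: "(?D ^^ (j + k)) (br u v) = 0"
    if "(shift (br x) l ^^ j) u = 0" "(shift (br x) m ^^ k) v = 0" for j k
    using that
  proof (induction "j + k" arbitrary: j k u v)
    case 0
    then show ?case by (simp add: br_zero_left)
  next
    case (Suc n)
    show ?case
    proof (cases "j = 0 \<or> k = 0")
      case True
      then have "br u v = 0" using Suc.prems by (auto simp: br_zero_left br_zero_right)
      then show ?thesis by (simp add: lin_zero[OF lin_funpow[OF D]])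
    next
      case False
      then obtain a b where [simp]: "j = Suc a" "k = Suc b" by (metis not0_implies_Suc)
      have "(?D ^^ (a + k)) (br (shift (br x) l u) v) = 0"
        using Suc.hyps(2) Suc.prems by (intro Suc.hyps(1)) (simp_all add: funpow_swap1)
      moreover have "(?D ^^ (j + b)) (br u (shift (br x) m v)) = 0"
        using Suc.hyps(2) Suc.prems by (intro Suc.hyps(1)) (simp_all add: funpow_swap1)
      moreover have n: "a + k = n" "j + b = n" "j + k = Suc n" using Suc.hyps(2) by simp_all
      ultimately have "(?D ^^ n) (br (shift (br x) l u) v) = 0" "(?D ^^ n) (br u (shift (br x) m v)) = 0"
        by (simp_all only:)
      then have "(?D ^^ n) (?D (br u v)) = 0"
        unfolding step lin_add[OF lin_funpow[OF D]] by (simp only: add_0)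
      then show ?thesis unfolding n(3) funpow_Suc_right o_apply .
    qed
  qed
  from assms obtain j k where "(shift (br x) l ^^ j) u = 0" "(shift (br x) m ^^ k) v = 0"
    by (auto simp: gen_eig_def)
  then have "(?D ^^ (j + k)) (br u v) = 0" by (rule *)
  then show ?thesis unfolding gen_eig_def by blast
qed

text \<open>Generalized eigenvalues of \<open>ad x\<close> add up under the bracket.\<close>

lemma twist_derivation:
  assumes "\<And>a b. \<phi> (a + b) = \<phi> a + \<phi> b" shows "derivation (twist \<phi> (br x))"
proof -
  let ?S = "twist \<phi> (br x)"
  note S = twist_lin[OF lin_br, of \<phi> x]
  have hom: "?S (br u v) = br (?S u) v + br u (?S v)"
    if u: "u \<in> gen_eig (br x) l" and v: "v \<in> gen_eig (br x) m" for u v l m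
    using twist_gen_eig[OF lin_br gen_eig_br[OF u v], of \<phi>]
    unfolding twist_gen_eig[OF lin_br u] twist_gen_eig[OF lin_br v]
    by (simp add: assms br_scale_left br_scale_right scale_left_distrib)
  have half: "?S (br u v) = br (?S u) v + br u (?S v)" if u: "u \<in> gen_eig (br x) l" for u v l
  proof (rule gen_eig_induct[OF lin_br, of _ "\<lambda>v. ?S (br u v) = br (?S u) v + br u (?S v)"])
    show "v \<in> gen_eig (br x) m \<Longrightarrow> ?S (br u v) = br (?S u) v + br u (?S v)" for m v by (rule hom[OF u])
    show "?S (br u 0) = br (?S u) 0 + br u (?S 0)" by (simp add: br_zero_right lin_zero[OF S])
    show "?S (br u (v + w)) = br (?S u) (v + w) + br u (?S (v + w))"
      if "?S (br u v) = br (?S u) v + br u (?S v)" "?S (br u w) = br (?S u) w + br u (?S w)" for v w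
      unfolding lin_add[OF S] br_add_right that by (simp add: algebra_simps)
  qed
  have "?S (br u v) = br (?S u) v + br u (?S v)" for u v
  proof (rule gen_eig_induct[OF lin_br, of _ "\<lambda>u. ?S (br u v) = br (?S u) v + br u (?S v)"])
    show "u \<in> gen_eig (br x) m \<Longrightarrow> ?S (br u v) = br (?S u) v + br u (?S v)" for m u by (rule half)
    show "?S (br 0 v) = br (?S 0) v + br 0 (?S v)" by (simp add: br_zero_left lin_zero[OF S])
    show "?S (br (u + w) v) = br (?S (u + w)) v + br (u + w) (?S v)"
      if "?S (br u v) = br (?S u) v + br u (?S v)" "?S (br w v) = br (?S w) v + br w (?S v)" for u w
      unfolding lin_add[OF S] br_add_left that by (simp add: algebra_simps)
  qed
  then show ?thesis using S by (simp add: derivation_def)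
qed

definition killing :: "'g \<Rightarrow> 'g \<Rightarrow> 'k" where
  "killing x y = trace (\<lambda>z. br x (br y z))"

lemma killing_add_left: "killing (x + y) z = killing x z + killing y z"
  and killing_scale_left: "killing (c *s x) z = c * killing x z"
  unfolding killing_def br_add_left br_scale_left trace_add trace_scale by simp_all

lemma killing_sym: "killing x y = killing y x"
  unfolding killing_def by (rule trace_commute[OF lin_br lin_br])

lemma killing_lin: "Vector_Spaces.linear scale (*) (killing x)"
  by (rule formI) (simp_all only: killing_sym[of x] killing_add_left killing_scale_left)

lemmas killing_scale_right = form_scale[OF killing_lin]
  and killing_zero_right = form_zero[OF killing_lin]
  and killing_diff_right = form_diff[OF killing_lin]
  and killing_neg_right = form_neg[OF killing_lin]
  and killing_sum_right = form_sum[OF killing_lin]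

lemma killing_zero_left: "killing 0 y = 0" and killing_diff_left: "killing (x - z) y = killing x y - killing z y"
  and killing_neg_left: "killing (- x) y = - killing x y"
  and killing_sum_left: "killing (\<Sum>i\<in>I. f i) y = (\<Sum>i\<in>I. killing (f i) y)"
  using killing_zero_right[of y] killing_diff_right[of y x z] killing_neg_right[of y x] killing_sum_right[of y f I]
  by (simp_all only: killing_sym[of y])

text \<open>Since \<open>ad (S x) = [S, ad x]\<close>, cyclicity of the trace moves \<open>S\<close> out of the form.  For \<open>S = ad w\<close>
  this is invariance.\<close>

lemma killing_derivation:
  assumes S: "derivation S" shows "killing (S x) y = trace (\<lambda>z. S (br (br x y) z))"
proof -
  have l: "lin S" and d: "\<And>u v. br (S u) v = S (br u v) - br u (S v)"
    using S by (auto simp: derivation_def)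
  have "killing (S x) y = trace (\<lambda>z. S (br x (br y z))) - trace (\<lambda>z. br x (S (br y z)))"
    unfolding killing_def d trace_diff ..
  also have "trace (\<lambda>z. br x (S (br y z))) = trace (\<lambda>z. S (br y (br x z)))"
    by (rule trace_commute[OF lin_br lin_compose[OF l lin_br]])
  also have "trace (\<lambda>z. S (br x (br y z))) - trace (\<lambda>z. S (br y (br x z)))
      = trace (\<lambda>z. S (br (br x y) z))"
    unfolding trace_diff[symmetric] lin_diff[OF l, symmetric]
    using br_br[of x y] by (simp only: add_diff_cancel_right')
  finally show ?thesis .
qed

lemma derivation_br: "derivation (br w)"
  unfolding derivation_def using lin_br br_br by blast

lemma killing_invariant: "killing (br w x) y = killing w (br x y)"
  using killing_derivation[OF derivation_br, of w x y] by (simp add: killing_def)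

text \<open>The semisimple part of \<open>ad h\<close> is a derivation, hence skew for the Killing form; it acts on \<open>x\<close> and
  \<open>y\<close> with the eigenvalues \<open>0\<close> and \<open>l\<close>.\<close>

lemma killing_gen_eig_orthogonal:
  assumes x: "x \<in> gen_eig (br h) 0" and y: "y \<in> gen_eig (br h) l" and "l \<noteq> 0" shows "killing x y = 0"
proof -
  let ?S = "twist (\<lambda>a. a) (br h)"
  have S: "derivation ?S" by (rule twist_derivation) simp
  have "br y x = br (- x) y" using br_skew[of y x] by (metis br_neg_right br_skew)
  then have "killing (?S y) x = killing (?S (- x)) y" unfolding killing_derivation[OF S] by simp
  moreover have "?S (- x) = 0"
    using twist_gen_eig[OF lin_br, of "- x" h 0] subspace_neg[OF subspace_gen_eig[OF lin_br] x] by simp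
  ultimately have "killing (l *s y) x = 0"
    using twist_gen_eig[OF lin_br y, of "\<lambda>a. a"] by (simp add: killing_zero_left)
  then have "l * killing x y = 0" unfolding killing_scale_left killing_sym[of y x] .
  then show ?thesis using assms(3) by simp
qed

definition adnil :: "'g \<Rightarrow> bool" where
  "adnil x \<longleftrightarrow> (\<forall>v. \<exists>k. (br x ^^ k) v = 0)"

text \<open>The product of \<open>ad a\<close> with an operator commuting with it is nilpotent.\<close>

lemma killing_commuting_nilpotent:
  assumes a: "adnil a" and ay: "br a y = 0" shows "killing a y = 0"
  unfolding killing_def
proof (rule trace_nilpotent[OF lin_compose[OF lin_br lin_br]])
  fix v
  have c: "br a (br y z) = br y (br a z)" for z using br_br[of a y z] ay by (simp add: br_zero_left)
  have c': "(br a ^^ k) (br y z) = br y ((br a ^^ k) z)" for k z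
    by (induction k) (simp_all add: c)
  have "((\<lambda>z. br a (br y z)) ^^ k) v = (br a ^^ k) ((br y ^^ k) v)" for k
    by (induction k) (simp_all add: c c')
  moreover have "(br a ^^ card Basis) w = 0" for w
    using funpow_dim_eq_0[OF lin_br] a unfolding adnil_def by blast
  ultimately show "\<exists>k. ((\<lambda>z. br a (br y z)) ^^ k) v = 0" by metis
qed

text \<open>The projection \<open>P\<close> to a generalized eigenspace of \<open>ad a\<close> commutes with \<open>ad b\<close> for \<open>b \<in> B\<close>, so
  \<open>tr (P [ad x, ad b]) = 0\<close>.  Hence \<open>tr (P (ad a)) = 0\<close>, and this trace is the eigenvalue times the
  dimension of its generalized eigenspace.\<close>

lemma adnil_if_sum_of_brackets_with_centralizer:
  assumes comm: "\<And>b. b \<in> B \<Longrightarrow> br a b = 0" and a: "a \<in> span {br x b | x b. b \<in> B}"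
  shows "adnil a"
proof -
  have "l = 0" if l: "l \<in> spectrum (br a)" for l
  proof -
    let ?P = "eig_proj (br a) l"
    let ?F = "\<lambda>c. trace (\<lambda>z. ?P (br c z))"
    note P = eig_proj_lin[OF lin_br, of a l]
    have gen: "?F (br x b) = 0" if "b \<in> B" for x b
    proof -
      have "br b (br a z) = br a (br b z)" for z
        using br_br[of a b z] comm[OF that] by (simp add: br_zero_left)
      then have Pb: "?P (br b z) = br b (?P z)" for z by (intro eig_proj_commute[OF lin_br lin_br])
      have bb: "br (br x b) z = br x (br b z) - br b (br x z)" for z using br_br[of x b z] by simp
      have "?F (br x b) = trace (\<lambda>z. ?P (br x (br b z))) - trace (\<lambda>z. br b (?P (br x z)))"
        unfolding bb lin_diff[OF P] trace_diff Pb ..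
      also have "trace (\<lambda>z. br b (?P (br x z))) = trace (\<lambda>z. ?P (br x (br b z)))"
        by (rule trace_commute[OF lin_br lin_compose[OF P lin_br]])
      finally show ?thesis by simp
    qed
    have F: "?F (c + d) = ?F c + ?F d" "?F (k *s c) = k * ?F c" "?F 0 = 0" for c d k
      unfolding br_add_left br_scale_left br_zero_left lin_add[OF P] lin_scale[OF P] lin_zero[OF P]
        trace_add trace_scale trace_zero by (rule refl)+
    have "a \<in> {c. ?F c = 0}"
    proof (rule set_mp[OF span_minimal a])
      show "{br x b | x b. b \<in> B} \<subseteq> {c. ?F c = 0}" using gen by blast
      show "subspace {c. ?F c = 0}"
      proof (rule subspaceI)
        show "0 \<in> {c. ?F c = 0}" by (simp only: mem_Collect_eq F)
        show "c + d \<in> {c. ?F c = 0}" if "c \<in> {c. ?F c = 0}" "d \<in> {c. ?F c = 0}" for c d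
          using that by (simp only: mem_Collect_eq F add_0)
        show "k *s c \<in> {c. ?F c = 0}" if "c \<in> {c. ?F c = 0}" for k c
          using that by (simp only: mem_Collect_eq F mult_zero_right)
      qed
    qed
    then have "l * of_nat (alg_multiplicity (br a) l) = 0" using trace_eig_proj_T[OF lin_br, of a l] by simp
    then show "l = 0" using alg_multiplicity_pos[OF lin_br l] by simp
  qed
  then show ?thesis unfolding adnil_def using nilpotent_if_spectrum[OF lin_br] by blast
qed

section \<open>Engel's theorem\<close>

lemma subspace_of_subalgebra: "subalgebra H \<Longrightarrow> subspace H"
  by (simp add: subalgebra_def)

lemma subalgebra_br: "subalgebra H \<Longrightarrow> x \<in> H \<Longrightarrow> y \<in> H \<Longrightarrow> br x y \<in> H"
  by (simp add: subalgebra_def)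

lemma subalgebra_add_normalizing:
  assumes M: "subalgebra M" and z: "\<And>m. m \<in> M \<Longrightarrow> br m z \<in> M"
  shows "subalgebra (span (insert z M))"
proof -
  note sM = subspace_of_subalgebra[OF M]
  have spM: "span M = M" using sM by (simp add: span_eq_iff)
  have z': "br z m \<in> M" if "m \<in> M" for m
    using subspace_neg[OF sM z[OF that]] br_skew[of z m] by simp
  have "br x y \<in> M" if "x \<in> span (insert z M)" "y \<in> span (insert z M)" for x y
  proof -
    from that obtain c d where cd: "x - c *s z \<in> M" "y - d *s z \<in> M"
      unfolding span_breakdown_eq spM by blast
    define p q where "p = x - c *s z" and "q = y - d *s z"
    have "x = c *s z + p" "y = d *s z + q" by (simp_all add: p_def q_def)
    then have "br x y = c *s br z q + d *s br p z + br p q"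
      unfolding p_def[symmetric] q_def[symmetric]
      by (simp add: br_add_left br_add_right br_scale_left br_scale_right br_self)
    moreover have "p \<in> M" "q \<in> M" using cd by (simp_all add: p_def q_def)
    ultimately show ?thesis
      using z z' subalgebra_br[OF M] by (simp add: subspace_add[OF sM] subspace_scale[OF sM])
  qed
  then show ?thesis unfolding subalgebra_def using span_superset[of "insert z M"] by blast
qed

text \<open>Engel's theorem for the module \<open>U / W\<close>.  A maximal proper subalgebra \<open>M\<close> of \<open>H\<close> is an ideal of
  codimension one: the theorem applied to the module \<open>H / M\<close> gives an element \<open>z\<close> normalizing \<open>M\<close>.
  Then \<open>z\<close> preserves the nonzero space of invariants of \<open>M\<close>, where it acts nilpotently.\<close>

lemma engel:
  assumes "subalgebra H" "\<And>x y. x \<in> H \<Longrightarrow> y \<in> H \<Longrightarrow> \<exists>k. (br x ^^ k) y = 0"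
    and "subspace U" "subspace W" "W \<subset> U"
    and "\<And>h u. h \<in> H \<Longrightarrow> u \<in> U \<Longrightarrow> br h u \<in> U"
    and "\<And>h w. h \<in> H \<Longrightarrow> w \<in> W \<Longrightarrow> br h w \<in> W"
    and "\<And>h u. h \<in> H \<Longrightarrow> u \<in> U \<Longrightarrow> \<exists>k. (br h ^^ k) u \<in> W"
  shows "\<exists>u\<in>U. u \<notin> W \<and> (\<forall>h\<in>H. br h u \<in> W)"
  using assms
proof (induction "dim H" arbitrary: H U W rule: less_induct)
  case less
  note H = less.prems(1) and nil = less.prems(2) and sU = less.prems(3) and sW = less.prems(4)
    and WU = less.prems(5) and HU = less.prems(6) and HW = less.prems(7) and nilU = less.prems(8)
  note sH = subspace_of_subalgebra[OF H]
  show ?case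
  proof (cases "H \<subseteq> {0}")
    case True
    obtain u where "u \<in> U" "u \<notin> W" using WU by blast
    moreover have "br h u \<in> W" if "h \<in> H" for h
      using that True subspace_0[OF sW] by (auto simp: br_zero_left)
    ultimately show ?thesis by blast
  next
    case False
    let ?P = "\<lambda>M. subalgebra M \<and> M \<subset> H"
    have "?P {0}" using False subspace_0[OF sH] by (auto simp: subalgebra_def br_zero_left)
    moreover have "\<forall>M. ?P M \<longrightarrow> dim M < Suc (dim H)" using dim_subset less_Suc_eq_le by blast
    ultimately obtain M where M: "?P M" and max: "\<And>N. ?P N \<Longrightarrow> dim N \<le> dim M"
      using ex_has_greatest_nat[of ?P "{0}" dim "Suc (dim H)"] by blast
    note sM = subspace_of_subalgebra[OF conjunct1[OF M]]
    have spM: "span M = M" using sM by (simp add: span_eq_iff)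
    have spH: "span H = H" using sH by (simp add: span_eq_iff)
    have dM: "dim M < dim H" using M by (intro dim_psubset) (simp only: spM spH)
    have M0: "subalgebra M" "M \<subseteq> H" "M \<subset> H" using M by auto
    have "\<exists>z\<in>H. z \<notin> M \<and> (\<forall>m\<in>M. br m z \<in> M)"
    proof (rule less.hyps[OF dM M0(1)])
      show "\<exists>k. (br x ^^ k) y = 0" if "x \<in> M" "y \<in> M" for x y using nil that M0(2) by blast
      show "br h u \<in> H" if "h \<in> M" "u \<in> H" for h u using subalgebra_br[OF H] that M0(2) by blast
      show "br h w \<in> M" if "h \<in> M" "w \<in> M" for h w using subalgebra_br[OF M0(1)] that by blast
      show "\<exists>k. (br h ^^ k) u \<in> M" if "h \<in> M" "u \<in> H" for h u
        using nil[of h u] that M0(2) subspace_0[OF sM] by (metis subsetD)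
    qed (rule sH sM M0(3))+
    then obtain z where z: "z \<in> H" "z \<notin> M" "\<And>m. m \<in> M \<Longrightarrow> br m z \<in> M" by blast
    let ?N = "span (insert z M)"
    have N: "subalgebra ?N" by (rule subalgebra_add_normalizing[OF M0(1) z(3)])
    have NH: "?N \<subseteq> H" using z(1) M0(2) sH by (intro span_minimal) auto
    have "M \<subset> ?N" using z(2) span_superset[of "insert z M"] by auto
    then have "dim M < dim ?N" by (intro dim_psubset) (simp only: spM span_span)
    then have NeqH: "?N = H" using max[of ?N] N NH by (meson leD psubsetI)
    let ?U = "{u \<in> U. \<forall>m\<in>M. br m u \<in> W}"
    have "\<exists>u\<in>U. u \<notin> W \<and> (\<forall>m\<in>M. br m u \<in> W)"
    proof (rule less.hyps[OF dM M0(1)])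
      show "\<exists>k. (br x ^^ k) y = 0" if "x \<in> M" "y \<in> M" for x y using nil that M0(2) by blast
      show "br h u \<in> U" if "h \<in> M" "u \<in> U" for h u using HU that M0(2) by blast
      show "br h w \<in> W" if "h \<in> M" "w \<in> W" for h w using HW that M0(2) by blast
      show "\<exists>k. (br h ^^ k) u \<in> W" if "h \<in> M" "u \<in> U" for h u using nilU that M0(2) by blast
    qed (rule sU sW WU)+
    then obtain u0 where u0: "u0 \<in> ?U" "u0 \<notin> W" by blast
    have zU: "br z u \<in> ?U" if u: "u \<in> ?U" for u
    proof -
      have "br m (br z u) \<in> W" if m: "m \<in> M" for m
        unfolding br_br[of m z u]
        using u m z(1,3) HW by (intro subspace_add[OF sW]) auto
      then show ?thesis using u HU z(1) by blast
    qed
    define k where "k = (LEAST k. (br z ^^ k) u0 \<in> W)"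
    have "\<exists>k. (br z ^^ k) u0 \<in> W" using nilU z(1) u0(1) by blast
    then have k: "(br z ^^ k) u0 \<in> W" unfolding k_def by (rule LeastI_ex)
    have "k \<noteq> 0" using k u0(2) by (metis funpow_0)
    then obtain j where j: "k = Suc j" using not0_implies_Suc by blast
    let ?u = "(br z ^^ j) u0"
    have u1: "?u \<notin> W" using not_less_Least[of j "\<lambda>k. (br z ^^ k) u0 \<in> W"] j unfolding k_def by simp
    have u2: "(br z ^^ i) u0 \<in> ?U" for i
    proof (induction i)
      case (Suc i)
      then show ?case using zU by (simp only: funpow.simps o_apply)
    qed (use u0(1) in simp)
    have "br h ?u \<in> W" if "h \<in> H" for h
    proof -
      obtain c where c: "h - c *s z \<in> M"
        using \<open>h \<in> H\<close> unfolding NeqH[symmetric] span_breakdown_eq spM by blast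
      have "br h ?u = br (h - c *s z) ?u + c *s br z ?u"
        by (simp add: br_diff_left br_scale_left)
      moreover have "br (h - c *s z) ?u \<in> W" using u2[of j] c by blast
      moreover have "br z ?u \<in> W" using k j by simp
      ultimately show ?thesis using sW by (simp add: subspace_add subspace_scale)
    qed
    then show ?thesis using u1 u2[of j] by blast
  qed
qed

lemma commutator_mono: "A \<subseteq> A' \<Longrightarrow> B \<subseteq> B' \<Longrightarrow> commutator A B \<subseteq> commutator A' B'"
  unfolding commutator_def by (rule span_mono) blast

lemma commutator_in: "x \<in> A \<Longrightarrow> y \<in> B \<Longrightarrow> br x y \<in> commutator A B"
  unfolding commutator_def by (rule span_base) blast

lemma commutator_subset:
  "subspace W \<Longrightarrow> (\<And>x y. x \<in> A \<Longrightarrow> y \<in> B \<Longrightarrow> br x y \<in> W) \<Longrightarrow> commutator A B \<subseteq> W"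
  unfolding commutator_def by (rule span_minimal) auto

lemma subspace_commutator: "subspace (commutator A B)"
  unfolding commutator_def by (rule subspace_span)

lemma lower_central_mono: "A \<subseteq> B \<Longrightarrow> (commutator H ^^ n) A \<subseteq> (commutator H ^^ n) B"
  by (induction n) (auto intro: commutator_mono[THEN subsetD, rotated -1])

lemma nilpotent_subalgebra_adnil:
  assumes "nilpotent H" "x \<in> H" "y \<in> H" shows "\<exists>k. (br x ^^ k) y = 0"
proof -
  obtain n where n: "(commutator H ^^ n) H = {0}" using assms(1) by (auto simp: nilpotent_def)
  have "(br x ^^ k) y \<in> (commutator H ^^ k) H" for k
  proof (induction k)
    case (Suc k)
    then show ?case using commutator_in[OF assms(2) Suc] by simp
  qed (use assms in simp)
  then show ?thesis using n by blast
qed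

text \<open>A maximal ideal \<open>W\<close> of \<open>H\<close> that is killed by iterated commutators with \<open>H\<close> could otherwise be
  enlarged by an element supplied by Engel's theorem.\<close>

lemma nilpotent_if_adnil:
  assumes H: "subalgebra H" and nil: "\<And>x y. x \<in> H \<Longrightarrow> y \<in> H \<Longrightarrow> \<exists>k. (br x ^^ k) y = 0"
  shows "nilpotent H"
proof -
  note sH = subspace_of_subalgebra[OF H]
  define P where "P W \<longleftrightarrow> subspace W \<and> W \<subseteq> H \<and> (\<forall>h\<in>H. \<forall>w\<in>W. br h w \<in> W) \<and>
    (\<exists>n. (commutator H ^^ n) W = {0})" for W
  have "\<exists>n. (commutator H ^^ n) {0} = {0}" by (rule exI[of _ 0]) simp
  then have "P {0}"
    unfolding P_def using subspace_0[OF sH] by (simp add: br_zero_right subspace_single_0)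
  moreover have "dim W < Suc (dim H)" if "P W" for W
    using that unfolding P_def by (simp only: less_Suc_eq_le dim_subset)
  ultimately obtain W where W: "P W" and max: "\<And>V. P V \<Longrightarrow> dim V \<le> dim W"
    using ex_has_greatest_nat[of P "{0}" dim "Suc (dim H)"] by blast
  have sW: "subspace W" and WH: "W \<subseteq> H" and HW: "\<And>h w. h \<in> H \<Longrightarrow> w \<in> W \<Longrightarrow> br h w \<in> W"
    using W by (simp_all add: P_def)
  obtain n where n: "(commutator H ^^ n) W = {0}" using W unfolding P_def by blast
  have "W = H"
  proof (rule ccontr)
    assume "W \<noteq> H"
    then have "W \<subset> H" using WH by blast
    have "\<exists>u\<in>H. u \<notin> W \<and> (\<forall>h\<in>H. br h u \<in> W)"
    proof (rule engel[OF H nil sH sW \<open>W \<subset> H\<close>])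
      show "\<exists>k. (br h ^^ k) u \<in> W" if "h \<in> H" "u \<in> H" for h u
        using nil[OF that] subspace_0[OF sW] by metis
      show "br h u \<in> H" if "h \<in> H" "u \<in> H" for h u by (rule subalgebra_br[OF H that])
      show "br h u \<in> W" if "h \<in> H" "u \<in> W" for h u by (rule HW[OF that])
    qed
    then obtain u where u: "u \<in> H" "u \<notin> W" "\<And>h. h \<in> H \<Longrightarrow> br h u \<in> W" by blast
    let ?V = "span (insert u W)"
    have VH: "?V \<subseteq> H" using u(1) WH sH by (intro span_minimal) auto
    have spW: "span W = W" using sW by (simp add: span_eq_iff)
    have HV: "br h v \<in> W" if "h \<in> H" "v \<in> ?V" for h v
    proof -
      obtain c where c: "v - c *s u \<in> W" using \<open>v \<in> ?V\<close> unfolding span_breakdown_eq spW by blast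
      have "br h (v - c *s u) + c *s br h u \<in> W"
        by (intro subspace_add[OF sW] subspace_scale[OF sW] HW u(3) that(1) c)
      then show ?thesis by (simp add: br_diff_right br_scale_right)
    qed
    have WV: "W \<subset> ?V" using u(2) span_superset[of "insert u W"] by auto
    have "commutator H ?V \<subseteq> W" by (rule commutator_subset[OF sW HV])
    then have "(commutator H ^^ Suc n) ?V \<subseteq> (commutator H ^^ n) W"
      unfolding funpow_Suc_right o_apply by (rule lower_central_mono)
    moreover have "0 \<in> (commutator H ^^ Suc n) ?V" using subspace_0[OF subspace_commutator] by simp
    ultimately have "(commutator H ^^ Suc n) ?V = {0}" unfolding n by blast
    moreover have "\<forall>h\<in>H. \<forall>v\<in>?V. br h v \<in> ?V" using HV WV by blast
    ultimately have "P ?V" unfolding P_def using VH subspace_span by blast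
    then have "dim ?V \<le> dim W" by (rule max)
    moreover have "dim W < dim ?V" using WV by (intro dim_psubset) (simp only: spW span_span)
    ultimately show False by simp
  qed
  then show ?thesis using n unfolding nilpotent_def by blast
qed

lemma derived_subset_lower_central:
  assumes "subalgebra H"
  shows "((\<lambda>D. commutator D D) ^^ n) H \<subseteq> (commutator H ^^ n) H \<and> ((\<lambda>D. commutator D D) ^^ n) H \<subseteq> H"
proof (induction n)
  case (Suc n)
  let ?D = "((\<lambda>D. commutator D D) ^^ n) H"
  have "commutator ?D ?D \<subseteq> commutator H ((commutator H ^^ n) H)"
    using Suc by (intro commutator_mono) auto
  moreover have "commutator ?D ?D \<subseteq> H"
    using Suc by (intro commutator_subset subspace_of_subalgebra[OF assms] subalgebra_br[OF assms]) auto
  ultimately show ?case by simp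
qed simp

end

section \<open>Cartan's criterion\<close>

text \<open>Linear functionals over the rationals separate the elements of the ground field; they take the part
  of complex conjugation, or of positivity, in Cartan's criterion.\<close>

lemma rational_functional:
  fixes l :: "'k::field_char_0"
  assumes "l \<noteq> 0"
  obtains f :: "'k \<Rightarrow> rat" where "\<And>a b. f (a + b) = f a + f b" "\<And>q a. f (of_rat q * a) = q * f a" "f l = 1"
proof -
  interpret Q: vector_space "\<lambda>(q::rat) (x::'k). of_rat q * x"
    by (standard; simp only: of_rat_add of_rat_mult distrib_left distrib_right mult.assoc of_rat_1 mult_1_left)
  interpret R: vector_space "(*) :: rat \<Rightarrow> rat \<Rightarrow> rat"
    by (standard; simp only: distrib_left distrib_right mult.assoc mult_1_left)
  interpret QQ: vector_space_pair "\<lambda>(q::rat) (x::'k). of_rat q * x" "(*) :: rat \<Rightarrow> rat \<Rightarrow> rat" ..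
  have "Q.independent {l}" using assms by (simp only: Q.dependent_single simp_thms)
  from QQ.linear_independent_extend[OF this, of "\<lambda>_. 1"]
  obtain f where f: "Vector_Spaces.linear (\<lambda>(q::rat) (x::'k). of_rat q * x) (*) f" "f l = 1" by (metis singletonI)
  have 1: "f (a + b) = f a + f b" for a b by (rule QQ.linear_add[OF f(1)])
  have 2: "f (of_rat q * a) = q * f a" for q a by (rule QQ.linear_scale[OF f(1)])
  show ?thesis by (rule that[OF 1 2 f(2)])
qed

context lie_algebra
begin

definition killing_radical :: "'g set" where
  "killing_radical = {x. \<forall>y. killing x y = 0}"

lemma subspace_killing_radical: "subspace killing_radical"
  by (rule subspaceI) (auto simp: killing_radical_def killing_zero_left killing_add_left killing_scale_left)

lemma killing_radical_ideal: "br y x \<in> killing_radical" if "x \<in> killing_radical"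
proof -
  have "killing (br x y) z = 0" for z using that unfolding killing_invariant killing_radical_def by blast
  then have "killing (br y x) z = 0" for z using br_skew[of y x] by (simp add: killing_neg_left)
  then show ?thesis by (simp add: killing_radical_def)
qed

text \<open>For a rational functional \<open>f\<close>, the operator \<open>S\<close> acting on each generalized eigenspace of \<open>ad h\<close>
  by \<open>f\<close> of the eigenvalue is a derivation.  As \<open>h\<close> is a sum of brackets from the radical,
  \<open>tr (S (ad h)) = 0\<close>, which means that the sum of \<open>f l * l\<close> over the eigenvalues \<open>l\<close> vanishes.
  Applying \<open>f\<close> gives a vanishing sum of squares of rationals.\<close>

lemma adnil_commutator_killing_radical:
  assumes h: "h \<in> commutator killing_radical killing_radical" shows "adnil h"
proof -
  have "l0 = 0" if l0: "l0 \<in> spectrum (br h)" for l0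
  proof (rule ccontr)
    assume "l0 \<noteq> 0"
    then obtain f :: "'k \<Rightarrow> rat" where f: "\<And>a b. f (a + b) = f a + f b"
      "\<And>q a. f (of_rat q * a) = q * f a" "f l0 = 1" using rational_functional by blast
    let ?S = "twist (\<lambda>l. of_rat (f l)) (br h)"
    have S: "derivation ?S" by (rule twist_derivation) (simp add: f of_rat_add)
    have lS: "lin ?S" by (rule twist_lin[OF lin_br])
    let ?F = "\<lambda>c. trace (\<lambda>z. ?S (br c z))"
    have F: "?F (c + d) = ?F c + ?F d" "?F (k *s c) = k * ?F c" "?F 0 = 0" for c d k
      unfolding br_add_left br_scale_left br_zero_left lin_add[OF lS] lin_scale[OF lS] lin_zero[OF lS]
        trace_add trace_scale trace_zero by (rule refl)+
    have gen: "?F (br x y) = 0" if "x \<in> killing_radical" "y \<in> killing_radical" for x y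
      using that(2) killing_derivation[OF S, of x y] killing_sym[of "?S x" y] by (simp add: killing_radical_def)
    have "commutator killing_radical killing_radical \<subseteq> {c. ?F c = 0}"
    proof (rule commutator_subset)
      show "br x y \<in> {c. ?F c = 0}" if "x \<in> killing_radical" "y \<in> killing_radical" for x y
        using gen[OF that] by simp
      show "subspace {c. ?F c = 0}"
      proof (rule subspaceI)
        show "0 \<in> {c. ?F c = 0}" by (simp only: mem_Collect_eq F)
        show "c + d \<in> {c. ?F c = 0}" if "c \<in> {c. ?F c = 0}" "d \<in> {c. ?F c = 0}" for c d
          using that by (simp only: mem_Collect_eq F add_0)
        show "k *s c \<in> {c. ?F c = 0}" if "c \<in> {c. ?F c = 0}" for k c
          using that by (simp only: mem_Collect_eq F mult_zero_right)
      qed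
    qed
    then have "?F h = 0" using h by blast
    then have "(\<Sum>l\<in>spectrum (br h). of_rat (f l) * l * of_nat (alg_multiplicity (br h) l)) = 0"
      by (simp only: trace_twist[OF lin_br])
    then have "f (\<Sum>l\<in>spectrum (br h). of_rat (f l) * l * of_nat (alg_multiplicity (br h) l)) = f 0" by simp
    moreover have f0: "f 0 = 0" using f(1)[of 0 0] by simp
    have f_sum: "f (sum g I) = (\<Sum>i\<in>I. f (g i))" if "finite I" for g and I :: "'k set"
      using that by (induction I rule: finite_induct) (auto simp: f0 f)
    have f_term: "f (of_rat (f l) * l * of_nat n) = (f l)\<^sup>2 * of_nat n" for l n
    proof -
      have "of_rat (f l) * l * of_nat n = of_rat (f l * of_nat n) * l" by (simp add: of_rat_mult mult_ac)
      then have "f (of_rat (f l) * l * of_nat n) = f l * of_nat n * f l" by (simp only: f(2))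
      then show ?thesis by (simp add: power2_eq_square mult_ac)
    qed
    ultimately have "(\<Sum>l\<in>spectrum (br h). (f l)\<^sup>2 * of_nat (alg_multiplicity (br h) l)) = 0"
      using f0 by (simp only: f_sum[OF finite_spectrum[OF lin_br]] f_term)
    then have "\<forall>l\<in>spectrum (br h). (f l)\<^sup>2 * of_nat (alg_multiplicity (br h) l) = 0"
      by (subst (asm) sum_nonneg_eq_0_iff[OF finite_spectrum[OF lin_br]]) auto
    then have "(f l0)\<^sup>2 * of_nat (alg_multiplicity (br h) l0) = 0" using l0 by blast
    then show False using f(3) alg_multiplicity_pos[OF lin_br l0] by simp
  qed
  then show ?thesis unfolding adnil_def using nilpotent_if_spectrum[OF lin_br] by blast
qed

text \<open>The radical is an ideal, and its commutator consists of nilpotent elements; so the commutator is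
  nilpotent by Engel's theorem and the radical is solvable.\<close>

lemma killing_nondegenerate:
  assumes semisimple and "\<And>y. killing x y = 0" shows "x = 0"
proof -
  let ?R = killing_radical and ?d = "\<lambda>D. commutator D D"
  let ?K = "commutator ?R ?R"
  have KR: "?K \<subseteq> ?R" by (intro commutator_subset subspace_killing_radical killing_radical_ideal)
  then have K: "subalgebra ?K"
    unfolding subalgebra_def by (meson commutator_in subspace_commutator subsetD)
  have "nilpotent ?K"
    by (rule nilpotent_if_adnil[OF K]) (use adnil_commutator_killing_radical in \<open>auto simp: adnil_def\<close>)
  then obtain n where "(commutator ?K ^^ n) ?K = {0}" by (auto simp: nilpotent_def)
  then have "(?d ^^ n) ?K \<subseteq> {0}" using derived_subset_lower_central[OF K, of n] by simp
  then have "(?d ^^ Suc n) ?R \<subseteq> {0}" by (simp only: funpow_Suc_right o_apply)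
  moreover have "0 \<in> (?d ^^ Suc n) ?R" using subspace_0[OF subspace_commutator] by simp
  ultimately have "solvable ?R" unfolding solvable_def by blast
  moreover have "lie_ideal ?R"
    using subspace_killing_radical killing_radical_ideal by (simp add: lie_ideal_def)
  ultimately have "?R = {0}" using assms(1) by (simp add: semisimple_def)
  then show ?thesis using assms(2) by (auto simp: killing_radical_def)
qed

lemma killing_represents:
  assumes ss: semisimple and \<xi>: "Vector_Spaces.linear scale (*) \<xi>"
  shows "\<exists>s. \<forall>y. \<xi> y = killing s y"
proof -
  let ?F = "\<lambda>s. \<Sum>b\<in>Basis. killing s b *s b"
  have F: "lin ?F"
    by (rule linI) (simp_all only: killing_add_left killing_scale_left scale_left_distrib sum.distrib scale_sum_right scale_scale)
  have rep: "representation Basis (\<Sum>b\<in>Basis. c b *s b) b = c b" if b: "b \<in> Basis" for c b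
  proof -
    have "representation Basis (\<Sum>b\<in>Basis. c b *s b) b = (\<Sum>i\<in>Basis. if b = i then c i else 0)"
      unfolding rep_sum_scale
      by (intro sum.cong refl) (simp add: representation_basis[OF independent_Basis])
    then show ?thesis using b finite_Basis by (simp only: sum.delta' if_True)
  qed
  have ext: "\<zeta> = \<eta>" if "Vector_Spaces.linear scale (*) \<zeta>" "Vector_Spaces.linear scale (*) \<eta>"
    "\<And>b. b \<in> Basis \<Longrightarrow> \<zeta> b = \<eta> b" for \<zeta> \<eta> :: "'g \<Rightarrow> 'k"
  proof
    fix y show "\<zeta> y = \<eta> y"
      by (rule form_eq_on[OF that(1,2), of y Basis]) (simp_all add: that(3) span_Basis)
  qed
  have zero: "Vector_Spaces.linear scale (*) (\<lambda>_::'g. 0::'k)" by (rule formI) simp_all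
  have "inj ?F"
    unfolding self.linear_inj_iff_eq_0[OF F]
  proof (intro allI impI)
    fix s assume F0: "?F s = 0"
    have "killing s b = 0" if "b \<in> Basis" for b
      using rep[OF that, of "killing s"] unfolding F0 form_zero[OF rep_lin] by (rule sym)
    then have "killing s = (\<lambda>_. 0)" by (rule ext[OF killing_lin zero])
    then show "s = 0" using killing_nondegenerate[OF ss] by simp
  qed
  then have "surj ?F" by (rule linear_inj_imp_surj[OF F])
  from surjD[OF this, of "\<Sum>b\<in>Basis. \<xi> b *s b"]
  obtain s where s: "(\<Sum>b\<in>Basis. \<xi> b *s b) = ?F s" by blast
  have "killing s b = \<xi> b" if "b \<in> Basis" for b
    using rep[OF that, of "killing s"] rep[OF that, of \<xi>] unfolding s by (rule trans[OF sym])
  then have "killing s = \<xi>" by (rule ext[OF killing_lin \<xi>])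
  then show ?thesis by blast
qed

text \<open>Choose \<open>s\<close> such that \<open>S\<close> and \<open>ad s\<close> have the same trace against all \<open>ad y\<close>.  Then \<open>S - ad s\<close> is a
  derivation with values in the radical of the Killing form.\<close>

lemma derivation_inner:
  assumes ss: semisimple and S: "derivation S" shows "\<exists>s. \<forall>x. S x = br s x"
proof -
  have lS: "lin S" using S by (simp add: derivation_def)
  have "Vector_Spaces.linear scale (*) (\<lambda>y. trace (\<lambda>z. S (br y z)))"
    by (rule formI) (simp_all only: br_add_left br_scale_left lin_add[OF lS] lin_scale[OF lS] trace_add trace_scale)
  from killing_represents[OF ss this] obtain s where s: "\<And>y. trace (\<lambda>z. S (br y z)) = killing s y" by blast
  let ?E = "\<lambda>x. S x - br s x"
  have "S (br u v) - br s (br u v) = br (?E u) v + br u (?E v)" for u v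
  proof -
    have "S (br u v) = br (S u) v + br u (S v)" using S by (simp add: derivation_def)
    then show ?thesis unfolding br_br[of s u v] br_diff_left br_diff_right by simp
  qed
  then have E: "derivation ?E" unfolding derivation_def using lin_minus[OF lS lin_br] by blast
  have "?E x = 0" for x
  proof (rule killing_nondegenerate[OF ss])
    fix y
    have "killing (?E x) y = trace (\<lambda>z. S (br (br x y) z)) - trace (\<lambda>z. br s (br (br x y) z))"
      unfolding killing_derivation[OF E] trace_diff ..
    then show "killing (?E x) y = 0" unfolding s killing_def[symmetric] by simp
  qed
  then have "S x = br s x" for x by (simp only: right_minus_eq)
  then show ?thesis by blast
qed

section \<open>Cartan subalgebras\<close>

text \<open>The Fitting null component of \<open>ad x\<close> in \<open>L\<close>.\<close>

definition fitting :: "'g set \<Rightarrow> 'g \<Rightarrow> 'g set" where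
  "fitting L x = L \<inter> gen_eig (br x) 0"

lemma subspace_fitting: "subspace L \<Longrightarrow> subspace (fitting L x)"
  unfolding fitting_def by (rule subspace_inter[OF _ subspace_gen_eig[OF lin_br]])

lemma self_in_fitting: "x \<in> L \<Longrightarrow> x \<in> fitting L x"
  using eigenvector_gen_eig[of "br x" x 0] br_self[of x] by (simp add: fitting_def)

lemma subalgebra_fitting: "subalgebra L \<Longrightarrow> subalgebra (fitting L x)"
  using gen_eig_br[of _ x 0 _ 0] subspace_fitting[of L x] by (auto simp: subalgebra_def fitting_def)

lemma eig_proj_map_gen_eig:
  assumes T: "lin T" and S: "lin S" "\<And>l v. v \<in> gen_eig T l \<Longrightarrow> S v \<in> gen_eig T l"
  shows "eig_proj T l (S v) = S (eig_proj T l v)"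
proof (rule eig_proj_eqI[OF T, where w = "\<lambda>l. S (eig_proj T l v)"])
  show "S (eig_proj T l v) \<in> gen_eig T l" for l by (rule S(2)[OF eig_proj_in_gen_eig[OF T]])
  show "S v = (\<Sum>l\<in>spectrum T. S (eig_proj T l v))"
    by (simp only: lin_sum[OF S(1), symmetric] eig_proj_sum[OF T])
qed

text \<open>Along the line \<open>x + s y\<close> the Fitting component can only shrink for almost all \<open>s\<close>, hence by
  minimality it stays equal to that of \<open>x\<close>.  So \<open>ad (x + s y)\<close> is nilpotent there for infinitely
  many \<open>s\<close>, and the top coefficient in \<open>s\<close> of its power is the power of \<open>ad y\<close>.\<close>

lemma minimal_fitting_nilpotent:
  assumes L: "subalgebra L" and M: "subspace M" "M \<subseteq> L" and x: "x \<in> M" and y: "y \<in> M"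
    and y0: "y \<in> gen_eig (br x) 0"
    and min: "\<And>z. z \<in> M \<Longrightarrow> dim (fitting L x) \<le> dim (fitting L z)"
    and k: "k \<in> fitting L x"
  shows "(br y ^^ card Basis) k = 0"
proof -
  note sL = subspace_of_subalgebra[OF L]
  let ?P = "eig_proj (br x) 0" and ?n = "card Basis"
  let ?K = "fitting L x" and ?U = "{v \<in> L. ?P v = 0}"
  have Lx: "br x v \<in> L" if "v \<in> L" for v using subalgebra_br[OF L _ that] x M by blast
  have PL: "?P v \<in> ?K" if "v \<in> L" for v
    unfolding fitting_def using eig_proj_facts(1,2)[OF lin_br sL Lx that] by blast
  have sU: "subspace ?U" by (rule subspace_kernel_on[OF eig_proj_lin[OF lin_br] sL])
  have PK: "?P v = v" if "v \<in> ?K" for v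
    using eig_proj_gen_eig[OF lin_br, of v x 0 0] that by (simp add: fitting_def)
  have injU: "v = 0" if "v \<in> ?U" "br x v = 0" for v
  proof -
    have "v \<in> gen_eig (br x) 0" using that(2) by (intro eigenvector_gen_eig) simp
    then show ?thesis using that(1) eig_proj_gen_eig[OF lin_br, of v x 0 0] by simp
  qed
  let ?F = "{s. \<exists>v\<in>?U. v \<noteq> 0 \<and> br x v + s *s br y v = 0}"
  have F: "finite ?F" by (rule pencil_injective[OF lin_br lin_br sU injU])
  have nil: "((\<lambda>v. br x v + s *s br y v) ^^ ?n) k = 0" if s: "s \<in> - ?F" for s
  proof -
    let ?z = "x + s *s y"
    have z: "br ?z = (\<lambda>v. br x v + s *s br y v)" by (simp add: fun_eq_iff br_add_left br_scale_left)
    have zM: "?z \<in> M" using x y M(1) by (intro subspace_add subspace_scale)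
    have z0: "?z \<in> gen_eig (br x) 0"
      using self_in_fitting[of x UNIV] y0 unfolding fitting_def
      by (intro subspace_add[OF subspace_gen_eig[OF lin_br]] subspace_scale[OF subspace_gen_eig[OF lin_br]]) auto
    have zG: "br ?z v \<in> gen_eig (br x) l" if "v \<in> gen_eig (br x) l" for v l
      using gen_eig_br[OF z0 that] by simp
    have zP: "?P (br ?z v) = br ?z (?P v)" for v by (rule eig_proj_map_gen_eig[OF lin_br lin_br zG])
    have zL: "br ?z v \<in> L" if "v \<in> L" for v using subalgebra_br[OF L _ that] zM M by blast
    have zU: "br ?z v \<in> ?U" if "v \<in> ?U" for v
      using that zL by (simp add: zP br_zero_right)
    have zinj: "v = 0" if v: "v \<in> ?U" "br ?z v = 0" for v
      using s v by (auto simp: z)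
    have zpow: "v = 0" if "v \<in> ?U" "(br ?z ^^ j) v = 0" for v j
      using that
    proof (induction j arbitrary: v)
      case (Suc j)
      have "(br ?z ^^ j) (br ?z v) = 0" using Suc.prems(2) unfolding funpow_Suc_right o_apply .
      from Suc.IH[OF zU[OF Suc.prems(1)] this] show ?case by (rule zinj[OF Suc.prems(1)])
    qed simp
    have sub: "fitting L ?z \<subseteq> ?K"
    proof
      fix v assume v: "v \<in> fitting L ?z"
      then obtain j where j: "(br ?z ^^ j) v = 0" by (auto simp: fitting_def gen_eig_0)
      have vL: "v \<in> L" using v by (simp add: fitting_def)
      let ?u = "v - ?P v"
      have PLv: "?P v \<in> L" using PL[OF vL] by (simp add: fitting_def)
      have "(br ?z ^^ i) (?P v) = ?P ((br ?z ^^ i) v)" for i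
      proof (induction i)
        case (Suc i)
        then show ?case by (simp only: funpow.simps o_apply zP)
      qed simp
      then have "(br ?z ^^ j) ?u = 0"
        using j lin_zero[OF eig_proj_lin[OF lin_br]] by (simp add: lin_diff[OF lin_funpow[OF lin_br]])
      moreover have "?u \<in> ?U"
        using subspace_diff[OF sL vL PLv] PK[OF PL[OF vL]] by (simp add: lin_diff[OF eig_proj_lin[OF lin_br]])
      ultimately have "?u = 0" using zpow by blast
      then show "v \<in> ?K" using PL[OF vL] by simp
    qed
    have "fitting L ?z = ?K"
      by (rule subspace_dim_equal[OF subspace_fitting[OF sL] subspace_fitting[OF sL] sub min[OF zM]])
    then have "k \<in> gen_eig (br ?z) 0" using k by (auto simp: fitting_def)
    then have "(br ?z ^^ ?n) k = 0" using funpow_dim_eq_0[OF lin_br] unfolding gen_eig_0 by blast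
    then show ?thesis unfolding z .
  qed
  obtain c where c: "\<And>s. ((\<lambda>v. br x v + s *s br y v) ^^ ?n) k = (\<Sum>i\<le>?n. s ^ i *s c i)"
    "c ?n = (br y ^^ ?n) k" using pencil_power_expansion[OF lin_br lin_br, of ?n x y k] by blast
  have "infinite (- ?F)" using F infinite_UNIV_char_0 by (simp add: Compl_eq_Diff_UNIV)
  then have "c ?n = 0"
    by (rule vector_polynomial_zero[where n = "?n"]) (use nil c(1) in auto)
  then show ?thesis using c(2) by simp
qed

lemma minimal_fitting_exists:
  assumes "M \<noteq> {}" shows "\<exists>x\<in>M. \<forall>z\<in>M. dim (fitting L x) \<le> dim (fitting L z)"
proof -
  obtain x where "x \<in> M" using assms by blast
  then show ?thesis using ex_has_least_nat[of "\<lambda>x. x \<in> M" x "\<lambda>z. dim (fitting L z)"] by blast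
qed

text \<open>A Fitting component of least dimension is nilpotent by \<open>minimal_fitting_nilpotent\<close> and Engel's
  theorem; every Fitting component is its own normalizer.\<close>

lemma cartan_subalgebra_exists:
  assumes L: "subalgebra L" shows "\<exists>H. cartan_subalgebra L H"
proof -
  note sL = subspace_of_subalgebra[OF L]
  have "L \<noteq> {}" using subspace_0[OF sL] by blast
  from minimal_fitting_exists[OF this, of L]
  obtain x where x: "x \<in> L" "\<And>z. z \<in> L \<Longrightarrow> dim (fitting L x) \<le> dim (fitting L z)" by blast
  let ?H = "fitting L x"
  have H: "subalgebra ?H" by (rule subalgebra_fitting[OF L])
  have "nilpotent ?H"
  proof (rule nilpotent_if_adnil[OF H])
    fix y k assume y: "y \<in> ?H" and k: "k \<in> ?H"
    have "(br y ^^ card Basis) k = 0"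
      by (rule minimal_fitting_nilpotent[OF L sL subset_refl x(1) _ _ x(2) k]) (use y in \<open>auto simp: fitting_def\<close>)
    then show "\<exists>j. (br y ^^ j) k = 0" by blast
  qed
  moreover have "{y \<in> L. \<forall>h\<in>?H. br y h \<in> ?H} = ?H"
  proof
    show "?H \<subseteq> {y \<in> L. \<forall>h\<in>?H. br y h \<in> ?H}"
      using subalgebra_br[OF H] by (auto simp: fitting_def)
    show "{y \<in> L. \<forall>h\<in>?H. br y h \<in> ?H} \<subseteq> ?H"
    proof
      fix y assume y: "y \<in> {y \<in> L. \<forall>h\<in>?H. br y h \<in> ?H}"
      then have "br y x \<in> ?H" using self_in_fitting[OF x(1)] by blast
      then have "br x y \<in> ?H"
        using subspace_neg[OF subspace_fitting[OF sL]] br_skew[of x y] by simp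
      then obtain j where "(br x ^^ j) (br x y) = 0" by (auto simp: fitting_def gen_eig_0)
      then have "(br x ^^ Suc j) y = 0" unfolding funpow_Suc_right o_apply .
      then have "y \<in> gen_eig (br x) 0" unfolding gen_eig_0 by blast
      then show "y \<in> ?H" using y by (simp add: fitting_def)
    qed
  qed
  ultimately have "cartan_subalgebra L ?H"
    using H unfolding cartan_subalgebra_def by (auto simp: fitting_def)
  then show ?thesis by blast
qed

lemma rank_cartan:
  assumes "subalgebra L" shows "\<exists>H. cartan_subalgebra L H \<and> rank L = dim H"
  using someI_ex[OF cartan_subalgebra_exists[OF assms]] unfolding rank_def by blast

text \<open>Choose \<open>h \<in> H\<close> with a Fitting component \<open>K\<close> of least dimension among the elements of \<open>H\<close>.  Then
  \<open>H\<close> acts nilpotently on \<open>K\<close>, and if \<open>K\<close> were larger than \<open>H\<close>, Engel's theorem for \<open>K / H\<close> would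
  give an element outside \<open>H\<close> that normalizes \<open>H\<close>.\<close>

lemma cartan_subalgebra_regular:
  assumes L: "subalgebra L" and H: "cartan_subalgebra L H" shows "\<exists>h\<in>H. fitting L h = H"
proof -
  note sL = subspace_of_subalgebra[OF L]
  have subH: "subalgebra H" and HL: "H \<subseteq> L" and nilH: "nilpotent H"
    and norm: "{x \<in> L. \<forall>h\<in>H. br x h \<in> H} = H" using H by (auto simp: cartan_subalgebra_def)
  note sH = subspace_of_subalgebra[OF subH]
  have nil: "\<exists>k. (br x ^^ k) y = 0" if "x \<in> H" "y \<in> H" for x y
    by (rule nilpotent_subalgebra_adnil[OF nilH that])
  have "H \<noteq> {}" using subspace_0[OF sH] by blast
  from minimal_fitting_exists[OF this, of L]
  obtain h where h: "h \<in> H" "\<And>z. z \<in> H \<Longrightarrow> dim (fitting L h) \<le> dim (fitting L z)" by blast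
  let ?K = "fitting L h"
  have HK: "H \<subseteq> ?K" using HL nil[OF h(1)] by (auto simp: fitting_def gen_eig_0)
  have "?K = H"
  proof (rule ccontr)
    assume "?K \<noteq> H"
    then have HK': "H \<subset> ?K" using HK by blast
    have "\<exists>u\<in>?K. u \<notin> H \<and> (\<forall>x\<in>H. br x u \<in> H)"
    proof (rule engel[OF subH nil subspace_fitting[OF sL] sH HK'])
      show "br x u \<in> ?K" if "x \<in> H" "u \<in> ?K" for x u
        using subalgebra_br[OF subalgebra_fitting[OF L]] that HK by blast
      show "br x u \<in> H" if "x \<in> H" "u \<in> H" for x u by (rule subalgebra_br[OF subH that])
      show "\<exists>k. (br x ^^ k) u \<in> H" if "x \<in> H" "u \<in> ?K" for x u
      proof -
        have "(br x ^^ card Basis) u = 0"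
          by (rule minimal_fitting_nilpotent[OF L sH HL h(1) that(1) _ h(2) that(2)])
            (use HK that(1) in \<open>auto simp: fitting_def\<close>)
        then show ?thesis using subspace_0[OF sH] by metis
      qed
    qed
    then obtain u where u: "u \<in> ?K" "u \<notin> H" "\<And>x. x \<in> H \<Longrightarrow> br x u \<in> H" by blast
    have "br u x \<in> H" if "x \<in> H" for x
      using subspace_neg[OF sH u(3)[OF that]] br_skew[of u x] by simp
    then have "u \<in> {x \<in> L. \<forall>h\<in>H. br x h \<in> H}" using u(1) by (auto simp: fitting_def)
    then show False using norm u(2) by simp
  qed
  then show ?thesis using h(1) by blast
qed

text \<open>Nondegeneracy on \<open>L\<close> of the restriction of the Killing form of the ambient algebra.\<close>

definition nondegenerate :: "'g set \<Rightarrow> bool" where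
  "nondegenerate L \<longleftrightarrow> (\<forall>x\<in>L. (\<forall>y\<in>L. killing x y = 0) \<longrightarrow> x = 0)"

lemma nondegenerate_fitting:
  assumes L: "subalgebra L" and nd: "nondegenerate L" and h: "h \<in> L"
  shows "nondegenerate (fitting L h)"
  unfolding nondegenerate_def
proof (intro ballI impI)
  fix x assume x: "x \<in> fitting L h" and x0: "\<forall>y\<in>fitting L h. killing x y = 0"
  note sL = subspace_of_subalgebra[OF L]
  have "killing x y = 0" if y: "y \<in> L" for y
  proof -
    have P: "eig_proj (br h) l y \<in> gen_eig (br h) l" "eig_proj (br h) l y \<in> L" for l
      using eig_proj_facts(1,2)[OF lin_br sL subalgebra_br[OF L h] y] by blast+
    have "killing x (eig_proj (br h) l y) = 0" for l
    proof (cases "l = 0")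
      case True
      then show ?thesis using x0 P[of 0] by (simp add: fitting_def)
    next
      case False
      then show ?thesis using killing_gen_eig_orthogonal[OF _ P(1)] x by (simp add: fitting_def)
    qed
    then have "(\<Sum>l\<in>spectrum (br h). killing x (eig_proj (br h) l y)) = 0" by simp
    then show ?thesis unfolding killing_sum_right[symmetric] eig_proj_sum[OF lin_br] .
  qed
  then show "x = 0" using nd x by (auto simp: nondegenerate_def fitting_def)
qed

text \<open>The last nonzero term of the lower central series is central and, if \<open>H\<close> is not abelian, lies in
  the commutator.  So it consists of nilpotent elements commuting with \<open>H\<close>, which are orthogonal
  to \<open>H\<close>.\<close>

lemma nilpotent_nondegenerate_abelian:
  assumes H: "subalgebra H" and nil: "nilpotent H" and nd: "nondegenerate H"
    and "x \<in> H" "y \<in> H"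
  shows "br x y = 0"
proof -
  let ?C = "\<lambda>n. (commutator H ^^ n) H"
  have CH: "?C n \<subseteq> H" for n
  proof (induction n)
    case (Suc n)
    then have "commutator H (?C n) \<subseteq> H"
      by (intro commutator_subset subspace_of_subalgebra[OF H] subalgebra_br[OF H]) blast+
    then show ?case by simp
  qed simp
  define n where "n = (LEAST n. ?C n = {0})"
  have n: "?C n = {0}" unfolding n_def using nil unfolding nilpotent_def by (rule LeastI_ex)
  have n': "?C k \<noteq> {0}" if "k < n" for k using that not_less_Least unfolding n_def by blast
  have "n \<le> 1"
  proof (rule ccontr)
    assume "\<not> n \<le> 1"
    then obtain j where j: "n = Suc (Suc j)" using less_imp_Suc_add[of 1 n] by auto
    have "a = 0" if a: "a \<in> ?C (Suc j)" for a
    proof -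
      have aH: "a \<in> H" using CH a by blast
      have c: "br b a = 0" if "b \<in> H" for b
        using commutator_in[OF that a] n unfolding j by simp
      then have c': "br a b = 0" if "b \<in> H" for b using br_zero_sym that by blast
      have "{br x y | x y. x \<in> H \<and> y \<in> ?C j} \<subseteq> {br x b | x b. b \<in> H}" using CH[of j] by blast
      then have "commutator H (?C j) \<subseteq> span {br x b | x b. b \<in> H}"
        by (subst commutator_def) (rule span_mono)
      moreover have "a \<in> commutator H (?C j)" using a by simp
      ultimately have "a \<in> span {br x b | x b. b \<in> H}" by blast
      then have "adnil a" using adnil_if_sum_of_brackets_with_centralizer[of H a] c' by blast
      then have "\<forall>y\<in>H. killing a y = 0" using killing_commuting_nilpotent c' by blast
      then show ?thesis using nd aH unfolding nondegenerate_def by blast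
    qed
    then have "?C (Suc j) \<subseteq> {0}" by blast
    moreover have "0 \<in> ?C (Suc j)" using subspace_0[OF subspace_commutator] by simp
    ultimately show False using n'[of "Suc j"] j by blast
  qed
  then have "?C 1 = {0}"
  proof (cases "n = 0")
    case True
    then have "H = {0}" using n by simp
    then have "commutator H H \<subseteq> {0}" by (intro commutator_subset subspace_single_0) (auto simp: br_zero_left)
    then show ?thesis using subspace_0[OF subspace_commutator, of H H] by auto
  next
    case False
    then show ?thesis using n \<open>n \<le> 1\<close> by (simp add: le_Suc_eq)
  qed
  then show ?thesis using commutator_in[OF assms(4,5)] by simp
qed

section \<open>Formal power series with coefficients in a Lie algebra\<close>

text \<open>A sequence stands for the formal power series in a variable \<open>s\<close> of which it lists the coefficients.
  The bracket of two series follows.\<close>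

definition cauchy_bracket :: "(nat \<Rightarrow> 'g) \<Rightarrow> (nat \<Rightarrow> 'g) \<Rightarrow> nat \<Rightarrow> 'g" where
  "cauchy_bracket u v k = (\<Sum>a\<le>k. br (u a) (v (k - a)))"

definition formal_derivative :: "(nat \<Rightarrow> 'g) \<Rightarrow> nat \<Rightarrow> 'g" where
  "formal_derivative u k = of_nat (Suc k) *s u (Suc k)"

lemma cauchy_bracket_add_left: "cauchy_bracket (\<lambda>k. u k + u' k) v k = cauchy_bracket u v k + cauchy_bracket u' v k"
  unfolding cauchy_bracket_def br_add_left sum.distrib ..

lemma cauchy_bracket_cong_left: "(\<And>a. a \<le> k \<Longrightarrow> u a = u' a) \<Longrightarrow> cauchy_bracket u v k = cauchy_bracket u' v k"
  unfolding cauchy_bracket_def by (intro sum.cong) auto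

lemma cauchy_bracket_cong_right: "(\<And>a. a \<le> k \<Longrightarrow> v a = v' a) \<Longrightarrow> cauchy_bracket u v k = cauchy_bracket u v' k"
  unfolding cauchy_bracket_def by (intro sum.cong) auto

lemma formal_derivative_cauchy_bracket:
  "formal_derivative (cauchy_bracket u v) k = cauchy_bracket (formal_derivative u) v k + cauchy_bracket u (formal_derivative v) k"
proof -
  let ?w = "\<lambda>a. br (u a) (v (Suc k - a))"
  have "formal_derivative (cauchy_bracket u v) k = (\<Sum>a\<le>Suc k. of_nat (Suc k) *s ?w a)"
    unfolding formal_derivative_def cauchy_bracket_def scale_sum_right ..
  also have "\<dots> = (\<Sum>a\<le>Suc k. of_nat a *s ?w a + of_nat (Suc k - a) *s ?w a)"
  proof (rule sum.cong)
    fix a assume "a \<in> {..Suc k}"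
    then have "(of_nat (Suc k) :: 'k) = of_nat a + of_nat (Suc k - a)"
      by (simp only: of_nat_add[symmetric]) simp
    then show "of_nat (Suc k) *s ?w a = of_nat a *s ?w a + of_nat (Suc k - a) *s ?w a"
      by (simp only: scale_left_distrib)
  qed simp
  also have "\<dots> = (\<Sum>a\<le>Suc k. of_nat a *s ?w a) + (\<Sum>a\<le>Suc k. of_nat (Suc k - a) *s ?w a)"
    by (rule sum.distrib)
  also have "(\<Sum>a\<le>Suc k. of_nat a *s ?w a) = cauchy_bracket (formal_derivative u) v k"
    unfolding sum.atMost_Suc_shift cauchy_bracket_def formal_derivative_def
    by (simp only: br_scale_left diff_Suc_Suc of_nat_0 scale_zero_left add_0)
  also have "(\<Sum>a\<le>Suc k. of_nat (Suc k - a) *s ?w a) = cauchy_bracket u (formal_derivative v) k"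
    unfolding sum.atMost_Suc cauchy_bracket_def formal_derivative_def
    by (simp add: br_scale_right Suc_diff_le)
  finally show ?thesis .
qed

lemma triangle_sum_swap:
  "(\<Sum>a\<le>k. \<Sum>b\<le>k - a. g a b) = (\<Sum>b\<le>k. \<Sum>a\<le>k - b. g a b)" for g :: "nat \<Rightarrow> nat \<Rightarrow> 'g"
proof -
  have 1: "(\<Sum>b\<le>k - a. g a b) = sum (g a) {b \<in> {..k}. a + b \<le> k}" if "a \<in> {..k}" for a
    by (rule sum.cong) (use that in auto)
  have 2: "sum (\<lambda>a. g a b) {a \<in> {..k}. a + b \<le> k} = (\<Sum>a\<le>k - b. g a b)" if "b \<in> {..k}" for b
    by (rule sum.cong) (use that in auto)
  have "(\<Sum>a\<le>k. \<Sum>b\<le>k - a. g a b) = (\<Sum>a\<le>k. sum (g a) {b \<in> {..k}. a + b \<le> k})"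
    by (rule sum.cong[OF refl 1])
  also have "\<dots> = (\<Sum>b\<le>k. sum (\<lambda>a. g a b) {a \<in> {..k}. a + b \<le> k})"
    by (rule sum.swap_restrict) auto
  also have "\<dots> = (\<Sum>b\<le>k. \<Sum>a\<le>k - b. g a b)"
    by (rule sum.cong[OF refl 2])
  finally show ?thesis .
qed

lemma triangle_sum_diagonal:
  "(\<Sum>j\<le>k. \<Sum>i\<le>j. f i (j - i) (k - j)) = (\<Sum>j\<le>k. \<Sum>i\<le>k - j. f j i (k - j - i))"
  for f :: "nat \<Rightarrow> nat \<Rightarrow> nat \<Rightarrow> 'g"
  using fps_mult_assoc_lemma[of f k k] by (simp only: atLeast0AtMost)

lemma cauchy_bracket_jacobi: "cauchy_bracket B (cauchy_bracket u v) k = cauchy_bracket (cauchy_bracket B u) v k + cauchy_bracket u (cauchy_bracket B v) k"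
proof -
  have "cauchy_bracket B (cauchy_bracket u v) k = (\<Sum>a\<le>k. \<Sum>b\<le>k - a.
      br (br (B a) (u b)) (v (k - a - b)) + br (u b) (br (B a) (v (k - a - b))))"
    unfolding cauchy_bracket_def br_sum_right by (intro sum.cong refl br_br)
  also have "\<dots> = (\<Sum>a\<le>k. \<Sum>b\<le>k - a. br (br (B a) (u b)) (v (k - a - b)))
      + (\<Sum>a\<le>k. \<Sum>b\<le>k - a. br (u b) (br (B a) (v (k - a - b))))"
    by (simp only: sum.distrib)
  also have "(\<Sum>a\<le>k. \<Sum>b\<le>k - a. br (br (B a) (u b)) (v (k - a - b))) = cauchy_bracket (cauchy_bracket B u) v k"
    unfolding cauchy_bracket_def br_sum_left by (rule triangle_sum_diagonal[symmetric])
  also have "(\<Sum>a\<le>k. \<Sum>b\<le>k - a. br (u b) (br (B a) (v (k - a - b)))) = cauchy_bracket u (cauchy_bracket B v) k"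
    unfolding cauchy_bracket_def br_sum_right
    by (subst triangle_sum_swap) (simp only: diff_commute)
  finally show ?thesis .
qed

lemma formal_ode_zero:
  assumes "\<And>k. k < N \<Longrightarrow> formal_derivative W k = cauchy_bracket B W k" "W 0 = 0" "k \<le> N"
  shows "W k = 0"
  using assms(3)
proof (induction k rule: less_induct)
  case (less k)
  show ?case
  proof (cases k)
    case (Suc j)
    have "W (j - a) = 0" for a using less Suc by simp
    then have "formal_derivative W j = 0"
      using assms(1)[of j] less.prems Suc by (simp add: cauchy_bracket_def br_zero_right)
    then have "of_nat (Suc j) *s W (Suc j) = 0" unfolding formal_derivative_def .
    then show ?thesis using Suc by (simp only: scale_eq_0_iff of_nat_eq_0_iff) simp
  qed (use assms(2) in simp)
qed

text \<open>The solution of \<open>X' = [B, X]\<close> with constant term \<open>c\<close>.\<close>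

fun flow :: "(nat \<Rightarrow> 'g) \<Rightarrow> nat \<Rightarrow> 'g \<Rightarrow> 'g" where
  "flow B 0 c = c"
| "flow B (Suc k) c = inverse (of_nat (Suc k)) *s (\<Sum>a\<le>k. br (B a) (flow B (k - a) c))"

lemma flow_ode: "formal_derivative (\<lambda>k. flow B k c) k = cauchy_bracket B (\<lambda>k. flow B k c) k"
  unfolding formal_derivative_def cauchy_bracket_def flow.simps scale_scale
  by (subst right_inverse) (simp_all del: of_nat_Suc)

lemma flow_in:
  assumes L: "subalgebra L" and "\<And>a. B a \<in> L" "c \<in> L" shows "flow B k c \<in> L"
proof (induction k rule: less_induct)
  case (less k)
  show ?case
  proof (cases k)
    case (Suc j)
    have "inverse (of_nat (Suc j)) *s (\<Sum>a\<le>j. br (B a) (flow B (j - a) c)) \<in> L"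
      using less.IH Suc assms(2) subspace_of_subalgebra[OF L]
      by (intro subspace_scale subspace_sum subalgebra_br[OF L]) auto
    then show ?thesis using Suc by simp
  qed (use assms in simp)
qed

lemma flow_cong:
  "(\<And>a. a < k \<Longrightarrow> B a = B' a) \<Longrightarrow> flow B k c = flow B' k c"
proof (induction k rule: less_induct)
  case (less k)
  show ?case
  proof (cases k)
    case (Suc j)
    have "(\<Sum>a\<le>j. br (B a) (flow B (j - a) c)) = (\<Sum>a\<le>j. br (B' a) (flow B' (j - a) c))"
      using less Suc by (intro sum.cong refl arg_cong2[where f = br]) auto
    then show ?thesis using Suc by simp
  qed simp
qed

text \<open>The bracket of two solutions of \<open>X' = [B, X]\<close> solves the same equation, by the Jacobi identity.\<close>

lemma flow_commute:
  assumes "br c c' = 0"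
  shows "cauchy_bracket (\<lambda>k. flow B k c) (\<lambda>k. flow B k c') k = 0"
proof -
  let ?X = "\<lambda>k. flow B k c" and ?Y = "\<lambda>k. flow B k c'"
  show ?thesis
  proof (rule formal_ode_zero[of k "cauchy_bracket ?X ?Y" B])
    show "cauchy_bracket ?X ?Y 0 = 0" using assms by (simp add: cauchy_bracket_def)
    show "formal_derivative (cauchy_bracket ?X ?Y) j = cauchy_bracket B (cauchy_bracket ?X ?Y) j" for j
      unfolding formal_derivative_cauchy_bracket cauchy_bracket_jacobi[of B ?X ?Y]
        cauchy_bracket_cong_left[of j "formal_derivative ?X" "cauchy_bracket B ?X" ?Y, OF flow_ode]
        cauchy_bracket_cong_right[of j "formal_derivative ?Y" "cauchy_bracket B ?Y" ?X, OF flow_ode] ..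
  qed simp
qed

lemma fitting_complement:
  assumes L: "subalgebra L" and h: "h \<in> L" and r: "r \<in> L"
  shows "\<exists>b\<in>L. r - br h b \<in> fitting L h"
proof -
  note sL = subspace_of_subalgebra[OF L]
  note Lh = subalgebra_br[OF L h]
  let ?P = "\<lambda>l. eig_proj (br h) l r"
  have P: "?P l \<in> L" "?P l \<in> gen_eig (br h) l" for l using eig_proj_facts(1,2)[OF lin_br sL Lh r] by blast+
  have "\<exists>b\<in>L. br h b = ?P l" if "l \<noteq> 0" for l
    using shift_surj_gen_eig[OF lin_br sL Lh _ P, of 0] that by (auto simp: shift_0)
  then obtain b where b: "\<And>l. l \<noteq> 0 \<Longrightarrow> b l \<in> L \<and> br h (b l) = ?P l" by metis
  let ?b = "\<Sum>l\<in>spectrum (br h) - {0}. b l"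
  have "br h ?b = (\<Sum>l\<in>spectrum (br h) - {0}. ?P l)"
    unfolding br_sum_right using b by (intro sum.cong) auto
  moreover have r_eq: "r = (\<Sum>l\<in>spectrum (br h) - {0}. ?P l) + (if 0 \<in> spectrum (br h) then ?P 0 else 0)"
    using eig_proj_sum[OF lin_br, of h r] finite_spectrum[OF lin_br, of h]
    by (auto simp: sum.remove[of _ 0] add.commute)
  ultimately have "r - br h ?b = (if 0 \<in> spectrum (br h) then ?P 0 else 0)"
    by (simp only: diff_eq_eq add.commute)
  then have "r - br h ?b \<in> fitting L h"
    using P[of 0] subspace_0[OF subspace_fitting[OF sL, of h]] by (simp add: fitting_def)
  moreover have "?b \<in> L" using b by (intro subspace_sum[OF sL]) auto
  ultimately show ?thesis by blast
qed

text \<open>The series \<open>h + s x\<close>.\<close>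

definition pencil :: "'g \<Rightarrow> 'g \<Rightarrow> nat \<Rightarrow> 'g" where
  "pencil h x k = (if k = 0 then h else if k = 1 then x else 0)"

text \<open>Order by order, \<open>B\<close> and \<open>f\<close> are found such that \<open>z = h + s x\<close> solves \<open>z' = [B, z] + Y\<close>, where \<open>Y\<close>
  is the series with coefficients \<open>f\<close> in the Fitting component of \<open>h\<close>, transported by the flow of \<open>B\<close>.
  The unknowns of order \<open>k\<close> enter the equation of order \<open>k\<close> through \<open>[B\<^sub>k, h] + f\<^sub>k\<close>, and such
  elements fill \<open>L\<close>.  The equations up to order \<open>N\<close> suffice below.\<close>

lemma isospectral_flow_exists:
  assumes L: "subalgebra L" and h: "h \<in> L" and x: "x \<in> L"
  shows "\<exists>B f. (\<forall>a. B a \<in> L) \<and> (\<forall>a. f a \<in> fitting L h) \<and>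
    (\<forall>k<N. formal_derivative (pencil h x) k = cauchy_bracket B (pencil h x) k + (\<Sum>a\<le>k. flow B (k - a) (f a)))"
proof (induction N)
  case 0
  show ?case
    using subspace_0[OF subspace_of_subalgebra[OF L]] subspace_0[OF subspace_fitting[OF subspace_of_subalgebra[OF L]]]
    by (intro exI[of _ "\<lambda>_. 0"]) auto
next
  case (Suc N)
  note sL = subspace_of_subalgebra[OF L]
  let ?p = "pencil h x"
  from Suc obtain B f where B: "\<And>a. B a \<in> L" and f: "\<And>a. f a \<in> fitting L h" and
    eq: "\<And>k. k < N \<Longrightarrow> formal_derivative ?p k = cauchy_bracket B ?p k + (\<Sum>a\<le>k. flow B (k - a) (f a))" by blast
  have p: "?p k \<in> L" for k using h x subspace_0[OF sL] by (simp add: pencil_def)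
  have fL: "f a \<in> L" for a using f by (auto simp: fitting_def)
  define r where "r = formal_derivative ?p N - (\<Sum>a<N. br (B a) (?p (N - a))) - (\<Sum>a<N. flow B (N - a) (f a))"
  have "r \<in> L" unfolding r_def formal_derivative_def
    using B p flow_in[OF L B fL]
    by (intro subspace_diff[OF sL] subspace_scale[OF sL] subspace_sum[OF sL] subalgebra_br[OF L]) auto
  then obtain b where b: "b \<in> L" "r - br h b \<in> fitting L h" using fitting_complement[OF L h] by blast
  let ?B = "B(N := - b)" and ?f = "f(N := r - br h b)"
  have flow: "flow ?B k c = flow B k c" if "k \<le> N" for k c
    by (rule flow_cong) (use that in auto)
  have "formal_derivative ?p k = cauchy_bracket ?B ?p k + (\<Sum>a\<le>k. flow ?B (k - a) (?f a))" if k: "k < Suc N" for k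
  proof (cases "k < N")
    case True
    have "cauchy_bracket ?B ?p k = cauchy_bracket B ?p k" by (rule cauchy_bracket_cong_left) (use True in auto)
    moreover have "(\<Sum>a\<le>k. flow ?B (k - a) (?f a)) = (\<Sum>a\<le>k. flow B (k - a) (f a))"
      using True by (intro sum.cong) (auto simp: flow)
    ultimately show ?thesis using eq[OF True] by simp
  next
    case False
    then have [simp]: "k = N" using k by simp
    have "cauchy_bracket ?B ?p N = (\<Sum>a<N. br (B a) (?p (N - a))) + br (- b) h"
      unfolding cauchy_bracket_def lessThan_Suc_atMost[symmetric] sum.lessThan_Suc by (simp add: pencil_def)
    moreover have "(\<Sum>a\<le>N. flow ?B (N - a) (?f a)) = (\<Sum>a<N. flow B (N - a) (f a)) + (r - br h b)"
      unfolding lessThan_Suc_atMost[symmetric] sum.lessThan_Suc by (simp add: flow)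
    moreover have "br (- b) h = br h b" using br_skew[of "- b" h] by (simp add: br_neg_right)
    ultimately show ?thesis by (simp add: r_def)
  qed
  moreover have "?B a \<in> L" "?f a \<in> fitting L h" for a
    using B f b subspace_neg[OF sL] by auto
  ultimately show ?case by blast
qed

text \<open>If \<open>X\<close> is the transport of an element \<open>c\<close> of the Fitting component, then \<open>[h + s x, X]\<close> solves
  \<open>W' = [B, W]\<close>: the remaining term \<open>[Y, X]\<close> vanishes because transports of commuting elements
  commute.  The constant term \<open>[h, c]\<close> is zero, and so is the solution.\<close>

lemma formal_centralizer:
  assumes L: "subalgebra L" and h: "h \<in> L" and x: "x \<in> L"
    and ab: "\<And>c c'. c \<in> fitting L h \<Longrightarrow> c' \<in> fitting L h \<Longrightarrow> br c c' = 0"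
  shows "\<exists>B. (\<forall>a. B a \<in> L) \<and> (\<forall>c\<in>fitting L h. \<forall>k\<le>N. cauchy_bracket (pencil h x) (\<lambda>k. flow B k c) k = 0)"
proof -
  let ?p = "pencil h x"
  obtain B f where B: "\<And>a. B a \<in> L" and f: "\<And>a. f a \<in> fitting L h" and
    eq: "\<And>k. k < N \<Longrightarrow> formal_derivative ?p k = cauchy_bracket B ?p k + (\<Sum>a\<le>k. flow B (k - a) (f a))"
    using isospectral_flow_exists[OF L h x, of N] by blast
  have "cauchy_bracket ?p (\<lambda>k. flow B k c) k = 0" if c: "c \<in> fitting L h" and k: "k \<le> N" for c k
  proof (rule formal_ode_zero[OF _ _ k, of _ B])
    let ?X = "\<lambda>k. flow B k c" and ?Y = "\<lambda>k. \<Sum>a\<le>k. flow B (k - a) (f a)"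
    show "cauchy_bracket ?p ?X 0 = 0" using ab[OF self_in_fitting[OF h] c] by (simp add: cauchy_bracket_def pencil_def)
    fix j assume j: "j < N"
    have "cauchy_bracket ?Y ?X j = (\<Sum>i\<le>j. \<Sum>a\<le>i. br (flow B (i - a) (f a)) (flow B (j - i) c))"
      unfolding cauchy_bracket_def br_sum_left ..
    also have "\<dots> = (\<Sum>a\<le>j. \<Sum>i\<le>j - a. br (flow B i (f a)) (flow B (j - a - i) c))"
      by (rule triangle_sum_diagonal[of "\<lambda>a i l. br (flow B i (f a)) (flow B l c)"])
    also have "\<dots> = (\<Sum>a\<le>j. cauchy_bracket (\<lambda>k. flow B k (f a)) ?X (j - a))" unfolding cauchy_bracket_def ..
    also have "\<dots> = 0" using flow_commute[OF ab[OF f c]] by simp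
    finally have YX: "cauchy_bracket ?Y ?X j = 0" .
    have "cauchy_bracket (formal_derivative ?p) ?X j = cauchy_bracket (\<lambda>k. cauchy_bracket B ?p k + ?Y k) ?X j"
      by (rule cauchy_bracket_cong_left) (use eq j in auto)
    also have "\<dots> = cauchy_bracket (cauchy_bracket B ?p) ?X j" unfolding cauchy_bracket_add_left YX by simp
    finally have 1: "cauchy_bracket (formal_derivative ?p) ?X j = cauchy_bracket (cauchy_bracket B ?p) ?X j" .
    have 2: "cauchy_bracket ?p (formal_derivative ?X) j = cauchy_bracket ?p (cauchy_bracket B ?X) j"
      by (rule cauchy_bracket_cong_right) (rule flow_ode)
    show "formal_derivative (cauchy_bracket ?p ?X) j = cauchy_bracket B (cauchy_bracket ?p ?X) j"
      unfolding formal_derivative_cauchy_bracket cauchy_bracket_jacobi[of B ?p ?X] 1 2 ..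
  qed
  then show ?thesis using B by blast
qed

text \<open>By the previous lemma, the kernel of \<open>ad (h + s x)\<close> over the formal power series has rank at
  least \<open>dim (fitting L h)\<close>.  If the centralizer of \<open>x\<close> were smaller, counting coefficients would
  produce a nonzero polynomial \<open>Q\<close> in \<open>s\<close> with values in a complement of that centralizer, killed by
  \<open>ad (h + s x)\<close>.  Its leading coefficient would commute with \<open>x\<close>.\<close>

lemma abelian_fitting_minimal:
  assumes L: "subalgebra L" and h: "h \<in> L" and x: "x \<in> L"
    and ab: "\<And>c c'. c \<in> fitting L h \<Longrightarrow> c' \<in> fitting L h \<Longrightarrow> br c c' = 0"
  shows "dim (fitting L h) \<le> dim {v \<in> L. br x v = 0}"
proof (rule ccontr)
  note sL = subspace_of_subalgebra[OF L]
  let ?Z = "{v \<in> L. br x v = 0}" and ?K = "fitting L h" and ?n = "card Basis"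
  assume "\<not> dim ?K \<le> dim ?Z"
  then have less: "dim ?Z < dim ?K" by simp
  have sZ: "subspace ?Z" by (rule subspace_kernel_on[OF lin_br sL])
  obtain B where B: "\<And>a. B a \<in> L"
    and B0: "\<And>c k. c \<in> ?K \<Longrightarrow> k \<le> ?n \<Longrightarrow> cauchy_bracket (pencil h x) (\<lambda>k. flow B k c) k = 0"
    using formal_centralizer[OF L h x ab, of ?n] by blast
  let ?X = "flow B"
  have XL: "?X k c \<in> L" if "c \<in> ?K" for k c
    by (rule flow_in[OF L B]) (use that in \<open>simp add: fitting_def\<close>)
  have X0: "br h c = 0" if "c \<in> ?K" for c using ab[OF self_in_fitting[OF h] that] .
  have XS: "br h (?X (Suc k) c) + br x (?X k c) = 0" if c: "c \<in> ?K" and k: "Suc k \<le> ?n" for k c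
  proof -
    have "cauchy_bracket (pencil h x) (\<lambda>k. ?X k c) (Suc k) = (\<Sum>a\<le>Suc k.
        (if a = 0 then br h (?X (Suc k) c) else 0) + (if a = 1 then br x (?X k c) else 0))"
      unfolding cauchy_bracket_def
      by (intro sum.cong refl) (auto simp only: pencil_def br_zero_left if_True if_False add_0_right
        add_0_left diff_zero diff_Suc_1 zero_neq_one split: if_split)
    also have "\<dots> = br h (?X (Suc k) c) + br x (?X k c)"
      unfolding sum.distrib by (simp only: sum.delta finite_atMost atMost_iff if_True zero_le One_nat_def Suc_le_mono)
    finally show ?thesis using B0[OF c k] by simp
  qed
  obtain C where C: "C \<subseteq> ?K" "independent C" "?K \<subseteq> span C" "card C = dim ?K"
    by (rule basis_exists[of ?K])
  have fC: "finite C" using C(2) finiteI_independent by blast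
  obtain D where D: "D \<subseteq> ?Z" "independent D" "?Z \<subseteq> span D" "card D = dim ?Z"
    by (rule basis_exists[of ?Z])
  have fD: "finite D" using D(2) finiteI_independent by blast
  obtain P where P: "lin P" "\<And>v. P v \<in> ?Z" "\<And>v. v \<in> ?Z \<Longrightarrow> P v = v" using projection_exists[OF sZ] by blast
  obtain E where E: "D \<subseteq> E" "E \<subseteq> UNIV" "independent E" "UNIV \<subseteq> span E"
    by (rule maximal_independent_subset_extend[OF subset_UNIV D(2)])
  have spE: "span E = UNIV" using E(4) by blast
  let ?R = "\<lambda>w b. representation E w b"
  have R: "Vector_Spaces.linear scale (*) (\<lambda>w. ?R w b)" for b by (rule linear_representation[OF E(3) spE])
  have R0: "w = 0" if "w \<in> ?Z" "\<And>b. b \<in> D \<Longrightarrow> ?R w b = 0" for w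
  proof -
    have w: "w \<in> span D" using that(1) D(3) by blast
    have "representation D w b = 0" if "b \<in> D" for b
      using \<open>\<And>b. b \<in> D \<Longrightarrow> ?R w b = 0\<close>[OF that] unfolding representation_extend[OF E(3) w E(1)] .
    then have "(\<Sum>b\<in>D. representation D w b *s b) = 0" by (intro sum.neutral) simp
    then show ?thesis unfolding sum_representation_eq[OF D(2) w fD order_refl] .
  qed
  \<comment> \<open>unknowns: the coefficients, up to order \<open>n\<close>, of the basis \<open>C\<close> in a combination of transports\<close>
  let ?I = "C \<times> {..?n}"
  \<comment> \<open>equations: the orders up to \<open>n\<close> avoid the centralizer, and the order \<open>n + 1\<close> is killed\<close>
  let ?J = "(Inl ` (D \<times> {..?n}) :: ('g \<times> nat + 'g) set) \<union> Inr ` Basis"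
  let ?Y = "\<lambda>i l. if snd i \<le> l then ?X (l - snd i) (fst i) else 0"
  define M where "M i j = (case j of Inl bl \<Rightarrow> ?R (P (?Y i (snd bl))) (fst bl)
      | Inr b \<Rightarrow> representation Basis (br x (?Y i ?n)) b)" for i j
  have fI: "finite ?I" using fC by simp
  have fJ: "finite ?J" using fD finite_Basis by simp
  have "card ?J \<le> card (Inl ` (D \<times> {..?n}) :: ('g \<times> nat + 'g) set) + card (Inr ` Basis :: ('g \<times> nat + 'g) set)"
    by (rule card_Un_le)
  also have "\<dots> = dim ?Z * Suc ?n + ?n" by (simp add: card_image card_cartesian_product D(4))
  also have "\<dots> < Suc (dim ?Z) * Suc ?n" by simp
  also have "\<dots> \<le> dim ?K * Suc ?n" using less by (intro mult_le_mono1) simp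
  also have "\<dots> = card ?I" by (simp add: card_cartesian_product C(4))
  finally have "card ?J < card ?I" .
  from homogeneous_system_nontrivial_solution[OF fI fJ this, of M]
  obtain a where a: "\<exists>i\<in>?I. a i \<noteq> 0" "\<And>j. j \<in> ?J \<Longrightarrow> (\<Sum>i\<in>?I. a i * M i j) = 0" by blast
  define Q where "Q l = (\<Sum>i\<in>?I. a i *s ?Y i l)" for l
  have CK: "fst i \<in> ?K" if "i \<in> ?I" for i using that C(1) by auto
  have QL: "Q l \<in> L" for l
    unfolding Q_def using XL[OF CK] subspace_0[OF sL]
    by (intro subspace_sum[OF sL] subspace_scale[OF sL]) simp
  have PQ: "P (Q l) = 0" if l: "l \<le> ?n" for l
  proof (rule R0[OF P(2)])
    fix b assume b: "b \<in> D"
    have "?R (P (Q l)) b = (\<Sum>i\<in>?I. a i * ?R (P (?Y i l)) b)"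
      unfolding Q_def lin_sum[OF P(1)] lin_scale[OF P(1)] form_sum[OF R] form_scale[OF R] ..
    also have "\<dots> = (\<Sum>i\<in>?I. a i * M i (Inl (b, l)))" by (simp only: M_def sum.case fst_conv snd_conv)
    also have "\<dots> = 0" by (rule a(2)) (use b l in simp)
    finally show "?R (P (Q l)) b = 0" .
  qed
  have top: "br x (Q ?n) = 0"
    unfolding eq_iff_rep
  proof
    fix b assume b: "b \<in> Basis"
    have "representation Basis (br x (Q ?n)) b = (\<Sum>i\<in>?I. a i * representation Basis (br x (?Y i ?n)) b)"
      unfolding Q_def br_sum_right br_scale_right rep_sum_scale ..
    also have "\<dots> = (\<Sum>i\<in>?I. a i * M i (Inr b))" by (simp only: M_def sum.case)
    also have "\<dots> = 0" by (rule a(2)) (use b in simp)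
    finally show "representation Basis (br x (Q ?n)) b = representation Basis 0 b"
      by (simp add: form_zero[OF rep_lin])
  qed
  have step: "br h (Q (Suc l)) + br x (Q l) = 0" if l: "Suc l \<le> ?n" for l
  proof -
    have "br h (Q (Suc l)) + br x (Q l) = (\<Sum>i\<in>?I. a i *s (br h (?Y i (Suc l)) + br x (?Y i l)))"
      unfolding Q_def br_sum_right br_scale_right scale_right_distrib sum.distrib ..
    also have "\<dots> = (\<Sum>i\<in>?I. a i *s 0)"
    proof (intro sum.cong refl arg_cong[where f = "scale (a _)"])
      fix i assume i: "i \<in> ?I"
      consider "snd i \<le> l" | "snd i = Suc l" | "snd i > Suc l" by linarith
      then show "br h (?Y i (Suc l)) + br x (?Y i l) = 0"
      proof cases
        case 1
        then show ?thesis using XS[OF CK[OF i], of "l - snd i"] l by (simp add: Suc_diff_le del: flow.simps)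
      next
        case 2
        then show ?thesis using X0[OF CK[OF i]] by (simp add: br_zero_right)
      next
        case 3
        then show ?thesis by (simp add: br_zero_right)
      qed
    qed
    finally show ?thesis by simp
  qed
  have zero: "Q l = 0" if "br x (Q l) = 0" "l \<le> ?n" for l
  proof -
    have "P (Q l) = Q l" by (rule P(3)) (use QL that in blast)
    then show ?thesis using PQ[OF that(2)] by simp
  qed
  \<comment> \<open>from the leading coefficient downwards, all coefficients commute with \<open>x\<close> and vanish\<close>
  have Q0: "Q (?n - j) = 0" for j
  proof (induction j)
    case 0
    then show ?case using zero[of ?n] top by simp
  next
    case (Suc j)
    show ?case
    proof (cases "j < ?n")
      case True
      then have s: "?n - j = Suc (?n - Suc j)" by simp
      have "br x (Q (?n - Suc j)) = 0"
        using step[of "?n - Suc j"] Suc unfolding s[symmetric] by (simp add: br_zero_right)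
      then show ?thesis by (rule zero) simp
    next
      case False
      then show ?thesis using Suc by simp
    qed
  qed
  have Ql: "Q l = 0" if "l \<le> ?n" for l using Q0[of "?n - l"] that by simp
  have "\<forall>c\<in>C. a (c, l) = 0" if "l \<le> ?n" for l
    using that
  proof (induction l rule: less_induct)
    case (less l)
    have "Q l = (\<Sum>c\<in>C. \<Sum>k\<le>?n. a (c, k) *s (if k \<le> l then ?X (l - k) c else 0))"
      unfolding Q_def by (simp add: sum.cartesian_product case_prod_beta)
    also have "\<dots> = (\<Sum>c\<in>C. \<Sum>k\<le>?n. if k = l then a (c, l) *s c else 0)"
    proof (intro sum.cong refl)
      fix c k assume "c \<in> C" "k \<in> {..?n}"
      then show "a (c, k) *s (if k \<le> l then ?X (l - k) c else 0) = (if k = l then a (c, l) *s c else 0)"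
        using less.IH[of k] by (cases k l rule: linorder_cases) auto
    qed
    also have "\<dots> = (\<Sum>c\<in>C. a (c, l) *s c)" using less.prems by simp
    finally have z: "(\<Sum>c\<in>C. a (c, l) *s c) = 0" using Ql[OF less.prems] by simp
    show ?case
      by (rule independent_explicit[THEN iffD1, OF C(2), THEN conjunct2, THEN HOL.spec, THEN mp, OF z])
  qed
  then show False using a(1) by auto
qed

section \<open>The rank as the least dimension of a centralizer\<close>

lemma cartan_nondegenerate:
  assumes L: "subalgebra L" and nd: "nondegenerate L" and H: "cartan_subalgebra L H"
  shows "\<exists>h\<in>H. fitting L h = H" "nondegenerate H" "\<And>x y. x \<in> H \<Longrightarrow> y \<in> H \<Longrightarrow> br x y = 0"
proof -
  have H': "subalgebra H" "nilpotent H" "H \<subseteq> L" using H by (simp_all add: cartan_subalgebra_def)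
  show ex: "\<exists>h\<in>H. fitting L h = H" by (rule cartan_subalgebra_regular[OF L H])
  then obtain h where h: "h \<in> H" "fitting L h = H" by blast
  show ndH: "nondegenerate H" using nondegenerate_fitting[OF L nd] h H'(3) by blast
  show "br x y = 0" if "x \<in> H" "y \<in> H" for x y
    by (rule nilpotent_nondegenerate_abelian[OF H'(1,2) ndH that])
qed

lemma centralizer_subset_fitting: "{v \<in> L. br x v = 0} \<subseteq> fitting L x"
  using eigenvector_gen_eig[of "br x" _ 0] by (auto simp: fitting_def)

text \<open>Both \<open>h\<close> and an element with Fitting component the chosen Cartan subalgebra have centralizers of
  least dimension.\<close>

lemma rank_eq_abelian_fitting:
  assumes L: "subalgebra L" and nd: "nondegenerate L" and h: "h \<in> L"
    and ab: "\<And>c c'. c \<in> fitting L h \<Longrightarrow> c' \<in> fitting L h \<Longrightarrow> br c c' = 0"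
  shows "rank L = dim (fitting L h)"
proof -
  obtain H where H: "cartan_subalgebra L H" "rank L = dim H" using rank_cartan[OF L] by blast
  obtain g where g: "g \<in> H" "fitting L g = H" using cartan_nondegenerate(1)[OF L nd H(1)] by blast
  have gL: "g \<in> L" using g(1) H(1) by (auto simp: cartan_subalgebra_def)
  have ab': "br c c' = 0" if "c \<in> fitting L g" "c' \<in> fitting L g" for c c'
    using cartan_nondegenerate(3)[OF L nd H(1)] that unfolding g(2) .
  have "dim (fitting L h) \<le> dim (fitting L g)"
    using abelian_fitting_minimal[OF L h gL ab] dim_subset[OF centralizer_subset_fitting] by (rule order_trans)
  moreover have "dim (fitting L g) \<le> dim (fitting L h)"
    using abelian_fitting_minimal[OF L gL h ab'] dim_subset[OF centralizer_subset_fitting] by (rule order_trans)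
  ultimately show ?thesis using H(2) g(2) by simp
qed

lemma rank_le_dim_centralizer:
  assumes L: "subalgebra L" and nd: "nondegenerate L" and x: "x \<in> L"
  shows "rank L \<le> dim {v \<in> L. br x v = 0}"
proof -
  obtain H where H: "cartan_subalgebra L H" "rank L = dim H" using rank_cartan[OF L] by blast
  obtain g where g: "g \<in> H" "fitting L g = H" using cartan_nondegenerate(1)[OF L nd H(1)] by blast
  have gL: "g \<in> L" using g(1) H(1) by (auto simp: cartan_subalgebra_def)
  have ab: "br c c' = 0" if "c \<in> fitting L g" "c' \<in> fitting L g" for c c'
    using cartan_nondegenerate(3)[OF L nd H(1)] that unfolding g(2) .
  show ?thesis using abelian_fitting_minimal[OF L gL x ab] H(2) g(2) by simp
qed

lemma subalgebra_UNIV: "subalgebra UNIV"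
  by (simp add: subalgebra_def)

lemma nondegenerate_UNIV: "semisimple \<Longrightarrow> nondegenerate UNIV"
  unfolding nondegenerate_def using killing_nondegenerate by blast

lemma center_trivial: "semisimple \<Longrightarrow> (\<And>y. br x y = 0) \<Longrightarrow> x = 0"
  by (rule killing_nondegenerate) (simp_all add: killing_def trace_zero)

definition derived :: "nat \<Rightarrow> 'g set \<Rightarrow> 'g set" where
  "derived n D = ((\<lambda>D. commutator D D) ^^ n) D"

lemma derived_0: "derived 0 D = D"
  and derived_Suc: "derived (Suc n) D = commutator (derived n D) (derived n D)"
  and derived_add: "derived (j + k) D = derived j (derived k D)"
  by (simp_all add: derived_def funpow_add)

lemma derived_subset: "subalgebra D \<Longrightarrow> derived n D \<subseteq> D"
  and subalgebra_derived: "subalgebra D \<Longrightarrow> subalgebra (derived n D)"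
proof -
  assume D: "subalgebra D"
  have "derived n D \<subseteq> D \<and> subalgebra (derived n D)"
  proof (induction n)
    case 0
    then show ?case using D by (simp add: derived_0)
  next
    case (Suc n)
    let ?E = "derived n D"
    have E: "subalgebra ?E" using Suc by simp
    have sub: "commutator ?E ?E \<subseteq> ?E"
      by (rule commutator_subset[OF subspace_of_subalgebra[OF E] subalgebra_br[OF E]])
    have "br x y \<in> commutator ?E ?E" if "x \<in> commutator ?E ?E" "y \<in> commutator ?E ?E" for x y
      by (rule commutator_in) (use that sub in blast)+
    then have "subalgebra (commutator ?E ?E)"
      unfolding subalgebra_def using subspace_commutator by blast
    then show ?case using sub Suc unfolding derived_Suc by blast
  qed
  then show "derived n D \<subseteq> D" "subalgebra (derived n D)" by simp_all
qed

end

section \<open>The grading defined by an automorphism of finite order\<close>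

context lie_algebra_automorphism
begin

lemma lin_theta: "lin \<theta>"
  by (rule theta.linear_axioms)

lemma lin_proj: "lin (proj j)"
  by (rule linear_proj)

lemma theta_br: "\<theta> (br x y) = br (\<theta> x) (\<theta> y)"
  using aut by (simp add: automorphism_def)

abbreviation gr :: "nat \<Rightarrow> 'g set" where
  "gr \<equiv> grade \<theta> \<zeta>"

lemma gr_0: "x \<in> gr 0 \<longleftrightarrow> \<theta> x = x"
  by (simp add: grade_def)

lemma subspace_gr: "subspace (gr j)"
  by (rule subspaceI)
    (auto simp: grade_def lin_zero[OF lin_theta] lin_add[OF lin_theta] lin_scale[OF lin_theta]
      scale_right_distrib mult.commute)

lemma subalgebra_gr_0: "subalgebra (gr 0)"
  unfolding subalgebra_def using subspace_gr[of 0] by (simp add: gr_0 theta_br)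

lemma zeta_power_mod: "\<zeta> ^ (i mod m) = \<zeta> ^ i"
proof -
  have "\<zeta> ^ i = \<zeta> ^ (i mod m + m * (i div m))" by simp
  then show ?thesis by (simp only: power_add power_mult root_pow power_one mult_1_right)
qed

lemma gr_mod: "gr (i mod m) = gr i"
  by (simp add: grade_def zeta_power_mod)

lemma zeta_power_eq_1: "\<zeta> ^ i = 1 \<Longrightarrow> i mod m = 0"
  using root zeta_power_mod[of i] m_pos unfolding primitive_root_of_unity_def
  by (metis gr0I mod_less_divisor)

lemma proj_gr: "u \<in> gr i \<Longrightarrow> j < m \<Longrightarrow> proj j u = (if i mod m = j then u else 0)"
  using proj_grade[of u "i mod m" j] m_pos by (simp add: gr_mod)

lemma br_proj_in_gr: "br (proj i x) (proj j y) \<in> gr (i + j)"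
  by (intro br_grade proj_in_grade)

lemma proj_br_proj:
  "k < m \<Longrightarrow> proj k (br (proj i x) (proj j y)) = (if (i + j) mod m = k then br (proj i x) (proj j y) else 0)"
  by (rule proj_gr[OF br_proj_in_gr])

text \<open>The operator \<open>ad (\<theta> x)\<close> is the conjugate of \<open>ad x\<close> by \<open>\<theta>\<close>.\<close>

lemma killing_theta: "killing (\<theta> x) (\<theta> y) = killing x y"
proof -
  let ?h = "\<theta> ^^ (m - 1)"
  have pw: "\<theta> ^^ m = id" using ord by (simp add: has_order_def)
  have "m = Suc (m - 1)" using m_pos by simp
  then have 1: "\<theta> (?h z) = z" for z using pw by (metis funpow.simps(2) id_apply o_apply)
  have 2: "?h (\<theta> z) = z" for z
    using pw \<open>m = Suc (m - 1)\<close> by (metis funpow_Suc_right id_apply o_apply)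
  have "br (\<theta> x) (br (\<theta> y) z) = \<theta> (br x (br y (?h z)))" for z
    by (simp only: theta_br 1)
  then have "killing (\<theta> x) (\<theta> y) = trace (\<lambda>z. \<theta> (br x (br y (?h z))))" by (simp only: killing_def)
  also have "\<dots> = killing x y"
    unfolding killing_def
    by (rule trace_conj[OF lin_compose[OF lin_br lin_br] lin_theta lin_funpow[OF lin_theta] 2])
  finally show ?thesis .
qed

lemma killing_gr:
  assumes "x \<in> gr i" "y \<in> gr j" "(i + j) mod m \<noteq> 0" shows "killing x y = 0"
proof -
  have "killing x y = killing (\<zeta> ^ i *s x) (\<zeta> ^ j *s y)"
    using killing_theta[of x y] assms(1,2) by (simp only: grade_def mem_Collect_eq)
  then have "killing x y = \<zeta> ^ j * (\<zeta> ^ i * killing x y)" by (simp only: killing_scale_left killing_scale_right)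
  then have "\<zeta> ^ (j + i) * killing x y = 1 * killing x y" by (simp only: power_add mult.assoc mult_1_left)
  then have "killing x y = 0 \<or> \<zeta> ^ (j + i) = 1" by (simp only: mult_cancel_right)
  then show ?thesis using zeta_power_eq_1[of "j + i"] assms(3) by (auto simp: add.commute)
qed

lemma killing_proj_expand: "killing x y = (\<Sum>j<m. killing x (proj j y))"
  unfolding killing_sum_right[symmetric] sum_proj ..

lemma nondegenerate_gr_0: assumes ss: semisimple shows "nondegenerate (gr 0)"
  unfolding nondegenerate_def
proof (intro ballI impI)
  fix x assume x: "x \<in> gr 0" "\<forall>y\<in>gr 0. killing x y = 0"
  show "x = 0"
  proof (rule killing_nondegenerate[OF ss])
    fix y
    have "killing x (proj j y) = 0" if "j < m" for j
    proof (cases "j = 0")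
      case True
      then show ?thesis using x(2) proj_in_grade by blast
    next
      case False
      then show ?thesis using killing_gr[OF x(1) proj_in_grade[of j]] that by simp
    qed
    then show "killing x y = 0" unfolding killing_proj_expand[of x y] by (intro sum.neutral) simp
  qed
qed

definition graded :: "'g set \<Rightarrow> bool" where
  "graded D \<longleftrightarrow> subspace D \<and> (\<forall>x\<in>D. \<theta> x \<in> D)"

lemma graded_proj: assumes D: "graded D" and x: "x \<in> D" shows "proj j x \<in> D"
proof -
  have sD: "subspace D" and tD: "\<And>x. x \<in> D \<Longrightarrow> \<theta> x \<in> D" using D by (simp_all add: graded_def)
  have "(\<theta> ^^ k) x \<in> D" for k by (induction k) (simp_all add: x tD)
  then show ?thesis unfolding proj_def by (intro subspace_scale[OF sD] subspace_sum[OF sD])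
qed

lemma graded_commutator:
  assumes A: "graded A" and B: "graded B" shows "graded (commutator A B)"
proof -
  let ?C = "{x. \<theta> x \<in> commutator A B}"
  have "subspace ?C"
    using self.linear_subspace_vimage[OF lin_theta subspace_commutator[of A B]] by (simp add: vimage_def)
  then have "commutator A B \<subseteq> ?C"
  proof (rule commutator_subset)
    fix x y assume "x \<in> A" "y \<in> B"
    then have "\<theta> x \<in> A" "\<theta> y \<in> B" using A B by (simp_all add: graded_def)
    then show "br x y \<in> ?C" by (simp add: theta_br commutator_in)
  qed
  then show ?thesis unfolding graded_def using subspace_commutator by blast
qed

lemma graded_derived: "graded D \<Longrightarrow> graded (derived n D)"
  by (induction n) (simp_all add: derived_0 derived_Suc graded_commutator)

section \<open>Kreknin's theorem\<close>

text \<open>The component of degree \<open>k + 1\<close> of \<open>[D\<^sub>j, D]\<close> with \<open>j > k\<close> is \<open>[D\<^sub>j, D\<^sub>i]\<close> with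
  \<open>i + j\<close> congruent to \<open>k + 1\<close>.  It vanishes for \<open>j = k + 1\<close>, as then \<open>i = 0\<close>; otherwise the sum
  of the degrees exceeds \<open>m\<close>, which forces \<open>i > k + 1\<close>.  So if a derived term is generated in degrees
  above \<open>k\<close>, its commutator has its component of degree \<open>k + 1\<close> generated in degrees above \<open>k + 1\<close>,
  and as many derivations again remove that component from the generators.\<close>

lemma kreknin:
  assumes "k < m" "subalgebra D" "graded D" "\<And>x. x \<in> D \<Longrightarrow> proj 0 x = 0"
    and "subalgebra A" "\<And>j x. k < j \<Longrightarrow> j < m \<Longrightarrow> x \<in> D \<Longrightarrow> proj j x \<in> A"
  shows "derived (2 ^ k - 1) D \<subseteq> A"
  using assms
proof (induction k arbitrary: D A)
  case 0
  have "x \<in> A" if x: "x \<in> D" for x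
  proof -
    have "proj j x \<in> A" if "j < m" for j
    proof (cases "j = 0")
      case True
      then show ?thesis using "0.prems"(4)[OF x] subspace_0[OF subspace_of_subalgebra[OF "0.prems"(5)]] by simp
    next
      case False
      then show ?thesis using "0.prems"(6)[OF _ that x] by simp
    qed
    then have "(\<Sum>j<m. proj j x) \<in> A"
      by (intro subspace_sum[OF subspace_of_subalgebra[OF "0.prems"(5)]]) simp
    then show ?thesis by (simp only: sum_proj)
  qed
  then show ?case by (auto simp: derived_0)
next
  case (Suc k)
  note km = Suc.prems(1) and D = Suc.prems(2) and gD = Suc.prems(3) and D0 = Suc.prems(4)
    and A = Suc.prems(5) and DA = Suc.prems(6)
  note sD = subspace_of_subalgebra[OF D]
  note sA = subspace_of_subalgebra[OF A]
  let ?M = "derived (2 ^ k - 1) D"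
  let ?N = "commutator ?M ?M"
  let ?G = "{br (proj j x) y | j x y. k < j \<and> j < m \<and> x \<in> D \<and> y \<in> D}"
  let ?F = "span ?G"
  \<comment> \<open>a subalgebra containing all components of degree above \<open>k\<close>, hence the derived term \<open>M\<close>\<close>
  let ?A = "{a \<in> D. \<forall>d\<in>D. br a d \<in> ?F}"
  have "subalgebra ?A"
    unfolding subalgebra_def
  proof (intro conjI ballI)
    show "subspace ?A"
    proof (rule subspaceI)
      show "0 \<in> ?A" using subspace_0[OF sD] by (simp add: br_zero_left span_zero)
      show "a + b \<in> ?A" if "a \<in> ?A" "b \<in> ?A" for a b
        using that subspace_add[OF sD] by (simp add: br_add_left span_add)
      show "c *s a \<in> ?A" if "a \<in> ?A" for c a
        using that subspace_scale[OF sD] by (simp add: br_scale_left span_scale)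
    qed
    fix a b assume a: "a \<in> ?A" and b: "b \<in> ?A"
    have "br (br a b) d \<in> ?F" if d: "d \<in> D" for d
    proof -
      have "br (br a b) d = br a (br b d) - br b (br a d)" using br_br[of a b d] by simp
      moreover have "br b d \<in> D" "br a d \<in> D" using a b d subalgebra_br[OF D] by blast+
      ultimately show ?thesis using a b by (simp add: span_diff)
    qed
    then show "br a b \<in> ?A" using a b subalgebra_br[OF D] by blast
  qed
  moreover have "proj j x \<in> ?A" if "k < j" "j < m" "x \<in> D" for j x
    using graded_proj[OF gD that(3)] span_base[of _ ?G] that by blast
  ultimately have MA: "?M \<subseteq> ?A" using km D gD D0 by (intro Suc.IH) auto
  have MD: "?M \<subseteq> D" by (rule derived_subset[OF D])
  have NF: "?N \<subseteq> ?F" by (rule commutator_subset[OF subspace_span]) (use MA MD in blast)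
  have N_derived: "?N = derived (Suc (2 ^ k - 1)) D" by (simp only: derived_Suc)
  have N: "subalgebra ?N" "graded ?N" "?N \<subseteq> D"
    unfolding N_derived using subalgebra_derived[OF D] graded_derived[OF gD] derived_subset[OF D] by blast+
  have "?G \<subseteq> {f. proj (Suc k) f \<in> A}"
  proof
    fix f assume "f \<in> ?G"
    then obtain j x y where f: "f = br (proj j x) y" and j: "k < j" "j < m" and x: "x \<in> D" and y: "y \<in> D"
      by blast
    have "proj (Suc k) (br (proj j x) (proj i y)) \<in> A" if i: "i < m" for i
    proof (cases "(j + i) mod m = Suc k \<and> i \<noteq> 0")
      case True
      have "j + i \<ge> m"
      proof (rule ccontr)
        assume "\<not> j + i \<ge> m"
        then have "j + i = Suc k" using True by simp
        then show False using j True by simp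
      qed
      then have ji: "j + i = m + Suc k" using True i j by (simp add: mod_if split: if_splits)
      have "Suc k < j" "Suc k < i" using ji i j by linarith+
      then have "br (proj j x) (proj i y) \<in> A" using DA x y i j by (intro subalgebra_br[OF A])
      then show ?thesis using True km by (simp add: proj_br_proj)
    next
      case False
      have "proj 0 y = 0" by (rule D0[OF y])
      then have "proj (Suc k) (br (proj j x) (proj i y)) = 0"
        using False km lin_zero[OF lin_proj] by (cases "i = 0") (simp_all add: proj_br_proj br_zero_right)
      then show ?thesis using subspace_0[OF sA] by simp
    qed
    then have "(\<Sum>i<m. proj (Suc k) (br (proj j x) (proj i y))) \<in> A"
      by (intro subspace_sum[OF sA]) simp
    then have "proj (Suc k) (br (proj j x) (\<Sum>i<m. proj i y)) \<in> A"
      by (simp only: br_sum_right lin_sum[OF lin_proj])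
    then show "f \<in> {f. proj (Suc k) f \<in> A}" by (simp only: sum_proj f mem_Collect_eq)
  qed
  moreover have "subspace {f. proj (Suc k) f \<in> A}"
    using self.linear_subspace_vimage[OF lin_proj sA] by (simp add: vimage_def)
  ultimately have FA: "?F \<subseteq> {f. proj (Suc k) f \<in> A}" by (rule span_minimal)
  have "derived (2 ^ k - 1) ?N \<subseteq> A"
  proof (rule Suc.IH[OF _ N(1,2) _ A])
    show "k < m" using km by simp
    show "proj 0 x = 0" if "x \<in> ?N" for x using D0 N(3) that by blast
    show "proj j x \<in> A" if "k < j" "j < m" "x \<in> ?N" for j x
    proof (cases "j = Suc k")
      case True
      then show ?thesis using NF FA that(3) by blast
    next
      case False
      then show ?thesis using DA[of j x] that N(3) by auto
    qed
  qed
  moreover have "(2::nat) ^ Suc k - 1 = (2 ^ k - 1) + Suc (2 ^ k - 1)"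
  proof -
    have "(2::nat) ^ k \<ge> 1" by simp
    then show ?thesis by simp
  qed
  ultimately show ?case unfolding N_derived by (simp only: derived_add)
qed

text \<open>A homogeneous element of degree \<open>i\<close> is orthogonal to all degrees but \<open>- i\<close>, and commutes with
  degree \<open>- i\<close> because \<open>D\<close> has no component of degree \<open>0\<close>.  A nilpotent element is orthogonal to all
  elements commuting with it.\<close>

lemma adnil_homogeneous_zero:
  assumes D: "subalgebra D" and gD: "graded D" and D0: "\<And>x. x \<in> D \<Longrightarrow> proj 0 x = 0"
    and nd: "nondegenerate D" and a: "a \<in> D" and nil: "\<And>j. j < m \<Longrightarrow> adnil (proj j a)"
  shows "a = 0"
proof -
  have "proj i a = 0" if i: "i < m" for i
  proof -
    let ?a = "proj i a"
    have aD: "?a \<in> D" by (rule graded_proj[OF gD a])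
    have "killing ?a y = 0" if y: "y \<in> D" for y
    proof -
      have "killing ?a (proj j y) = 0" if j: "j < m" for j
      proof (cases "(i + j) mod m = 0")
        case True
        have "br ?a (proj j y) \<in> D" by (rule subalgebra_br[OF D aD graded_proj[OF gD y]])
        then have "proj 0 (br ?a (proj j y)) = 0" by (rule D0)
        then have "br ?a (proj j y) = 0" using True m_pos by (simp add: proj_br_proj)
        then show ?thesis by (rule killing_commuting_nilpotent[OF nil[OF i]])
      next
        case False
        then show ?thesis using killing_gr[OF proj_in_grade proj_in_grade] by blast
      qed
      then show ?thesis unfolding killing_proj_expand[of ?a y] by (intro sum.neutral) simp
    qed
    then show ?thesis using nd aD unfolding nondegenerate_def by blast
  qed
  then show ?thesis using sum_proj[of a] by simp
qed

text \<open>Let \<open>E\<close> be the last nonzero derived term and suppose that it is the commutator of a term \<open>F\<close>.  The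
  homogeneous elements of \<open>[F, E]\<close> are nilpotent since \<open>E\<close> is abelian; so \<open>[F, E] = 0\<close>.  Then those
  of \<open>E = [F, F]\<close> are nilpotent since they commute with \<open>F\<close>; so \<open>E = 0\<close>.\<close>

lemma fixed_point_free_abelian:
  assumes D: "subalgebra D" and gD: "graded D" and D0: "\<And>x. x \<in> D \<Longrightarrow> proj 0 x = 0"
    and nd: "nondegenerate D" and "x \<in> D" "y \<in> D"
  shows "br x y = 0"
proof -
  have s0: "subalgebra {0}" by (simp add: subalgebra_def subspace_single_0 br_zero_left)
  have zero_derived: "0 \<in> derived n D" for n
    by (rule subspace_0[OF subspace_of_subalgebra[OF subalgebra_derived[OF D]]])
  have "derived (2 ^ (m - 1) - 1) D \<subseteq> {0}"
    by (rule kreknin[OF _ D gD D0 s0]) (use m_pos in auto)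
  then have ex: "\<exists>n. derived n D = {0}" using zero_derived by blast
  define n where "n = (LEAST n. derived n D = {0})"
  have n: "derived n D = {0}" unfolding n_def using ex by (rule LeastI_ex)
  have n': "derived k D \<noteq> {0}" if "k < n" for k using that not_less_Least unfolding n_def by blast
  have "n \<le> 1"
  proof (rule ccontr)
    assume "\<not> n \<le> 1"
    then obtain j where j: "n = Suc (Suc j)" using less_imp_Suc_add[of 1 n] by auto
    let ?F = "derived j D" and ?E = "derived (Suc j) D"
    have F: "subalgebra ?F" "graded ?F" "?F \<subseteq> D"
      using subalgebra_derived[OF D] graded_derived[OF gD] derived_subset[OF D] by blast+
    have E: "subalgebra ?E" "graded ?E" "?E \<subseteq> D"
      using subalgebra_derived[OF D] graded_derived[OF gD] derived_subset[OF D] by blast+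
    have E_def: "?E = commutator ?F ?F" by (rule derived_Suc)
    have EF: "?E \<subseteq> ?F"
      unfolding E_def by (rule commutator_subset[OF subspace_of_subalgebra[OF F(1)] subalgebra_br[OF F(1)]])
    have EE: "br a b = 0" if "a \<in> ?E" "b \<in> ?E" for a b
      using commutator_in[OF that] n unfolding j derived_Suc[of "Suc j"] by blast
    have FE: "commutator ?F ?E \<subseteq> ?E" unfolding E_def by (rule commutator_mono[OF subset_refl EF[unfolded E_def]])
    have gFE: "graded (commutator ?F ?E)" by (rule graded_commutator[OF F(2) E(2)])
    have FE0: "a = 0" if a: "a \<in> commutator ?F ?E" for a
    proof (rule adnil_homogeneous_zero[OF D gD D0 nd])
      show "a \<in> D" using a FE E(3) by blast
      fix i assume "i < m"
      have p: "proj i a \<in> commutator ?F ?E" by (rule graded_proj[OF gFE a])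
      have "{br x b | x b. x \<in> ?F \<and> b \<in> ?E} \<subseteq> {br x b | x b. b \<in> ?E}" by blast
      then have "proj i a \<in> span {br x b | x b. b \<in> ?E}" using p unfolding commutator_def by (meson span_mono subsetD)
      moreover have "br (proj i a) b = 0" if "b \<in> ?E" for b using EE p FE that by blast
      ultimately show "adnil (proj i a)" by (intro adnil_if_sum_of_brackets_with_centralizer[of ?E])
    qed
    have E0: "a = 0" if a: "a \<in> ?E" for a
    proof (rule adnil_homogeneous_zero[OF D gD D0 nd])
      show "a \<in> D" using a E(3) by blast
      fix i assume "i < m"
      have p: "proj i a \<in> ?E" by (rule graded_proj[OF E(2) a])
      have "{br x b | x b. x \<in> ?F \<and> b \<in> ?F} \<subseteq> {br x b | x b. b \<in> ?F}" by blast
      then have "proj i a \<in> span {br x b | x b. b \<in> ?F}"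
        using p unfolding E_def commutator_def by (meson span_mono subsetD)
      moreover have "br (proj i a) b = 0" if "b \<in> ?F" for b
        using FE0[OF commutator_in[OF that p]] by (rule br_zero_sym)
      ultimately show "adnil (proj i a)" by (intro adnil_if_sum_of_brackets_with_centralizer[of ?F])
    qed
    then have "?E = {0}" using zero_derived by blast
    then show False using n'[of "Suc j"] j by simp
  qed
  then have "derived 1 D = {0}"
  proof (cases "n = 0")
    case True
    then have "D = {0}" using n by (simp add: derived_0)
    then have "derived 1 D \<subseteq> {0}" using derived_subset[OF D, of 1] by simp
    then show ?thesis using zero_derived by blast
  next
    case False
    then show ?thesis using n \<open>n \<le> 1\<close> by (simp add: le_Suc_eq)
  qed
  then show ?thesis using commutator_in[OF assms(5,6)] derived_Suc[of 0 D] by (simp add: derived_0)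
qed

section \<open>Regular elements fixed by the automorphism\<close>

text \<open>The semisimple part of \<open>ad h\<close> is a derivation commuting with \<open>\<theta>\<close> and \<open>ad H\<close>, hence
  \<open>ad s\<close> with \<open>s\<close> fixed by \<open>\<theta>\<close> and normalizing \<open>H\<close>.  Then \<open>h - s\<close> is a nilpotent element
  of the abelian algebra \<open>H\<close>, so it is orthogonal to \<open>H\<close> and vanishes.\<close>

lemma cartan_elements_semisimple:
  assumes ss: semisimple and H: "cartan_subalgebra (gr 0) H" and h: "h \<in> H"
  shows "twist (\<lambda>a. a) (br h) v = br h v"
proof -
  let ?S = "twist (\<lambda>a. a) (br h)"
  have norm: "{x \<in> gr 0. \<forall>h\<in>H. br x h \<in> H} = H" and HL: "H \<subseteq> gr 0" and subH: "subalgebra H"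
    using H by (simp_all add: cartan_subalgebra_def)
  note sH = subspace_of_subalgebra[OF subH]
  note nd = nondegenerate_gr_0[OF ss]
  note ndH = cartan_nondegenerate(2)[OF subalgebra_gr_0 nd H]
  note abH = cartan_nondegenerate(3)[OF subalgebra_gr_0 nd H]
  have th: "\<theta> h = h" using h HL gr_0 by blast
  have "derivation ?S" by (rule twist_derivation) simp
  from derivation_inner[OF ss this] obtain s where s: "\<And>x. ?S x = br s x" by blast
  have "\<theta> (br h x) = br h (\<theta> x)" for x by (simp only: theta_br th)
  from twist_commute[OF lin_br lin_theta this, of "\<lambda>a. a"]
  have ts: "br s (\<theta> x) = br (\<theta> s) (\<theta> x)" for x unfolding s theta_br .
  have "\<theta> s - s = 0"
  proof (rule center_trivial[OF ss])
    fix y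
    have "surj \<theta>" using aut by (simp add: automorphism_def bij_def)
    then obtain x where "y = \<theta> x" by (rule surjE)
    then show "br (\<theta> s - s) y = 0" using ts[of x] by (simp add: br_diff_left)
  qed
  then have s0: "s \<in> gr 0" by (simp add: gr_0)
  have sH0: "br s h' = 0" if h': "h' \<in> H" for h'
  proof (rule center_trivial[OF ss])
    fix y
    have "br h' (br h x) = br h (br h' x)" for x
      using br_br[of h' h x] abH[OF h' h] by (simp add: br_zero_left)
    from twist_commute[OF lin_br lin_br this, of "\<lambda>a. a"]
    have "br s (br h' y) = br h' (br s y)" unfolding s .
    then show "br (br s h') y = 0" using br_br[of s h' y] by simp
  qed
  have "s \<in> {x \<in> gr 0. \<forall>h\<in>H. br x h \<in> H}" using s0 sH0 subspace_0[OF sH] by simp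
  then have sH': "s \<in> H" using norm by simp
  let ?d = "h - s"
  have dH: "?d \<in> H" by (rule subspace_diff[OF sH h sH'])
  have "adnil ?d"
    unfolding adnil_def
  proof
    fix v
    have "v \<in> gen_eig (br ?d) 0"
    proof (rule gen_eig_induct[OF lin_br[of h], of "\<lambda>v. v \<in> gen_eig (br ?d) 0"])
      fix l v assume v: "v \<in> gen_eig (br h) l"
      have st: "br ?d u = shift (br h) l u" if "u \<in> gen_eig (br h) l" for u
        using twist_gen_eig[OF lin_br that, of "\<lambda>a. a"] unfolding s by (simp add: br_diff_left shift_def)
      have "(br ?d ^^ k) v = (shift (br h) l ^^ k) v \<and> (shift (br h) l ^^ k) v \<in> gen_eig (br h) l" for k
      proof (induction k)
        case (Suc k)
        then have "(br ?d ^^ Suc k) v = (shift (br h) l ^^ Suc k) v" using st by simp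
        moreover have "(shift (br h) l ^^ Suc k) v \<in> gen_eig (br h) l"
          using gen_eig_shift_stable[OF lin_br] Suc by simp
        ultimately show ?case by blast
      qed (use v in simp)
      moreover obtain k where "(shift (br h) l ^^ k) v = 0" using v unfolding gen_eig_def by blast
      ultimately have "(br ?d ^^ k) v = 0" by simp
      then show "v \<in> gen_eig (br ?d) 0" unfolding gen_eig_0 by blast
    qed (rule subspace_add[OF subspace_gen_eig[OF lin_br]] subspace_0[OF subspace_gen_eig[OF lin_br]]; assumption)+
    then show "\<exists>k. (br ?d ^^ k) v = 0" unfolding gen_eig_0 .
  qed
  then have "killing ?d y = 0" if "y \<in> H" for y
    using killing_commuting_nilpotent abH[OF dH that] by blast
  then have "?d = 0" using ndH dH unfolding nondegenerate_def by blast
  then show ?thesis using s by simp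
qed

text \<open>Choose \<open>h \<in> H\<close> with a Fitting component \<open>C\<close> in the whole algebra of least dimension.  Then \<open>H\<close> acts
  on \<open>C\<close> by operators that are both nilpotent and semisimple, so it centralizes \<open>C\<close>, and \<open>H\<close> is the
  component of \<open>C\<close> of degree \<open>0\<close>.  For opposite degrees \<open>i\<close> and \<open>j\<close>, the bracket of \<open>C\<^sub>i\<close> and
  \<open>C\<^sub>j\<close> lies in \<open>H\<close> and is orthogonal to \<open>H\<close>.  So the other components of \<open>C\<close> span a subalgebra
  \<open>D\<close> without fixed points.\<close>

lemma regular_element_fixed:
  assumes ss: semisimple and H: "cartan_subalgebra (gr 0) H"
  shows "\<exists>h\<in>H. fitting UNIV h = {v. br h v = 0} \<and> fitting UNIV h \<inter> gr 0 = H \<and>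
    (\<forall>c\<in>fitting UNIV h. \<forall>c'\<in>fitting UNIV h. br c c' = 0)"
proof -
  have norm: "{x \<in> gr 0. \<forall>h\<in>H. br x h \<in> H} = H" and HL: "H \<subseteq> gr 0" and subH: "subalgebra H"
    using H by (simp_all add: cartan_subalgebra_def)
  note sH = subspace_of_subalgebra[OF subH]
  note nd = nondegenerate_gr_0[OF ss]
  note ndH = cartan_nondegenerate(2)[OF subalgebra_gr_0 nd H]
  note abH = cartan_nondegenerate(3)[OF subalgebra_gr_0 nd H]
  have "H \<noteq> {}" using subspace_0[OF sH] by blast
  from minimal_fitting_exists[OF this, of UNIV]
  obtain h where h: "h \<in> H" "\<And>z. z \<in> H \<Longrightarrow> dim (fitting UNIV h) \<le> dim (fitting UNIV z)" by blast
  let ?C = "fitting UNIV h"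
  have subC: "subalgebra ?C" by (rule subalgebra_fitting[OF subalgebra_UNIV])
  note sC = subspace_of_subalgebra[OF subC]
  have ndC: "nondegenerate ?C" by (rule nondegenerate_fitting[OF subalgebra_UNIV nondegenerate_UNIV[OF ss]]) simp
  have HC: "H \<subseteq> ?C" using centralizer_subset_fitting[of UNIV h] abH[OF h(1)] by blast
  have HC0: "br y c = 0" if y: "y \<in> H" and c: "c \<in> ?C" for y c
  proof -
    have "y \<in> gen_eig (br h) 0" using HC y by (auto simp: fitting_def)
    then have "(br y ^^ card Basis) c = 0"
      using minimal_fitting_nilpotent[OF subalgebra_UNIV sH subset_UNIV h(1) y _ h(2) c] by blast
    then have "c \<in> gen_eig (br y) 0" unfolding gen_eig_0 by blast
    from twist_gen_eig[OF lin_br this, of "\<lambda>a. a"] show ?thesis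
      unfolding cartan_elements_semisimple[OF ss H y] by simp
  qed
  have CH: "?C \<inter> gr 0 = H"
  proof
    show "H \<subseteq> ?C \<inter> gr 0" using HC HL by blast
    have "br c y = 0" if "c \<in> ?C" "y \<in> H" for c y using HC0[OF that(2,1)] by (rule br_zero_sym)
    then have "?C \<inter> gr 0 \<subseteq> {x \<in> gr 0. \<forall>h\<in>H. br x h \<in> H}" using subspace_0[OF sH] by auto
    then show "?C \<inter> gr 0 \<subseteq> H" using norm by simp
  qed
  have th: "\<theta> h = h" using h(1) HL gr_0 by blast
  have "\<theta> (br h x) = br h (\<theta> x)" for x by (simp only: theta_br th)
  from gen_eig_commute[OF lin_br lin_theta this] have gC: "graded ?C"
    unfolding graded_def using sC by (auto simp: fitting_def)
  have C0: "proj 0 c \<in> H" if "c \<in> ?C" for c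
    using graded_proj[OF gC that] proj_in_grade CH by blast
  let ?D = "{x \<in> ?C. proj 0 x = 0}"
  have sD: "subspace ?D" by (rule subspace_kernel_on[OF lin_proj sC])
  have rev_degree: "br (proj i x) (proj j y) = 0" if x: "x \<in> ?C" and y: "y \<in> ?C" and ij: "(i + j) mod m = 0" for x y i j
  proof -
    let ?u = "br (proj i x) (proj j y)"
    have "?u \<in> gr 0" using br_proj_in_gr[of i x j y] gr_mod[of "i + j"] ij by simp
    moreover have "?u \<in> ?C" by (rule subalgebra_br[OF subC graded_proj[OF gC x] graded_proj[OF gC y]])
    ultimately have uH: "?u \<in> H" using CH by blast
    have "killing ?u y' = 0" if "y' \<in> H" for y'
      unfolding killing_invariant
      using br_zero_sym[OF HC0[OF that graded_proj[OF gC y, of j]]] by (simp add: killing_zero_right)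
    then show ?thesis using ndH uH unfolding nondegenerate_def by blast
  qed
  have subD: "subalgebra ?D"
    unfolding subalgebra_def
  proof (intro conjI ballI)
    show "subspace ?D" by (rule sD)
    fix x y assume x: "x \<in> ?D" and y: "y \<in> ?D"
    have "proj 0 (br (proj i x) (proj j y)) = 0" for i j
      using rev_degree[of x y i j] x y m_pos lin_zero[OF lin_proj] by (simp add: proj_br_proj)
    then have "proj 0 (br (\<Sum>i<m. proj i x) (\<Sum>j<m. proj j y)) = 0"
      by (simp only: br_sum_left br_sum_right lin_sum[OF lin_proj] sum.neutral_const)
    then have "proj 0 (br x y) = 0" by (simp only: sum_proj)
    then show "br x y \<in> ?D" using x y subalgebra_br[OF subC] by blast
  qed
  have gD: "graded ?D"
    unfolding graded_def
  proof (intro conjI ballI)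
    fix x assume x: "x \<in> ?D"
    have "proj 0 (\<theta> x) = proj 0 (\<Sum>j<m. \<theta> (proj j x))"
      by (simp only: lin_sum[OF lin_theta, symmetric] sum_proj)
    also have "\<dots> = (\<Sum>j<m. \<zeta> ^ j *s proj 0 (proj j x))"
      using proj_in_grade by (simp add: lin_sum[OF lin_proj] grade_def lin_scale[OF lin_proj])
    also have "\<dots> = (\<Sum>j<m. 0)"
    proof (rule sum.cong)
      fix j assume "j \<in> {..<m}"
      then show "\<zeta> ^ j *s proj 0 (proj j x) = 0"
        using x proj_gr[OF proj_in_grade, of 0 j x] m_pos by (cases "j = 0") auto
    qed simp
    finally have "proj 0 (\<theta> x) = 0" by simp
    then show "\<theta> x \<in> ?D" using x gC by (simp add: graded_def)
  qed (rule sD)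
  have split: "c - proj 0 c \<in> ?D" if "c \<in> ?C" for c
  proof -
    have "proj 0 (proj 0 c) = proj 0 c" using proj_gr[OF proj_in_grade, of 0 0 c] m_pos by simp
    moreover have "c - proj 0 c \<in> ?C" by (rule subspace_diff[OF sC that graded_proj[OF gC that]])
    ultimately show ?thesis by (simp add: lin_diff[OF lin_proj])
  qed
  have kapHD: "killing x y = 0" if x: "x \<in> ?D" and y: "y \<in> H" for x y
  proof -
    have "killing y (proj j x) = 0" if "j < m" for j
    proof (cases "j = 0")
      case True
      then show ?thesis using x by (simp add: killing_zero_right)
    next
      case False
      then show ?thesis using killing_gr[of y 0 "proj j x" j] proj_in_grade y HL that by auto
    qed
    then have "killing y x = 0" unfolding killing_proj_expand[of y x] by (intro sum.neutral) simp
    then show ?thesis using killing_sym by simp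
  qed
  have ndD: "nondegenerate ?D"
    unfolding nondegenerate_def
  proof (intro ballI impI)
    fix x assume x: "x \<in> ?D" and x0: "\<forall>y\<in>?D. killing x y = 0"
    have "killing x c = 0" if c: "c \<in> ?C" for c
    proof -
      have "killing x (c - proj 0 c) = 0" using x0 split[OF c] by blast
      then show ?thesis using kapHD[OF x C0[OF c]] by (simp add: killing_diff_right)
    qed
    then show "x = 0" using ndC x unfolding nondegenerate_def by blast
  qed
  have abD: "br x y = 0" if "x \<in> ?D" "y \<in> ?D" for x y
    by (rule fixed_point_free_abelian[OF subD gD _ ndD that]) simp
  have abC: "br c c' = 0" if c: "c \<in> ?C" and c': "c' \<in> ?C" for c c'
  proof -
    have "br (c - proj 0 c) (c' - proj 0 c') = 0" using abD split c c' by blast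
    moreover have "br (proj 0 c) c' = 0" by (rule HC0[OF C0[OF c] c'])
    moreover have "br c (proj 0 c') = 0" by (rule br_zero_sym[OF HC0[OF C0[OF c'] c]])
    moreover have "br (proj 0 c) (proj 0 c') = 0" by (rule abH[OF C0[OF c] C0[OF c']])
    ultimately show ?thesis by (simp add: br_diff_left br_diff_right)
  qed
  have "?C = {v. br h v = 0}"
    using centralizer_subset_fitting[of UNIV h] HC0[OF h(1)] by auto
  then show ?thesis using h(1) CH abC by blast
qed

section \<open>The index of the contraction\<close>

text \<open>The degree of the \<open>i\<close>-th component for the inverse automorphism.  With respect to it, \<open>br_rev\<close> is the
  part of the bracket in which degrees add up without wrapping around, and \<open>br_rev_wrap\<close> the rest.\<close>

definition rev_degree :: "nat \<Rightarrow> nat" where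
  "rev_degree i = (if i = 0 then 0 else m - i)"

definition br_rev :: "'g \<Rightarrow> 'g \<Rightarrow> 'g" where
  "br_rev z x = (\<Sum>k<m. \<Sum>i<m. if rev_degree k + rev_degree i < m then br (proj k z) (proj i x) else 0)"

definition br_rev_wrap :: "'g \<Rightarrow> 'g \<Rightarrow> 'g" where
  "br_rev_wrap z x = (\<Sum>k<m. \<Sum>i<m. if rev_degree k + rev_degree i < m then 0 else br (proj k z) (proj i x))"

lemma rev_degree_add:
  assumes "k < m" "i < m"
  shows "rev_degree ((k + i) mod m) = (if rev_degree k + rev_degree i < m then rev_degree k + rev_degree i else rev_degree k + rev_degree i - m)"
proof -
  consider "k = 0" | "i = 0" | "k \<noteq> 0" "i \<noteq> 0" "k + i < m" | "k \<noteq> 0" "i \<noteq> 0" "k + i \<ge> m" by linarith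
  then show ?thesis
  proof cases
    case 4
    then have "(k + i) mod m = k + i - m" using assms by (simp add: mod_if)
    then show ?thesis using 4 assms by (auto simp: rev_degree_def)
  qed (use assms in \<open>auto simp: rev_degree_def\<close>)
qed

lemma lin_br_rev: "lin (br_rev z)" and lin_br_rev_left: "lin (\<lambda>z. br_rev z x)" and lin_br_rev_wrap: "lin (br_rev_wrap z)"
proof -
  have a: "lin (\<lambda>x. if c then br (proj k z) (proj i x) else 0)" for c k i
    using lin_compose[OF lin_br lin_proj] lin_0 by (cases c) simp_all
  have b: "lin (\<lambda>x. if c then 0 else br (proj k z) (proj i x))" for c k i
    using lin_compose[OF lin_br lin_proj] lin_0 by (cases c) simp_all
  have d: "lin (\<lambda>z. if c then br (proj k z) (proj i x) else 0)" for c k i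
    using lin_compose[OF lin_br_left lin_proj] lin_0 by (cases c) simp_all
  show "lin (br_rev z)" unfolding br_rev_def by (rule lin_sums)+ (rule a)
  show "lin (br_rev_wrap z)" unfolding br_rev_wrap_def by (rule lin_sums)+ (rule b)
  show "lin (\<lambda>z. br_rev z x)" unfolding br_rev_def by (rule lin_sums)+ (rule d)
qed

lemma wrap_iff:
  assumes "k < m" "0 < i" "i < m" "j < m" "(k + i + j) mod m = 0"
  shows "rev_degree k + rev_degree i < m \<longleftrightarrow> \<not> i + j < m"
proof -
  obtain q where q: "k + i + j = m * q" using assms(5) by (auto simp: mod_eq_0_iff_dvd)
  have "m * q < m * 3" using assms q[symmetric] by linarith
  then have "q < 3" using mult_less_cancel1 by blast
  moreover have "q \<noteq> 0" using q assms(2) by (metis add_is_0 less_numeral_extra(3) mult_0_right)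
  ultimately consider "q = 1" | "q = 2" by linarith
  then show ?thesis by cases (use assms q in \<open>auto simp: rev_degree_def\<close>)
qed

text \<open>Both sides are sums over triples of degrees with sum divisible by \<open>m\<close>, and for \<open>x\<close> of positive
  degree the two conditions on the degrees agree.\<close>

lemma killing_br_inf:
  assumes x0: "proj 0 x = 0"
  shows "killing z (br_inf \<theta> \<zeta> m x y) = killing (br_rev z x) y"
proof -
  let ?t = "\<lambda>k i j. killing (br (proj k z) (proj i x)) (proj j y)"
  have "killing z (br_inf \<theta> \<zeta> m x y)
      = (\<Sum>i<m. \<Sum>j<m. killing z (if i + j < m then 0 else br (proj i x) (proj j y)))"
    unfolding br_inf_proj killing_sum_right ..
  also have "\<dots> = (\<Sum>i<m. \<Sum>j<m. \<Sum>k<m. if i + j < m then 0 else ?t k i j)"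
  proof (intro sum.cong refl)
    fix i j
    have "killing z w = (\<Sum>k<m. killing (proj k z) w)" for w
      unfolding killing_sum_left[symmetric] sum_proj ..
    then show "killing z (if i + j < m then 0 else br (proj i x) (proj j y))
        = (\<Sum>k<m. if i + j < m then 0 else ?t k i j)"
      by (simp add: killing_zero_right killing_invariant)
  qed
  also have "\<dots> = (\<Sum>i<m. \<Sum>j<m. \<Sum>k<m. if rev_degree k + rev_degree i < m then ?t k i j else 0)"
  proof (intro sum.cong refl)
    fix i j k assume ijk: "i \<in> {..<m}" "j \<in> {..<m}" "k \<in> {..<m}"
    show "(if i + j < m then 0 else ?t k i j) = (if rev_degree k + rev_degree i < m then ?t k i j else 0)"
    proof (cases "i = 0 \<or> (k + i + j) mod m \<noteq> 0")
      case True
      have "?t k i j = 0"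
      proof (cases "i = 0")
        case True
        then show ?thesis by (simp add: x0 br_zero_right killing_zero_left)
      next
        case False
        then show ?thesis using True killing_gr[OF br_proj_in_gr proj_in_grade] by blast
      qed
      then show ?thesis by simp
    next
      case False
      then show ?thesis using wrap_iff[of k i j] ijk by simp
    qed
  qed
  also have "\<dots> = (\<Sum>i<m. \<Sum>k<m. \<Sum>j<m. if rev_degree k + rev_degree i < m then ?t k i j else 0)"
    by (intro sum.cong refl sum.swap)
  also have "\<dots> = (\<Sum>k<m. \<Sum>i<m. \<Sum>j<m. if rev_degree k + rev_degree i < m then ?t k i j else 0)"
    by (rule sum.swap)
  also have "\<dots> = (\<Sum>k<m. \<Sum>i<m. killing (if rev_degree k + rev_degree i < m then br (proj k z) (proj i x) else 0) y)"
  proof (intro sum.cong refl)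
    fix k i
    show "(\<Sum>j<m. if rev_degree k + rev_degree i < m then ?t k i j else 0)
        = killing (if rev_degree k + rev_degree i < m then br (proj k z) (proj i x) else 0) y"
      using killing_proj_expand[of "br (proj k z) (proj i x)" y] by (simp add: killing_zero_left)
  qed
  also have "\<dots> = killing (br_rev z x) y" unfolding br_rev_def killing_sum_left ..
  finally show ?thesis .
qed

definition rescale :: "'k \<Rightarrow> 'g \<Rightarrow> 'g" where
  "rescale s x = (\<Sum>i<m. s ^ rev_degree i *s proj i x)"

lemma lin_rescale: "lin (rescale s)"
  unfolding rescale_def by (intro lin_sums lin_scaled lin_proj)

lemma rescale_gr: assumes "u \<in> gr l" shows "rescale s u = s ^ rev_degree (l mod m) *s u"
proof -
  have "rescale s u = (\<Sum>i<m. if l mod m = i then s ^ rev_degree i *s u else 0)"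
    unfolding rescale_def by (intro sum.cong refl) (simp add: proj_gr[OF assms])
  then show ?thesis using m_pos by simp
qed

lemma rescale_rescale: assumes "s * r = 1" shows "rescale s (rescale r x) = x"
proof -
  have "rescale s (rescale r x) = (\<Sum>i<m. r ^ rev_degree i *s rescale s (proj i x))"
    unfolding rescale_def[of r] lin_sum[OF lin_rescale] lin_scale[OF lin_rescale] ..
  also have "\<dots> = (\<Sum>i<m. proj i x)"
  proof (intro sum.cong refl)
    fix i assume "i \<in> {..<m}"
    then have "rescale s (proj i x) = s ^ rev_degree i *s proj i x"
      using rescale_gr[OF proj_in_grade, of s i x] by simp
    moreover have "r ^ rev_degree i * s ^ rev_degree i = 1"
      using assms by (simp add: power_mult_distrib[symmetric] mult.commute)
    ultimately show "r ^ rev_degree i *s rescale s (proj i x) = proj i x" by simp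
  qed
  finally show ?thesis by (simp only: sum_proj)
qed

text \<open>For \<open>t\<close> of the form \<open>s ^ m\<close> with \<open>s \<noteq> 0\<close>, the pencil \<open>br_rev + t br_rev_wrap\<close> is isomorphic to the
  original bracket.\<close>

lemma rescale_br:
  "rescale s (br_rev w x + s ^ m *s br_rev_wrap w x) = br (rescale s w) (rescale s x)"
proof -
  let ?b = "\<lambda>k i. br (proj k w) (proj i x)"
  have "br_rev w x + s ^ m *s br_rev_wrap w x
      = (\<Sum>k<m. \<Sum>i<m. if rev_degree k + rev_degree i < m then ?b k i else s ^ m *s ?b k i)"
    unfolding br_rev_def br_rev_wrap_def scale_sum_right sum.distrib[symmetric]
    by (intro sum.cong refl) simp
  then have "rescale s (br_rev w x + s ^ m *s br_rev_wrap w x)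
      = (\<Sum>k<m. \<Sum>i<m. rescale s (if rev_degree k + rev_degree i < m then ?b k i else s ^ m *s ?b k i))"
    by (simp only: lin_sum[OF lin_rescale])
  also have "\<dots> = (\<Sum>k<m. \<Sum>i<m. (s ^ rev_degree k * s ^ rev_degree i) *s ?b k i)"
  proof (intro sum.cong refl)
    fix k i assume "k \<in> {..<m}" "i \<in> {..<m}"
    then have ki: "k < m" "i < m" by simp_all
    have r: "rescale s (?b k i) = s ^ rev_degree ((k + i) mod m) *s ?b k i"
      by (rule rescale_gr[OF br_proj_in_gr])
    show "rescale s (if rev_degree k + rev_degree i < m then ?b k i else s ^ m *s ?b k i)
        = (s ^ rev_degree k * s ^ rev_degree i) *s ?b k i"
    proof (cases "rev_degree k + rev_degree i < m")
      case True
      then show ?thesis using r rev_degree_add[OF ki] by (simp add: power_add)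
    next
      case False
      then have "s ^ m * s ^ (rev_degree k + rev_degree i - m) = s ^ rev_degree k * s ^ rev_degree i"
        by (simp add: power_add[symmetric])
      then show ?thesis using r rev_degree_add[OF ki] False by (simp add: lin_scale[OF lin_rescale])
    qed
  qed
  also have "\<dots> = br (rescale s w) (rescale s x)"
    unfolding rescale_def[of s w] br_sum_left br_scale_left
    unfolding rescale_def[of s x] br_sum_right br_scale_right scale_sum_right scale_scale ..
  finally show ?thesis .
qed

lemma dim_add_le_of_disjoint:
  assumes "subspace A" "subspace Q" "subspace U" "A \<subseteq> U" "Q \<subseteq> U" "A \<inter> Q \<subseteq> {0}"
  shows "dim A + dim Q \<le> dim U"
proof -
  have "A \<inter> Q = {0}" using assms(6) subspace_0[OF assms(1)] subspace_0[OF assms(2)] by blast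
  then have eq: "dim {x + y |x y. x \<in> A \<and> y \<in> Q} = dim A + dim Q" by (rule dim_direct_sum[OF assms(1,2)])
  have "{x + y |x y. x \<in> A \<and> y \<in> Q} \<subseteq> U" using assms(4,5) subspace_add[OF assms(3)] by blast
  from dim_subset[OF this] show ?thesis unfolding eq .
qed

text \<open>For almost all \<open>t\<close>, the operator \<open>br_rev w + t br_rev_wrap w\<close> is injective on a complement of the
  kernel of \<open>br_rev w\<close>, while for \<open>t \<noteq> 0\<close> its kernel is a rescaled centralizer.\<close>

lemma rank_le_dim_kernel_br_rev:
  assumes ss: semisimple shows "rank UNIV \<le> dim {x. br_rev w x = 0}"
proof (rule ccontr)
  let ?K = "{x. br_rev w x = 0}"
  assume "\<not> rank UNIV \<le> dim ?K"
  then have less: "dim ?K < rank UNIV" by simp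
  have sK: "subspace ?K" by (rule subspace_kernel[OF lin_br_rev])
  obtain Q where Q: "subspace Q" "Q \<inter> ?K = {0}" "dim Q + dim ?K = dim UNIV"
    using complement_exists[OF sK subspace_UNIV subset_UNIV] by blast
  have inj: "v = 0" if "v \<in> Q" "br_rev w v = 0" for v using Q(2) that by blast
  let ?F = "{s. \<exists>v\<in>Q. v \<noteq> 0 \<and> br_rev w v + s *s br_rev_wrap w v = 0}"
  have "finite ?F" by (rule pencil_injective[OF lin_br_rev lin_br_rev_wrap Q(1) inj])
  then have "finite (insert 0 ?F)" by simp
  then obtain t where t: "t \<notin> insert 0 ?F" using ex_new_if_finite[OF infinite_UNIV_char_0] by blast
  \<comment> \<open>over an algebraically closed field every parameter is an \<open>m\<close>-th power\<close>
  obtain s where s: "s ^ m = t" using nth_root_exists[OF m_pos, of t] by blast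
  have s0: "s \<noteq> 0" using s t m_pos by (auto simp: power_0_left)
  have sr: "s * inverse s = 1" "inverse s * s = 1" using s0 by simp_all
  let ?T = "\<lambda>x. br_rev w x + t *s br_rev_wrap w x"
  let ?X = "{x. ?T x = 0}" and ?Y = "{v \<in> UNIV. br (rescale s w) v = 0}"
  have T: "lin ?T" by (intro lin_plus lin_scaled lin_br_rev lin_br_rev_wrap)
  have "?Y \<subseteq> rescale s ` ?X"
  proof
    fix y assume y: "y \<in> ?Y"
    let ?x = "rescale (inverse s) y"
    have yx: "rescale s ?x = y" by (rule rescale_rescale[OF sr(1)])
    have "rescale s (?T ?x) = br (rescale s w) y"
      using rescale_br[of s w ?x] unfolding s yx .
    then have "rescale s (?T ?x) = 0" using y by simp
    then have "rescale (inverse s) (rescale s (?T ?x)) = 0" by (simp add: lin_zero[OF lin_rescale])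
    then have "?T ?x = 0" unfolding rescale_rescale[OF sr(2)] .
    then show "y \<in> rescale s ` ?X" using yx by (intro image_eqI[where x = ?x]) simp_all
  qed
  then have "dim ?Y \<le> dim (rescale s ` ?X)" by (rule dim_subset)
  also have "\<dots> \<le> dim ?X"
  proof -
    interpret pair: finite_dimensional_vector_space_pair_1 scale Basis scale by unfold_locales
    show ?thesis by (rule pair.dim_image_le[OF lin_rescale])
  qed
  finally have "rank UNIV \<le> dim ?X"
    using rank_le_dim_centralizer[OF subalgebra_UNIV nondegenerate_UNIV[OF ss], of "rescale s w"] by simp
  moreover have "dim ?X + dim Q \<le> dim UNIV"
  proof (rule dim_add_le_of_disjoint[OF subspace_kernel[OF T] Q(1) subspace_UNIV])
    show "?X \<inter> Q \<subseteq> {0}" using t by blast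
  qed simp_all
  ultimately show False using Q(3) less by linarith
qed

lemma proj_0_br_rev: "proj 0 (br_rev w x) = br (proj 0 w) (proj 0 x)"
proof -
  have "proj 0 (br_rev w x)
      = (\<Sum>k<m. \<Sum>i<m. proj 0 (if rev_degree k + rev_degree i < m then br (proj k w) (proj i x) else 0))"
    unfolding br_rev_def lin_sum[OF lin_proj] ..
  also have "\<dots> = (\<Sum>k<m. \<Sum>i<m. if i = 0 then if k = 0 then br (proj 0 w) (proj 0 x) else 0 else 0)"
  proof (intro sum.cong refl)
    fix k i assume ki: "k \<in> {..<m}" "i \<in> {..<m}"
    show "proj 0 (if rev_degree k + rev_degree i < m then br (proj k w) (proj i x) else 0)
        = (if i = 0 then if k = 0 then br (proj 0 w) (proj 0 x) else 0 else 0)"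
    proof (cases "k = 0 \<and> i = 0")
      case True
      then show ?thesis using m_pos by (simp add: rev_degree_def proj_br_proj)
    next
      case False
      have "\<not> (rev_degree k + rev_degree i < m \<and> (k + i) mod m = 0)"
      proof
        assume a: "rev_degree k + rev_degree i < m \<and> (k + i) mod m = 0"
        then have "rev_degree k + rev_degree i = 0" using rev_degree_add[of k i] ki by (simp add: rev_degree_def)
        then show False using False ki by (auto simp: rev_degree_def split: if_splits)
      qed
      then show ?thesis using False m_pos lin_zero[OF lin_proj] by (auto simp: proj_br_proj)
    qed
  qed
  finally show ?thesis using m_pos by simp
qed

text \<open>What the stabiliser of a functional in the contraction contains besides the central component of
  degree \<open>0\<close>; see \<open>dim_stabiliser\<close>.\<close>

definition reduced_kernel :: "'g \<Rightarrow> 'g set" where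
  "reduced_kernel z = {x. proj 0 x = 0 \<and> br_rev z x = 0}"

lemma subspace_reduced_kernel: "subspace (reduced_kernel z)"
  using subspace_kernel_on[OF lin_br_rev subspace_kernel[OF lin_proj], of 0 z] by (simp add: reduced_kernel_def)

lemma proj_0_idem: "proj 0 (proj 0 x) = proj 0 x"
  using proj_gr[OF proj_in_grade, of 0 0 x] m_pos by simp

text \<open>The kernel of \<open>br_rev w\<close> has dimension at least the rank, and its image in degree \<open>0\<close> centralizes
  the component of degree \<open>0\<close> of \<open>w\<close>.\<close>

lemma rank_le_dim_reduced_kernel_regular:
  assumes ss: semisimple and reg: "dim {v \<in> gr 0. br (proj 0 w) v = 0} \<le> r0"
  shows "rank UNIV \<le> dim (reduced_kernel w) + r0"
proof -
  let ?K = "{x. br_rev w x = 0}"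
  have "{x \<in> ?K. proj 0 x = 0} = reduced_kernel w" by (auto simp: reduced_kernel_def)
  then have "dim (reduced_kernel w) + dim (proj 0 ` ?K) = dim ?K"
    using dim_kernel_image[OF lin_proj subspace_kernel[OF lin_br_rev], of w 0] by simp
  moreover have "dim (proj 0 ` ?K) \<le> dim {v \<in> gr 0. br (proj 0 w) v = 0}"
  proof (rule dim_subset, rule subsetI)
    fix y assume "y \<in> proj 0 ` ?K"
    then obtain x where x: "br_rev w x = 0" "y = proj 0 x" by blast
    have "br (proj 0 w) y = 0" using proj_0_br_rev[of w x] x lin_zero[OF lin_proj] by simp
    then show "y \<in> {v \<in> gr 0. br (proj 0 w) v = 0}" using x(2) proj_in_grade by blast
  qed
  ultimately show ?thesis
    using rank_le_dim_kernel_br_rev[OF ss, of w] reg by linarith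
qed

text \<open>For almost all \<open>s\<close>, the element \<open>w = z + s h\<close> inherits the small centralizer in degree \<open>0\<close> from \<open>h\<close>,
  and its reduced kernel is at most as large as that of \<open>z\<close>.\<close>

lemma rank_le_dim_reduced_kernel:
  assumes ss: semisimple and h: "h \<in> gr 0" and reg: "dim {v \<in> gr 0. br h v = 0} \<le> r0"
  shows "rank UNIV \<le> dim (reduced_kernel z) + r0"
proof -
  let ?V = "{x. proj 0 x = 0}" and ?Z = "{v \<in> gr 0. br h v = 0}"
  have sV: "subspace ?V" by (rule subspace_kernel[OF lin_proj])
  have KVV: "reduced_kernel u \<subseteq> ?V" for u by (auto simp: reduced_kernel_def)
  obtain Q where Q: "subspace Q" "Q \<subseteq> ?V" "Q \<inter> reduced_kernel z = {0}" "dim Q + dim (reduced_kernel z) = dim ?V"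
    using complement_exists[OF subspace_reduced_kernel sV KVV, of z] by blast
  obtain P where P: "subspace P" "P \<subseteq> gr 0" "P \<inter> ?Z = {0}" "dim P + dim ?Z = dim (gr 0)"
    using complement_exists[OF subspace_kernel_on[OF lin_br subspace_gr] subspace_gr, of 0 h] by blast
  have injQ: "v = 0" if "v \<in> Q" "br_rev z v = 0" for v using Q(2,3) that by (auto simp: reduced_kernel_def)
  have injP: "v = 0" if "v \<in> P" "br h v = 0" for v using P(2,3) that by blast
  let ?F = "{s. \<exists>v\<in>Q. v \<noteq> 0 \<and> br_rev z v + s *s br_rev h v = 0}"
  let ?G = "{s. \<exists>v\<in>P. v \<noteq> 0 \<and> br h v + s *s br (proj 0 z) v = 0}"
  have F: "finite ?F" by (rule pencil_injective[OF lin_br_rev lin_br_rev Q(1) injQ])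
  have G: "finite ?G" by (rule pencil_injective[OF lin_br lin_br P(1) injP])
  have "finite (insert 0 (?F \<union> inverse ` ?G))" using F G by simp
  then obtain s where s: "s \<notin> insert 0 (?F \<union> inverse ` ?G)"
    using ex_new_if_finite[OF infinite_UNIV_char_0] by blast
  have s0: "s \<noteq> 0" and sF: "s \<notin> ?F" and sG: "inverse s \<notin> ?G"
    using s by (auto simp: image_iff)
  let ?w = "z + s *s h"
  have p0: "proj 0 ?w = proj 0 z + s *s h"
    using proj_gr[OF h, of 0] m_pos by (simp add: lin_add[OF lin_proj] lin_scale[OF lin_proj])
  have regw: "dim {v \<in> gr 0. br (proj 0 ?w) v = 0} \<le> r0"
  proof -
    let ?W = "{v \<in> gr 0. br (proj 0 ?w) v = 0}"
    have "dim ?W + dim P \<le> dim (gr 0)"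
    proof (rule dim_add_le_of_disjoint[OF subspace_kernel_on[OF lin_br subspace_gr] P(1) subspace_gr])
      show "?W \<inter> P \<subseteq> {0}"
      proof
        fix v assume v: "v \<in> ?W \<inter> P"
        have "inverse s *s (br (proj 0 z) v + s *s br h v) = 0"
          using v by (simp add: p0 br_add_left br_scale_left)
        then have "br h v + inverse s *s br (proj 0 z) v = 0"
          using s0 by (simp add: scale_right_distrib add.commute)
        then show "v \<in> {0}" using sG v by blast
      qed
    qed (use P(2) in auto)
    then show ?thesis using P(4) reg by linarith
  qed
  have "dim (reduced_kernel ?w) + dim Q \<le> dim ?V"
  proof (rule dim_add_le_of_disjoint[OF subspace_reduced_kernel Q(1) sV KVV Q(2)])
    show "reduced_kernel ?w \<inter> Q \<subseteq> {0}"
    proof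
      fix v assume v: "v \<in> reduced_kernel ?w \<inter> Q"
      have "br_rev z v + s *s br_rev h v = 0"
        using v lin_add[OF lin_br_rev_left, of z "s *s h" v] lin_scale[OF lin_br_rev_left, of s h v] by (simp add: reduced_kernel_def)
      then show "v \<in> {0}" using sF v by blast
    qed
  qed
  then show ?thesis using Q(4) rank_le_dim_reduced_kernel_regular[OF ss regw] by linarith
qed

lemma br_rev_fixed: assumes h: "h \<in> gr 0" shows "br_rev h x = br h x"
proof -
  have "br_rev h x = (\<Sum>k<m. if k = 0 then (\<Sum>i<m. br h (proj i x)) else 0)"
    unfolding br_rev_def
  proof (intro sum.cong refl)
    fix k assume k: "k \<in> {..<m}"
    show "(\<Sum>i<m. if rev_degree k + rev_degree i < m then br (proj k h) (proj i x) else 0)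
        = (if k = 0 then (\<Sum>i<m. br h (proj i x)) else 0)"
    proof (cases "k = 0")
      case True
      then have "proj k h = h" using proj_gr[OF h, of k] m_pos by simp
      then show ?thesis using True by (auto simp: rev_degree_def intro!: sum.cong)
    next
      case False
      then have p: "proj k h = 0" using proj_gr[OF h, of k] k m_pos by simp
      show ?thesis unfolding p br_zero_left using False by simp
    qed
  qed
  also have "\<dots> = br h (\<Sum>i<m. proj i x)" using m_pos by (simp add: br_sum_right)
  finally show ?thesis by (simp only: sum_proj)
qed

lemma dim_stabiliser:
  assumes ss: semisimple
  shows "dim {x. \<forall>y. killing z (br_inf \<theta> \<zeta> m x y) = 0} = dim (gr 0) + dim (reduced_kernel z)"
proof -
  interpret l: Vector_Spaces.linear scale scale "\<lambda>x. br_inf \<theta> \<zeta> m x y" for y by (rule linear_br_inf_left)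
  let ?S = "{x. \<forall>y. killing z (br_inf \<theta> \<zeta> m x y) = 0}"
  have g0: "br_inf \<theta> \<zeta> m x y = 0" if x: "x \<in> gr 0" for x y
  proof -
    have "(if i + j < m then 0 else br (proj i x) (proj j y)) = 0" if "i < m" "j < m" for i j
      using proj_gr[OF x, of i] that m_pos by (cases "i = 0") (simp_all add: br_zero_left)
    then show ?thesis unfolding br_inf_proj by (intro sum.neutral ballI) simp
  qed
  have V: "x \<in> ?S \<longleftrightarrow> br_rev z x = 0" if "proj 0 x = 0" for x
    using killing_br_inf[OF that] killing_nondegenerate[OF ss] by (auto simp: killing_zero_left)
  have shift: "x \<in> ?S \<longleftrightarrow> x - proj 0 x \<in> ?S" for x
    using g0[OF proj_in_grade] by (simp add: l.diff)
  have "?S = {a + b |a b. a \<in> gr 0 \<and> b \<in> reduced_kernel z}"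
  proof (intro equalityI subsetI)
    fix x assume "x \<in> ?S"
    then have "x - proj 0 x \<in> ?S" using shift by blast
    moreover have "proj 0 (x - proj 0 x) = 0" by (simp add: lin_diff[OF lin_proj] proj_0_idem)
    ultimately have "x - proj 0 x \<in> reduced_kernel z" using V by (simp add: reduced_kernel_def)
    moreover have "x = proj 0 x + (x - proj 0 x)" by simp
    ultimately show "x \<in> {a + b |a b. a \<in> gr 0 \<and> b \<in> reduced_kernel z}" using proj_in_grade by blast
  next
    fix x assume "x \<in> {a + b |a b. a \<in> gr 0 \<and> b \<in> reduced_kernel z}"
    then obtain a b where x: "x = a + b" and a: "a \<in> gr 0" and b: "b \<in> reduced_kernel z" by blast
    have "b \<in> ?S" using b V unfolding reduced_kernel_def by blast
    then show "x \<in> ?S" using g0[OF a] by (simp add: x l.add)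
  qed
  moreover have "gr 0 \<inter> reduced_kernel z = {0}"
  proof
    show "gr 0 \<inter> reduced_kernel z \<subseteq> {0}"
    proof
      fix x assume "x \<in> gr 0 \<inter> reduced_kernel z"
      then show "x \<in> {0}" using proj_gr[of x 0 0] m_pos by (simp add: reduced_kernel_def)
    qed
    show "{0} \<subseteq> gr 0 \<inter> reduced_kernel z" using subspace_0[OF subspace_gr] subspace_0[OF subspace_reduced_kernel] by blast
  qed
  ultimately show ?thesis using dim_direct_sum[OF subspace_gr subspace_reduced_kernel] by simp
qed

text \<open>A regular fixed element \<open>h\<close> acts through the original bracket, so its reduced kernel is the part
  without fixed points of its centralizer, a Cartan subalgebra.\<close>

lemma dim_reduced_kernel_regular:
  assumes ss: semisimple
  shows "\<exists>h\<in>gr 0. dim {v \<in> gr 0. br h v = 0} = rank (gr 0) \<and> rank UNIV = rank (gr 0) + dim (reduced_kernel h)"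
proof -
  obtain H where H: "cartan_subalgebra (gr 0) H" "rank (gr 0) = dim H"
    using rank_cartan[OF subalgebra_gr_0] by blast
  obtain h where h: "h \<in> H" and C: "fitting UNIV h = {v. br h v = 0}" and CH: "fitting UNIV h \<inter> gr 0 = H"
    and ab: "\<And>c c'. c \<in> fitting UNIV h \<Longrightarrow> c' \<in> fitting UNIV h \<Longrightarrow> br c c' = 0"
    using regular_element_fixed[OF ss H(1)] by blast
  have h0: "h \<in> gr 0" using h CH by blast
  have rk: "rank UNIV = dim (fitting UNIV h)"
    by (rule rank_eq_abelian_fitting[OF subalgebra_UNIV nondegenerate_UNIV[OF ss] UNIV_I ab])
  have Z: "{v \<in> gr 0. br h v = 0} = H" using C CH by blast
  have reduced_kernel: "reduced_kernel h = {x \<in> fitting UNIV h. proj 0 x = 0}" unfolding reduced_kernel_def br_rev_fixed[OF h0] C by blast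
  have "proj 0 ` fitting UNIV h = H"
  proof
    show "proj 0 ` fitting UNIV h \<subseteq> H"
    proof
      fix y assume "y \<in> proj 0 ` fitting UNIV h"
      then obtain x where x: "br h x = 0" "y = proj 0 x" using C by blast
      have "br h y = proj 0 (br_rev h x)"
        using proj_0_br_rev[of h x] proj_gr[OF h0, of 0] m_pos x(2) by simp
      then have "br h y = 0" using x(1) br_rev_fixed[OF h0] lin_zero[OF lin_proj] by simp
      then show "y \<in> H" using x(2) proj_in_grade Z by blast
    qed
    show "H \<subseteq> proj 0 ` fitting UNIV h"
    proof
      fix y assume y: "y \<in> H"
      then have "y = proj 0 y" using proj_gr[of y 0 0] CH m_pos by auto
      then show "y \<in> proj 0 ` fitting UNIV h" using y CH by blast
    qed
  qed
  then have "dim (reduced_kernel h) + dim H = dim (fitting UNIV h)"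
    using dim_kernel_image[OF lin_proj subspace_fitting[OF subspace_UNIV], of h 0] unfolding reduced_kernel by simp
  then show ?thesis using h0 Z H(2) rk by auto
qed

lemma index_br_inf:
  assumes ss: semisimple
  shows "int (lie_algebra.index scale (br_inf \<theta> \<zeta> m)) = int (dim (gr 0)) + int (rank UNIV) - int (rank (gr 0))"
proof -
  interpret inf: lie_algebra scale Basis "br_inf \<theta> \<zeta> m" by (rule lie_algebra_br_inf)
  obtain h where h: "h \<in> gr 0" "dim {v \<in> gr 0. br h v = 0} = rank (gr 0)"
    "rank UNIV = rank (gr 0) + dim (reduced_kernel h)" using dim_reduced_kernel_regular[OF ss] by blast
  have stab: "inf.stabiliser (killing z) = {x. \<forall>y. killing z (br_inf \<theta> \<zeta> m x y) = 0}" for z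
    unfolding inf.stabiliser_def inf.coad_def by (auto simp: fun_eq_iff)
  have ds: "dim (inf.stabiliser (killing z)) = dim (gr 0) + dim (reduced_kernel z)" for z
    unfolding stab by (rule dim_stabiliser[OF ss])
  have "inf.index = dim (gr 0) + dim (reduced_kernel h)"
    unfolding inf.index_def
  proof (rule Least_equality)
    show "\<exists>\<xi>\<in>inf.dual. dim (inf.stabiliser \<xi>) = dim (gr 0) + dim (reduced_kernel h)"
      using ds[of h] killing_lin[of h] unfolding inf.dual_def by blast
    fix d assume "\<exists>\<xi>\<in>inf.dual. dim (inf.stabiliser \<xi>) = d"
    then obtain \<xi> where \<xi>: "Vector_Spaces.linear scale (*) \<xi>" "dim (inf.stabiliser \<xi>) = d"
      unfolding inf.dual_def by blast
    from killing_represents[OF ss \<xi>(1)] obtain z where "\<xi> = killing z" by blast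
    then have "d = dim (gr 0) + dim (reduced_kernel z)" using ds \<xi>(2) by simp
    moreover have "rank UNIV \<le> dim (reduced_kernel z) + rank (gr 0)"
      by (rule rank_le_dim_reduced_kernel[OF ss h(1)]) (simp add: h(2))
    ultimately show "dim (gr 0) + dim (reduced_kernel h) \<le> d" using h(3) by simp
  qed
  then show ?thesis using h(3) by simp
qed

end

theorem theorem3p2:
  fixes scale :: "'k::{alg_closed_field,field_char_0} \<Rightarrow> 'g::ab_group_add \<Rightarrow> 'g"
    and Basis :: "'g set"
    and br :: "'g \<Rightarrow> 'g \<Rightarrow> 'g"
    and \<theta> :: "'g \<Rightarrow> 'g"
    and m :: nat
    and \<zeta> :: 'k
  assumes "lie_algebra scale Basis br"
    and "lie_algebra.semisimple scale br"
    and "lie_algebra.automorphism scale br \<theta>"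
    and "has_order \<theta> m"
    and "m \<ge> 2"
    and "primitive_root_of_unity m \<zeta>"
  shows "int (lie_algebra.index scale (lie_algebra.br_inf scale br \<theta> \<zeta> m)) =
    int (vector_space.dim scale (lie_algebra.grade scale \<theta> \<zeta> 0))
    + int (lie_algebra.rank scale br UNIV)
    - int (lie_algebra.rank scale br (lie_algebra.grade scale \<theta> \<zeta> 0))"
proof -
  interpret lie_algebra scale Basis br by (rule assms(1))
  interpret lie_algebra_automorphism scale Basis br \<theta> \<zeta> m
    by unfold_locales (rule assms(3,4,6))+
  show ?thesis by (rule index_br_inf[OF assms(2)])
qed

end
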